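(* Assume the Riemann Hypothesis. For an integer $n\ge 1$ let \[ r'_{2,2}(n)=\sum_{\substack{p \text{ prime},\ m\ge 1 \text{ integer}\\ p^2+m^2=n}}\log p . \] Then there is an absolute constant $K>0$ with the following property: for every function $H=H(N)$ taking positive integer values and satisfying $H/(N^{1/2}(\log N)^2)\to\infty$ and $H/N\to 0$ as $N\to\infty$, one has, for all sufficiently large integers $N$, \[ \Bigl|\sum_{n=N+1}^{N+H} r'_{2,2}(n)-\frac{\pi}{4}H\Bigr|\le K\Bigl(\frac{H^2}{N}+\frac{H\log\log N}{(\log N)^{1/2}}\Bigr). \]
   Context: The statement is an asymptotic formula as $N\to\infty$, uniform in $H$ in the indicated range (the implied constant does not depend on $H$). *)

theory Defs
  imports "HOL-Complex_Analysis.Complex_Analysis" "HOL-Computational_Algebra.Primes"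
    "HOL-Real_Asymp.Real_Asymp"
begin

definition zeta_domain :: "complex set"
  where "zeta_domain = {s. 0 < Re s} - {1}"

definition continues_zeta :: "(complex \<Rightarrow> complex) \<Rightarrow> bool"
  where "continues_zeta f \<longleftrightarrow>
    f holomorphic_on zeta_domain \<and>
    (\<forall>s. 1 < Re s \<longrightarrow> (\<lambda>n. 1 / of_nat (Suc n) powr s) sums f s)"

text \<open>
  The Riemann zeta function, as the analytic continuation of its Dirichlet series. Continuing to
  the punctured half-plane, which contains the critical strip, is enough to state the Riemann
  Hypothesis; the values outside \<^term>\<open>zeta_domain\<close> are unspecified.
  Existence and uniqueness of the continuation are proved below.
\<close>

definition riemann_zeta :: "complex \<Rightarrow> complex"
  where "riemann_zeta = (SOME f. continues_zeta f)"

definition Riemann_Hypothesis :: bool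
  where "Riemann_Hypothesis \<longleftrightarrow>
    (\<forall>s. 0 < Re s \<and> Re s < 1 \<and> riemann_zeta s = 0 \<longrightarrow> Re s = 1 / 2)"

lemma norm_powr_minus_diff_le:
  fixes m x :: real and s :: complex
  assumes m: "1 \<le> m" "m \<le> x" "x \<le> m + 1" and s: "0 \<le> Re s"
  shows "norm (of_real x powr (-s) - of_real m powr (-s)) \<le> norm s * m powr (- Re s - 1)"
proof -
  have "norm (of_real x powr (-s) - of_real m powr (-s))
        \<le> norm s * m powr (- Re s - 1) * norm (of_real x - of_real m :: complex)"
  proof (rule field_differentiable_bound[where S = "closed_segment (of_real m) (of_real x)"
        and f = "\<lambda>z. z powr (-s)" and x = "of_real x" and y = "of_real m" and f' = "\<lambda>z. - s * z powr (- s - 1)"])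
    fix z :: complex assume "z \<in> closed_segment (of_real m) (of_real x)"
    then have "z \<in> of_real ` closed_segment m x"
      by (simp add: closed_segment_of_real)
    then obtain t where t: "z = of_real t" "m \<le> t"
      using m by (auto simp: closed_segment_eq_real_ivl)
    then have "z \<notin> \<real>\<^sub>\<le>\<^sub>0"
      using m by (simp add: complex_nonpos_Reals_iff)
    from has_field_derivative_powr[OF this]
    show "((\<lambda>z. z powr (-s)) has_field_derivative - s * z powr (- s - 1))
        (at z within closed_segment (of_real m) (of_real x))"
      by (rule has_field_derivative_at_within)
    have "t powr (- Re s - 1) \<le> m powr (- Re s - 1)"
      using t m s by (intro powr_mono2') auto
    then show "norm (- s * z powr (- s - 1)) \<le> norm s * m powr (- Re s - 1)"
      using t m by (simp add: norm_mult norm_powr_real_powr mult_left_mono)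
  qed auto
  also have "\<dots> \<le> norm s * m powr (- Re s - 1) * 1"
    using m by (intro mult_left_mono) (auto simp flip: of_real_diff)
  finally show ?thesis by simp
qed

text \<open>Terms of a series for \<open>(s - 1) \<zeta>(s) - 1\<close> that converges for \<open>Re s > 0\<close>.\<close>

definition zeta_term :: "nat \<Rightarrow> complex \<Rightarrow> complex"
  where "zeta_term n s = (s - 1) * of_nat (Suc n) powr (-s)
    + (of_nat (Suc (Suc n)) powr (1 - s) - of_nat (Suc n) powr (1 - s))"

lemma norm_zeta_term_le:
  assumes s: "0 \<le> Re s"
  shows "norm (zeta_term n s) \<le> norm (1 - s) * norm s * real (Suc n) powr (- Re s - 1)"
proof -
  define m where "m = real (Suc n)"
  define g where "g = (\<lambda>z::complex. z powr (1 - s) + (s - 1) * z * of_real m powr (-s))"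
  have m: "m \<ge> 1" by (simp add: m_def)
  have "norm (g (of_real (m + 1)) - g (of_real m))
        \<le> (norm (1 - s) * (norm s * m powr (- Re s - 1))) * norm (of_real (m + 1) - of_real m :: complex)"
  proof (rule field_differentiable_bound[where S = "closed_segment (of_real m) (of_real (m + 1))"
        and f = g and x = "of_real (m + 1)" and y = "of_real m" and f' = "\<lambda>z. (1 - s) * (z powr (- s) - of_real m powr (- s))"])
    fix z :: complex assume "z \<in> closed_segment (of_real m) (of_real (m + 1))"
    then have "z \<in> of_real ` closed_segment m (m + 1)"
      by (simp only: closed_segment_of_real)
    then obtain t where t: "z = of_real t" "m \<le> t" "t \<le> m + 1"
      by (auto simp: closed_segment_eq_real_ivl)
    have nz: "z \<notin> \<real>\<^sub>\<le>\<^sub>0"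
      using t m by (simp add: complex_nonpos_Reals_iff)
    have deriv: "(g has_field_derivative
        (1 - s) * z powr (1 - s - 1) + (s - 1) * 1 * of_real m powr (- s)) (at z)"
      unfolding g_def
      by (intro DERIV_add has_field_derivative_powr[OF nz] DERIV_cmult_right DERIV_cmult DERIV_ident)
    have "(1 - s) * z powr (1 - s - 1) + (s - 1) * 1 * of_real m powr (- s)
        = (1 - s) * (z powr (- s) - of_real m powr (- s))" by (simp add: algebra_simps)
    with deriv show "(g has_field_derivative (1 - s) * (z powr (- s) - of_real m powr (- s)))
        (at z within closed_segment (of_real m) (of_real (m + 1)))"
      by (simp only: has_field_derivative_at_within)
    show "norm ((1 - s) * (z powr (- s) - of_real m powr (- s)))
        \<le> norm (1 - s) * (norm s * m powr (- Re s - 1))"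
      unfolding norm_mult t(1) using norm_powr_minus_diff_le[OF m t(2,3) s]
      by (intro mult_left_mono) auto
  qed auto
  moreover have "g (of_real (m + 1)) - g (of_real m) = zeta_term n s"
    by (simp add: g_def zeta_term_def m_def algebra_simps)
  ultimately show ?thesis by (simp add: m_def mult.assoc flip: of_real_diff)
qed

lemma continues_zeta_exists: "\<exists>f. continues_zeta f"
proof -
  define S where "S = {s. 0 < Re s}"
  have S: "open S" by (simp add: S_def open_halfspace_Re_gt)
  have hol: "zeta_term n holomorphic_on S" for n
    unfolding zeta_term_def by (intro holomorphic_intros) (auto simp: complex_nonpos_Reals_iff)
  have "\<exists>g g'. \<forall>x\<in>S. (\<lambda>n. zeta_term n x) sums g x \<and> (\<lambda>n. deriv (zeta_term n) x) sums g' x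
      \<and> (g has_field_derivative g' x) (at x)"
  proof (rule series_and_derivative_comparison_local[OF S])
    fix n x assume "x \<in> S"
    then show "(zeta_term n has_field_derivative deriv (zeta_term n) x) (at x)"
      by (rule holomorphic_derivI[OF hol S])
  next
    fix x assume x: "x \<in> S"
    define d where "d = Re x / 2"
    define C where "C = (1 + norm x + d) * (norm x + d)"
    have d: "d > 0" using x by (simp add: d_def S_def)
    have le: "norm (zeta_term n y) \<le> C * real (Suc n) powr (- d - 1)" if y: "y \<in> ball x d" for n y
    proof -
      have n: "norm (x - y) < d" using y by (simp add: dist_norm)
      have re: "Re y \<ge> d"
        using abs_Re_le_cmod[of "x - y"] n by (simp add: d_def)
      have ny: "norm y \<le> norm x + d"
        using norm_triangle_ineq4[of x "x - y"] n by simp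
      have n1: "norm (1 - y) \<le> 1 + norm x + d"
        using norm_triangle_ineq4[of 1 y] ny by simp
      have "norm (zeta_term n y) \<le> norm (1 - y) * norm y * real (Suc n) powr (- Re y - 1)"
        using re d by (intro norm_zeta_term_le) auto
      also have "\<dots> \<le> C * real (Suc n) powr (- d - 1)"
        unfolding C_def using ny n1 re d by (intro mult_mono powr_mono) auto
      finally show ?thesis .
    qed
    have "summable (\<lambda>n. real n powr (- d - 1))"
      using d by (simp add: summable_real_powr_iff)
    then have "summable (\<lambda>n. C * real (Suc n) powr (- d - 1))"
      by (subst (asm) summable_Suc_iff[symmetric]) (rule summable_mult)
    then show "\<exists>d h. 0 < d \<and> summable h
        \<and> (\<forall>\<^sub>F n in sequentially. \<forall>y\<in>ball x d \<inter> S. norm (zeta_term n y) \<le> h n)"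
      using d le by (intro exI[of _ d] exI[of _ "\<lambda>n. C * real (Suc n) powr (- d - 1)"]) auto
  qed
  then obtain g g' where g: "\<And>x. x \<in> S \<Longrightarrow> (\<lambda>n. zeta_term n x) sums g x"
    and g': "\<And>x. x \<in> S \<Longrightarrow> (g has_field_derivative g' x) (at x)" by blast
  have "g holomorphic_on S"
    using g' S holomorphic_on_open by blast
  then have "g holomorphic_on zeta_domain"
    by (rule holomorphic_on_subset) (auto simp: zeta_domain_def S_def)
  then have "(\<lambda>s. (1 + g s) / (s - 1)) holomorphic_on zeta_domain"
    by (intro holomorphic_intros) (auto simp: zeta_domain_def)
  moreover have "(\<lambda>n. 1 / of_nat (Suc n) powr s) sums ((1 + g s) / (s - 1))" if s: "1 < Re s" for s
  proof -
    have "(\<lambda>n. real (Suc n) powr (1 - Re s)) \<longlonglongrightarrow> 0"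
      using s by real_asymp
    then have "(\<lambda>n. of_nat (Suc n) powr (1 - s)) \<longlonglongrightarrow> (0 :: complex)"
      by (subst tendsto_norm_zero_iff[symmetric])
        (simp add: norm_powr_real_powr del: of_nat_Suc)
    then have "(\<lambda>n. of_nat (Suc (Suc n)) powr (1 - s) - of_nat (Suc n) powr (1 - s))
        sums (0 - of_nat (Suc 0) powr (1 - s) :: complex)"
      by (rule telescope_sums)
    note telescope = this
    have "(\<lambda>n. zeta_term n s) sums g s"
      using s by (intro g) (simp add: S_def)
    from sums_diff[OF this telescope]
    have "(\<lambda>n. (s - 1) * of_nat (Suc n) powr (-s)) sums (g s - (0 - of_nat (Suc 0) powr (1 - s)))"
      unfolding zeta_term_def add_diff_cancel_right' .
    moreover have "g s - (0 - of_nat (Suc 0) powr (1 - s)) = 1 + g s" by simp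
    ultimately have "(\<lambda>n. (s - 1) * of_nat (Suc n) powr (-s)) sums (1 + g s)"
      by (simp only:)
    then have "(\<lambda>n. (s - 1) * of_nat (Suc n) powr (-s) / (s - 1)) sums ((1 + g s) / (s - 1))"
      by (rule sums_divide)
    moreover have "s \<noteq> 1" using s by auto
    ultimately show ?thesis
      by (simp add: powr_minus_divide del: of_nat_Suc)
  qed
  ultimately show ?thesis unfolding continues_zeta_def by blast
qed

lemma continues_zeta_riemann_zeta: "continues_zeta riemann_zeta"
  unfolding riemann_zeta_def using continues_zeta_exists by (rule someI_ex)

lemma continues_zeta_unique:
  assumes f: "continues_zeta f" and s: "s \<in> zeta_domain"
  shows "f s = riemann_zeta s"
proof -
  have "connected {s. 0 < Re s}" by (intro convex_connected convex_halfspace_Re_gt)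
  then have conn: "connected zeta_domain" unfolding zeta_domain_def
    by (intro connected_open_delete) (auto simp: open_halfspace_Re_gt)
  have op: "open zeta_domain" unfolding zeta_domain_def
    by (intro open_delete open_halfspace_Re_gt)
  have ne: "{s. 1 < Re s} \<noteq> {}" by (auto intro: exI[of _ 2])
  have sub: "{s. 1 < Re s} \<subseteq> zeta_domain" by (auto simp: zeta_domain_def)
  have hol: "f holomorphic_on zeta_domain" "riemann_zeta holomorphic_on zeta_domain"
    using f continues_zeta_riemann_zeta by (auto simp: continues_zeta_def)
  have "f z = riemann_zeta z" if "1 < Re z" for z
    using f continues_zeta_riemann_zeta that sums_unique2
    unfolding continues_zeta_def by blast
  then show ?thesis
    using analytic_continuation_open[OF open_halfspace_Re_gt op ne conn sub hol _ s] by simp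
qed

definition r22' :: "nat \<Rightarrow> real"
  where "r22' n = (\<Sum>(p, m) | prime p \<and> 1 \<le> m \<and> p\<^sup>2 + m\<^sup>2 = n. ln (real p))"

lemma finite_r22'_index:
  "finite {(p, m). prime (p :: nat) \<and> 1 \<le> m \<and> p\<^sup>2 + m\<^sup>2 = (n :: nat)}"
proof (rule finite_subset)
  show "{(p, m). prime (p :: nat) \<and> 1 \<le> m \<and> p\<^sup>2 + m\<^sup>2 = n}
      \<subseteq> {..n} \<times> {..n}"
    using power2_nat_le_imp_le le_add1 le_add2 by fast
qed simp

end

theory Submission
  imports Defs "HOL-Number_Theory.Prime_Powers"
begin

text \<open>
  Counting the \<open>m\<close> that go with a given prime \<open>p\<close> turns the sum into
  \<open>\<Sum>\<^sub>p log p (f(p) + O(1))\<close>, where \<open>f(x) = \<surd>(N + H - x\<^sup>2) - \<surd>(N - x\<^sup>2)\<close> (negative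
  radicands replaced by \<open>0\<close>) and \<open>p \<le> \<surd>(N + H)\<close>. The bounded errors add up to
  \<open>O(\<surd>N) = O(H / log\<^sup>2 N)\<close>, so no exponential sums are needed. In the remaining smooth sum one
  replaces \<open>log p\<close> by \<open>1\<close> on average, which produces the area \<open>\<pi> H / 4\<close> of a quarter annulus;
  the cost of this is controlled by partial summation and the prime number theorem with a
  power-saving error term. Only near \<open>x = \<surd>N\<close>, where \<open>f\<close> is steep, is the trivial bound used.

  The prime number theorem is obtained from the Riemann Hypothesis by Newman's contour method
  for the Dirichlet series with coefficients \<open>\<Lambda>(n) - 1\<close>. The hypothesis allows the left part of the
  contour to lie on \<open>Re z = -1/4\<close>, with \<open>\<zeta>'/\<zeta>\<close> bounded there by the Borel--Caratheodory
  inequality, so that a radius equal to a small power of \<open>N\<close> is admissible.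
\<close>

section \<open>Dirichlet series and the von Mangoldt function\<close>

text \<open>The target loses only powers of log N against H, so any fixed power saving for primes
  will do. This is why a linear bound for the logarithmic derivative, an abscissa well inside the
  zero-free half-plane and the weak exponent 31/32 are accepted. \<open>Riemann_Hypothesis\<close>
  speaks of 0 < Re s < 1 alone. That zeta has no zeros with Re s >= 1 is a separate matter: Re s > 1
  is settled by integrating the logarithmic derivative, Re s = 1 by Mertens' inequality. The
  delicate point at the end is that H may be little more than sqrt N. Then f is about H / sqrt N for
  most x, while the two chords of which it is the difference have length up to about sqrt N; partial
  summation on each chord separately would lose this cancellation and is affordable only for H close
  to N. Otherwise f itself is used: it increases up to sqrt N, so its variation is bounded by its
  last value, and the range is cut short of sqrt N, where f climbs to about sqrt H.\<close>

definition dirichlet_series :: "(nat \<Rightarrow> complex) \<Rightarrow> complex \<Rightarrow> complex"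
  where "dirichlet_series a s = (\<Sum>n. a n * of_nat n powr (-s))"

text \<open>Both sides are 0 at n = 0, since \<open>0 powr w = 0\<close>; this convention lets all
  Dirichlet series run over the whole type \<open>nat\<close>.\<close>

lemma norm_of_nat_powr: "norm (of_nat n powr s :: complex) = real n powr Re s"
  by (cases "n = 0") (simp_all add: norm_powr_real_powr)

text \<open>Absolute convergence in the open half-plane is locally uniform there, so the series may
  be differentiated term by term.\<close>

lemma dirichlet_series_sums_deriv:
  fixes a :: "nat \<Rightarrow> complex"
  assumes sm: "\<And>\<sigma>. \<sigma> > 1 \<Longrightarrow> summable (\<lambda>n. norm (a n) * real n powr (-\<sigma>))"
    and s: "Re s > 1"
  shows "(\<lambda>n. a n * of_nat n powr (-s)) sums dirichlet_series a s"
    and "(dirichlet_series a has_field_derivative dirichlet_series (\<lambda>n. - (of_real (ln (real n)) * a n)) s) (at s)"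
proof -
  define S where "S = {s. Re s > 1}"
  have S: "open S" by (simp add: S_def open_halfspace_Re_gt)
  have "\<exists>g g'. \<forall>x\<in>S. (\<lambda>n. a n * of_nat n powr (-x)) sums g x
      \<and> (\<lambda>n. - (of_real (ln (real n)) * a n) * of_nat n powr (-x)) sums g' x
      \<and> (g has_field_derivative g' x) (at x)"
  proof (rule series_and_derivative_comparison_local[OF S])
    fix n x assume "x \<in> S"
    show "((\<lambda>x. a n * of_nat n powr (-x)) has_field_derivative
        - (of_real (ln (real n)) * a n) * of_nat n powr (-x)) (at x)"
    proof (cases "n = 0")
      case False
      then show ?thesis
        by (auto intro!: derivative_eq_intros simp: powr_def exp_minus Ln_of_nat)
    qed simp
  next
    fix x assume x: "x \<in> S"
    \<comment> \<open>Half the distance to the line Re = 1: on the ball of this radius every term is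
      dominated by the one at the real point 1 + d.\<close>
    define d where "d = (Re x - 1) / 2"
    have d: "d > 0" using x by (simp add: d_def S_def)
    have le: "norm (a n * of_nat n powr (-y)) \<le> norm (a n) * real n powr (-(1 + d))"
      if y: "y \<in> ball x d" for n y
    proof -
      have "Re y \<ge> 1 + d"
        using abs_Re_le_cmod[of "x - y"] y by (simp add: d_def dist_norm field_simps)
      then show ?thesis
        by (cases "n = 0") (auto simp: norm_mult norm_of_nat_powr intro!: mult_left_mono powr_mono)
    qed
    show "\<exists>d h. 0 < d \<and> summable h
        \<and> (\<forall>\<^sub>F n in sequentially. \<forall>y\<in>ball x d \<inter> S. norm (a n * of_nat n powr (-y)) \<le> h n)"
      using d le sm[of "1 + d"]
      by (intro exI[of _ d] exI[of _ "\<lambda>n. norm (a n) * real n powr (-(1+d))"]) auto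
  qed
  then obtain g g' where g: "\<And>x. x \<in> S \<Longrightarrow> (\<lambda>n. a n * of_nat n powr (-x)) sums g x"
    "\<And>x. x \<in> S \<Longrightarrow> (\<lambda>n. - (of_real (ln (real n)) * a n) * of_nat n powr (-x)) sums g' x"
    "\<And>x. x \<in> S \<Longrightarrow> (g has_field_derivative g' x) (at x)" by blast
  have eq: "g x = dirichlet_series a x" "g' x = dirichlet_series (\<lambda>n. - (of_real (ln (real n)) * a n)) x" if "x \<in> S" for x
    using sums_unique[OF g(1)[OF that]] sums_unique[OF g(2)[OF that]] by (simp_all only: dirichlet_series_def)
  have sS: "s \<in> S" using s by (simp add: S_def)
  show "(\<lambda>n. a n * of_nat n powr (-s)) sums dirichlet_series a s"
    using g(1)[OF sS] unfolding eq(1)[OF sS] .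
  have "(dirichlet_series a has_field_derivative g' s) (at s)"
    by (rule has_field_derivative_transform_within_open[OF g(3)[OF sS] S sS]) (rule eq(1))
  then show "(dirichlet_series a has_field_derivative dirichlet_series (\<lambda>n. - (of_real (ln (real n)) * a n)) s) (at s)"
    unfolding eq(2)[OF sS] .
qed

lemma summable_ln_powr:
  fixes \<sigma> :: real
  assumes "\<sigma> > 1"
  shows "summable (\<lambda>n. ln (real n) * real n powr (-\<sigma>))"
proof -
  \<comment> \<open>Half of the excess of \<sigma> over 1 absorbs the logarithm, the other half
    keeps the series convergent.\<close>
  define d where "d = (\<sigma> - 1) / 2"
  have d: "d > 0" "\<sigma> = 1 + d + d" using assms by (auto simp: d_def field_simps)
  have "summable (\<lambda>n. 1 / d * real n powr (-(1+d)))"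
    using d by (intro summable_mult) (simp add: summable_real_powr_iff)
  then show ?thesis
  proof (rule summable_comparison_test')
    fix n :: nat assume n: "n \<ge> 1"
    have "ln (real n) \<le> real n powr d / d" using n d by (intro ln_powr_bound) auto
    then have "ln (real n) * real n powr (-\<sigma>) \<le> real n powr d / d * real n powr (-\<sigma>)"
      by (intro mult_right_mono) auto
    also have "\<dots> = 1 / d * real n powr (-(1+d))"
      by (simp add: d(2) powr_add[symmetric] field_simps)
    finally show "norm (ln (real n) * real n powr (-\<sigma>)) \<le> 1 / d * real n powr (-(1+d))"
      using n by simp
  qed
qed

lemma mangoldt_le_ln: "mangoldt n \<le> ln (real n)"
  using mangoldt_le[of n] by (cases "n = 0") auto

lemma summable_mangoldt_powr:
  fixes \<sigma> :: real
  assumes "\<sigma> > 1"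
  shows "summable (\<lambda>n. norm (mangoldt n :: complex) * real n powr (-\<sigma>))"
  using summable_ln_powr[OF assms]
  by (rule summable_comparison_test') (auto intro!: mult_right_mono mangoldt_le_ln simp: mangoldt_nonneg)

lemma zeta_sums:
  assumes "Re s > 1"
  shows "(\<lambda>n. 1 * of_nat n powr (-s)) sums riemann_zeta s"
proof -
  have "(\<lambda>n. of_nat (Suc n) powr (-s)) sums riemann_zeta s"
    using continues_zeta_riemann_zeta assms
    by (simp add: continues_zeta_def powr_minus_divide del: of_nat_Suc)
  then show ?thesis
    by (subst (asm) sums_Suc_iff) simp
qed

lemma zeta_eq_dirichlet_series: "Re s > 1 \<Longrightarrow> riemann_zeta s = dirichlet_series (\<lambda>_. 1) s"
  using zeta_sums[of s] by (simp add: dirichlet_series_def sums_iff)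

lemma abs_summable_on_dirichlet:
  fixes a :: "nat \<Rightarrow> complex"
  assumes "summable (\<lambda>n. norm (a n) * real n powr (-Re s))"
  shows "(\<lambda>n. norm (a n * of_nat n powr (-s))) summable_on {1..}"
  using assms
  by (intro summable_on_subset_banach[OF norm_summable_imp_summable_on])
     (auto simp: norm_mult norm_of_nat_powr)

lemma infsum_dirichlet:
  fixes a :: "nat \<Rightarrow> complex"
  assumes "summable (\<lambda>n. norm (a n) * real n powr (-Re s))"
  shows "infsum (\<lambda>n. a n * of_nat n powr (-s)) {1..} = dirichlet_series a s"
proof -
  define f where "f = (\<lambda>n. a n * of_nat n powr (-s))"
  have "f summable_on {1..}"
    unfolding f_def by (rule abs_summable_summable[OF abs_summable_on_dirichlet[OF assms]])
  then have "(f has_sum infsum f {1..}) {1..}" by (rule has_sum_infsum)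
  also have "?this \<longleftrightarrow> (f has_sum infsum f {1..}) UNIV"
    by (rule has_sum_cong_neutral) (auto simp: f_def not_le)
  finally have "f sums infsum f {1..}" by (rule has_sum_imp_sums)
  then show ?thesis
    unfolding dirichlet_series_def f_def by (rule sums_unique)
qed

text \<open>The divisor sum \<open>mangoldt_sum\<close> transported to series: absolute convergence
  permits regrouping the double sum over (d, m) by the product n = d m.\<close>

lemma mangoldt_dirichlet_series_times_zeta:
  assumes s: "Re s > 1"
  shows "dirichlet_series mangoldt s * riemann_zeta s = dirichlet_series (\<lambda>n. of_real (ln (real n))) s"
proof -
  define f where "f = (\<lambda>d. mangoldt d * of_nat d powr (-s) :: complex)"
  define g where "g = (\<lambda>d. 1 * of_nat d powr (-s) :: complex)"
  have smz: "summable (\<lambda>n. norm (1::complex) * real n powr (-Re s))"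
    using s by (simp add: summable_real_powr_iff)
  have fs: "(\<lambda>n. norm (f n)) summable_on {1..}" unfolding f_def
    using s by (intro abs_summable_on_dirichlet summable_mangoldt_powr) auto
  have gs: "(\<lambda>n. norm (g n)) summable_on {1..}" unfolding g_def
    using smz by (intro abs_summable_on_dirichlet) auto
  have fgs: "(\<lambda>z. norm (case z of (x,y) \<Rightarrow> f x * g y)) summable_on {1..} \<times> {1..}"
  proof (rule Infinite_Sum.abs_summable_on_Sigma_iff[THEN iffD2], intro conjI ballI)
    show "(\<lambda>y. norm (case (x, y) of (x, y) \<Rightarrow> f x * g y)) summable_on {1..}" for x
      using gs by (simp add: norm_mult summable_on_cmult_right)
    show "(\<lambda>x. norm (\<Sum>\<^sub>\<infinity>y\<in>{1..}. norm (case (x, y) of (x, y) \<Rightarrow> f x * g y))) summable_on {1..}"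
      using fs by (simp add: norm_mult infsum_cmult_right' abs_mult summable_on_cmult_left)
  qed
  \<comment> \<open>Mutually inverse maps between pairs (d, m) of positive integers and pairs (n, d)
    with d dividing n.\<close>
  let ?i = "\<lambda>(n,d). (d, n div d) :: nat \<times> nat" and ?j = "\<lambda>(d,m). (d * m, d) :: nat \<times> nat"
  have wit: "?i (?j z) = z" "?j z \<in> Sigma {1..} (\<lambda>n. {d. d dvd n})"
    if "z \<in> {1..} \<times> {1..}" for z :: "nat \<times> nat" using that by (auto simp: Suc_le_eq)
  have wit': "?j (?i z) = z" "?i z \<in> {1..} \<times> {1..}"
    if "z \<in> Sigma {1..} (\<lambda>n. {d. d dvd n})" for z :: "nat \<times> nat"
    using that by (auto simp: Suc_le_eq dvd_pos_nat elim!: dvdE)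
  have "dirichlet_series mangoldt s * dirichlet_series (\<lambda>_. 1) s = infsum f {1..} * infsum g {1..}"
    unfolding f_def g_def
    by (simp only: infsum_dirichlet[OF smz] infsum_dirichlet[OF summable_mangoldt_powr[OF s]])
  also have "\<dots> = (\<Sum>\<^sub>\<infinity>(x,y)\<in>{1..}\<times>{1..}. f x * g y)"
  proof -
    have "(\<Sum>\<^sub>\<infinity>x\<in>{1..}. \<Sum>\<^sub>\<infinity>y\<in>{1..}. f x * g y) = (\<Sum>\<^sub>\<infinity>(x,y)\<in>{1..}\<times>{1..}. f x * g y)"
      by (rule infsum_Sigma'_banach) (rule abs_summable_summable[OF fgs])
    then show ?thesis
      by (simp only: infsum_cmult_right' infsum_cmult_left')
  qed
  also have "\<dots> = (\<Sum>\<^sub>\<infinity>(n,d)\<in>Sigma {1..} (\<lambda>n. {d. d dvd n}). f d * g (n div d))"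
    by (rule infsum_reindex_bij_witness[of _ ?i ?j]) (use wit wit' in \<open>auto simp: split_beta\<close>)
  also have "\<dots> = (\<Sum>\<^sub>\<infinity>n\<in>{1..}. \<Sum>\<^sub>\<infinity>d\<in>{d. d dvd n}. f d * g (n div d))"
  proof (rule infsum_Sigma'_banach[symmetric])
    have "(\<lambda>(d,m). f d * g m) summable_on {1..} \<times> {1..} \<longleftrightarrow>
        (\<lambda>(n,d). f d * g (n div d)) summable_on (SIGMA n:{1..}. {d. d dvd n})"
      by (rule summable_on_reindex_bij_witness[of _ ?i ?j]) (use wit wit' in \<open>auto simp: split_beta\<close>)
    then show "(\<lambda>(n,d). f d * g (n div d)) summable_on (SIGMA n:{1..}. {d. d dvd n})"
      using abs_summable_summable[OF fgs] by blast
  qed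
  also have "\<dots> = (\<Sum>\<^sub>\<infinity>n\<in>{1..}. of_real (ln (real n)) * of_nat n powr (-s))"
  proof (rule infsum_cong)
    fix n :: nat assume n: "n \<in> {1..}"
    have "(\<Sum>\<^sub>\<infinity>d\<in>{d. d dvd n}. f d * g (n div d)) = (\<Sum>d | d dvd n. f d * g (n div d))"
      using n by (intro infsum_finite) auto
    also have "\<dots> = (\<Sum>d | d dvd n. mangoldt d * of_nat n powr (-s))"
    proof (rule sum.cong)
      fix d assume "d \<in> {d. d dvd n}"
      then obtain m where m: "n = d * m" by auto
      with n have "d > 0" "m > 0" by auto
      then show "f d * g (n div d) = mangoldt d * of_nat n powr (-s)"
        by (simp add: f_def g_def m powr_times_real)
    qed auto
    also have "\<dots> = of_real (ln (real n)) * of_nat n powr (-s)"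
      using n by (simp add: sum_distrib_right[symmetric] mangoldt_sum)
    finally show "(\<Sum>\<^sub>\<infinity>d\<in>{d. d dvd n}. f d * g (n div d)) = of_real (ln (real n)) * of_nat n powr (-s)" .
  qed
  also have "\<dots> = dirichlet_series (\<lambda>n. of_real (ln (real n))) s"
    using summable_ln_powr[OF s]
    by (intro infsum_dirichlet, elim summable_comparison_test'[where N = 1]) auto
  finally show ?thesis using zeta_eq_dirichlet_series[OF s] by simp
qed

lemma zeta_deriv:
  assumes s: "Re s > 1"
  shows "(riemann_zeta has_field_derivative - dirichlet_series mangoldt s * riemann_zeta s) (at s)"
proof -
  have "summable (\<lambda>n. norm (1::complex) * real n powr (-\<sigma>))" if "\<sigma> > 1" for \<sigma> :: real
    using that by (simp add: summable_real_powr_iff)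
  from dirichlet_series_sums_deriv(2)[OF this s]
  have "(dirichlet_series (\<lambda>_. 1) has_field_derivative dirichlet_series (\<lambda>n. - of_real (ln (real n))) s) (at s)" by simp
  also have "dirichlet_series (\<lambda>n. - of_real (ln (real n))) s = - dirichlet_series (\<lambda>n. of_real (ln (real n))) s"
  proof -
    have "summable (\<lambda>n. norm (of_real (ln (real n)) :: complex) * real n powr (-\<sigma>))" if "\<sigma> > 1" for \<sigma>
      using summable_ln_powr[OF that]
      by (rule summable_comparison_test'[where N = 1]) auto
    from sums_minus[OF dirichlet_series_sums_deriv(1)[OF this s]] show ?thesis
      by (simp add: dirichlet_series_def sums_iff)
  qed
  also have "\<dots> = - dirichlet_series mangoldt s * riemann_zeta s"
    using mangoldt_dirichlet_series_times_zeta[OF s] by simp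
  finally show ?thesis
    by (rule has_field_derivative_transform_within_open[where S = "{s. Re s > 1}"])
       (use s in \<open>auto simp: open_halfspace_Re_gt zeta_eq_dirichlet_series\<close>)
qed

section \<open>Zero-free region of the zeta function\<close>

text \<open>The continuation of \<open>(s - 1) \<zeta>(s)\<close> to \<open>Re s > 0\<close>.\<close>

definition zeta_reg :: "complex \<Rightarrow> complex"
  where "zeta_reg s = 1 + (\<Sum>n. zeta_term n s)"

text \<open>The residue of zeta at 1 in disguise: both parts of every \<open>zeta_term\<close>
  vanish there. The value also serves to show that \<open>zeta_reg\<close> is not identically
  zero.\<close>

lemma zeta_reg_1 [simp]: "zeta_reg 1 = 1"
  by (simp add: zeta_reg_def zeta_term_def del: of_nat_Suc)

lemma zeta_term_deriv:
  "(zeta_term n has_field_derivative deriv (zeta_term n) s) (at s)"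
proof -
  have "zeta_term n holomorphic_on UNIV"
    unfolding zeta_term_def by (intro holomorphic_intros) (auto simp: complex_nonpos_Reals_iff)
  then show ?thesis by (rule holomorphic_derivI) auto
qed

text \<open>The terms decay like n^(-Re s - 1), one power better than those of the Dirichlet series,
  so they converge locally uniformly as far as Re s > 0.\<close>

lemma zeta_reg_holomorphic: "zeta_reg holomorphic_on {s. 0 < Re s}"
proof -
  define S where "S = {s. 0 < Re s}"
  have S: "open S" by (simp add: S_def open_halfspace_Re_gt)
  have "\<exists>g g'. \<forall>x\<in>S. (\<lambda>n. zeta_term n x) sums g x \<and> (\<lambda>n. deriv (zeta_term n) x) sums g' x
      \<and> (g has_field_derivative g' x) (at x)"
  proof (rule series_and_derivative_comparison_local[OF S])
    fix x assume x: "x \<in> S"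
    define d where "d = Re x / 2"
    define C where "C = (1 + norm x + d) * (norm x + d)"
    have d: "d > 0" using x by (simp add: d_def S_def)
    have le: "norm (zeta_term n y) \<le> C * real (Suc n) powr (- d - 1)" if y: "y \<in> ball x d" for n y
    proof -
      have n: "norm (x - y) < d" using y by (simp add: dist_norm)
      have re: "Re y \<ge> d"
        using abs_Re_le_cmod[of "x - y"] n by (simp add: d_def)
      have ny: "norm y \<le> norm x + d"
        using norm_triangle_ineq4[of x "x - y"] n by simp
      then have n1: "norm (1 - y) \<le> 1 + norm x + d"
        using norm_triangle_ineq4[of 1 y] by simp
      have "norm (zeta_term n y) \<le> norm (1 - y) * norm y * real (Suc n) powr (- Re y - 1)"
        using re d by (intro norm_zeta_term_le) auto
      also have "\<dots> \<le> C * real (Suc n) powr (- d - 1)"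
        unfolding C_def using ny n1 re d by (intro mult_mono powr_mono) auto
      finally show ?thesis .
    qed
    have "summable (\<lambda>n. C * real (Suc n) powr (- d - 1))"
      using d by (intro summable_mult)
        (subst summable_Suc_iff[of "\<lambda>n. real n powr (- d - 1)"], simp add: summable_real_powr_iff)
    then show "\<exists>d h. 0 < d \<and> summable h
        \<and> (\<forall>\<^sub>F n in sequentially. \<forall>y\<in>ball x d \<inter> S. norm (zeta_term n y) \<le> h n)"
      using d le by (intro exI[of _ d] exI[of _ "\<lambda>n. C * real (Suc n) powr (- d - 1)"]) auto
  qed (rule zeta_term_deriv)
  then obtain g g' where g: "\<And>x. x \<in> S \<Longrightarrow> (\<lambda>n. zeta_term n x) sums g x"
    and g': "\<And>x. x \<in> S \<Longrightarrow> (g has_field_derivative g' x) (at x)" by blast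
  have "(\<lambda>s. 1 + g s) holomorphic_on S"
    using g' S by (intro holomorphic_intros) (auto simp: holomorphic_on_open)
  moreover have "1 + g s = zeta_reg s" if "s \<in> S" for s
    using sums_unique[OF g[OF that]] by (simp add: zeta_reg_def)
  ultimately show "zeta_reg holomorphic_on {s. 0 < Re s}"
    unfolding S_def[symmetric] by (rule holomorphic_transform)
qed

text \<open>Polynomial growth is enough, because only the logarithm of this bound enters the
  estimate of the logarithmic derivative.\<close>

lemma norm_zeta_reg_le:
  obtains C where "C > 0" "\<And>s. Re s \<ge> 1/2 \<Longrightarrow> norm (zeta_reg s) \<le> 1 + C * norm (1 - s) * norm s"
proof
  let ?h = "\<lambda>n. real (Suc n) powr (-3/2)"
  have sm: "summable ?h"
    by (subst summable_Suc_iff[of "\<lambda>n. real n powr (-3/2)"]) (simp add: summable_real_powr_iff)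
  show "suminf ?h > 0"
    by (rule suminf_pos[OF sm]) simp
  fix s :: complex assume s: "Re s \<ge> 1/2"
  have le: "norm (zeta_term n s) \<le> norm (1 - s) * norm s * ?h n" for n
  proof -
    have "norm (zeta_term n s) \<le> norm (1 - s) * norm s * real (Suc n) powr (- Re s - 1)"
      using s by (intro norm_zeta_term_le) auto
    also have "\<dots> \<le> norm (1 - s) * norm s * ?h n"
      using s by (intro mult_left_mono powr_mono) auto
    finally show ?thesis .
  qed
  have "norm (\<Sum>n. zeta_term n s) \<le> (\<Sum>n. norm (1 - s) * norm s * ?h n)"
    by (rule norm_suminf_le[OF le]) (intro summable_mult sm)
  also have "\<dots> = norm (1 - s) * norm s * suminf ?h"
    by (rule suminf_mult[OF sm])
  finally show "norm (zeta_reg s) \<le> 1 + suminf ?h * norm (1 - s) * norm s"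
    using norm_triangle_ineq[of 1 "\<Sum>n. zeta_term n s"]
    by (simp add: zeta_reg_def mult_ac del: of_nat_Suc)
qed

text \<open>The differences in \<open>zeta_term\<close> telescope to -1, which cancels the leading 1
  of \<open>zeta_reg\<close>.\<close>

lemma zeta_reg_eq_right:
  assumes s: "Re s > 1"
  shows "zeta_reg s = (s - 1) * riemann_zeta s"
proof -
  have "(\<lambda>n. real (Suc n) powr (1 - Re s)) \<longlonglongrightarrow> 0"
    using s by real_asymp
  then have "(\<lambda>n. of_nat (Suc n) powr (1 - s)) \<longlonglongrightarrow> (0 :: complex)"
    by (subst tendsto_norm_zero_iff[symmetric])
      (simp add: norm_powr_real_powr del: of_nat_Suc)
  then have "(\<lambda>n. of_nat (Suc (Suc n)) powr (1 - s) - of_nat (Suc n) powr (1 - s))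
      sums (0 - of_nat (Suc 0) powr (1 - s) :: complex)"
    by (rule telescope_sums)
  moreover have "(\<lambda>n. (s - 1) * of_nat (Suc n) powr (-s)) sums ((s - 1) * riemann_zeta s)"
    using zeta_sums[OF s] sums_Suc_iff[of "\<lambda>n. of_nat n powr (-s)" "riemann_zeta s"]
    by (intro sums_mult) simp
  ultimately have "(\<lambda>n. zeta_term n s) sums ((s - 1) * riemann_zeta s + (0 - of_nat (Suc 0) powr (1 - s)))"
    unfolding zeta_term_def by (intro sums_add)
  then show ?thesis
    unfolding zeta_reg_def by (simp add: sums_iff)
qed

text \<open>\<open>zeta_reg s / (s - 1)\<close> satisfies \<open>continues_zeta\<close>, so
  uniqueness of the continuation carries the identity into the critical strip, where the Riemann
  Hypothesis is formulated.\<close>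

lemma zeta_reg_eq:
  assumes "s \<in> zeta_domain"
  shows "zeta_reg s = (s - 1) * riemann_zeta s"
proof -
  have "continues_zeta (\<lambda>s. zeta_reg s / (s - 1))"
    unfolding continues_zeta_def
  proof (intro conjI allI impI)
    show "(\<lambda>s. zeta_reg s / (s - 1)) holomorphic_on zeta_domain"
      by (intro holomorphic_intros holomorphic_on_subset[OF zeta_reg_holomorphic])
         (auto simp: zeta_domain_def)
    fix s :: complex assume s: "1 < Re s"
    then have "s \<noteq> 1" by auto
    then have "zeta_reg s / (s - 1) = riemann_zeta s"
      using zeta_reg_eq_right[OF s] by simp
    then show "(\<lambda>n. 1 / of_nat (Suc n) powr s) sums (zeta_reg s / (s - 1))"
      using continues_zeta_riemann_zeta s by (simp add: continues_zeta_def)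
  qed
  from continues_zeta_unique[OF this assms] show ?thesis
    using assms by (simp add: zeta_domain_def field_simps)
qed

text \<open>Since \<open>\<zeta>' = - D \<zeta>\<close> for the Dirichlet series \<open>D\<close> of \<open>\<Lambda>\<close>, the product of \<open>\<zeta>\<close> with
  \<open>exp (\<integral> D)\<close> is constant.\<close>

lemma zeta_nonzero_right:
  assumes s: "Re s > 1"
  shows "riemann_zeta s \<noteq> 0"
proof -
  define S where "S = {s. Re s > 1}"
  have S: "open S" "convex S" by (auto simp: S_def open_halfspace_Re_gt convex_halfspace_Re_gt)
  have "dirichlet_series mangoldt holomorphic_on S"
    using dirichlet_series_sums_deriv(2)[OF summable_mangoldt_powr] S
    by (subst holomorphic_on_open) (auto simp: S_def)
  from holomorphic_convex_primitive'[OF S(2,1) this] obtain P where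
    P: "\<And>x. x \<in> S \<Longrightarrow> (P has_field_derivative dirichlet_series mangoldt x) (at x within S)" by blast
  have "\<exists>c. \<forall>x\<in>S. riemann_zeta x * exp (P x) = c"
  proof (rule has_field_derivative_zero_constant[OF S(2)])
    fix x assume x: "x \<in> S"
    then have z: "(riemann_zeta has_field_derivative - dirichlet_series mangoldt x * riemann_zeta x) (at x within S)"
      using zeta_deriv[of x] by (auto simp: S_def intro: has_field_derivative_at_within)
    show "((\<lambda>x. riemann_zeta x * exp (P x)) has_field_derivative 0) (at x within S)"
      by (rule derivative_eq_intros refl z P[OF x])+ (simp add: algebra_simps)
  qed
  then obtain c where c: "\<And>x. x \<in> S \<Longrightarrow> riemann_zeta x * exp (P x) = c" by blast
  \<comment> \<open>If c were 0, zeta and hence \<open>zeta_reg\<close> would vanish throughout Re >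
    1, and by continuity also at 1, where its value is 1.\<close>
  have "c \<noteq> 0"
  proof
    assume "c = 0"
    then have zero: "zeta_reg x = 0" if "Re x > 1" for x
      using c[of x] that by (auto simp: S_def zeta_reg_eq_right)
    have "isCont zeta_reg 1"
      using zeta_reg_holomorphic open_halfspace_Re_gt[of 0]
      by (intro continuous_on_interior[OF holomorphic_on_imp_continuous_on]) (auto simp: interior_open)
    moreover have "(\<lambda>n. 1 + of_real (1 / real (Suc n))) \<longlonglongrightarrow> (1 + of_real 0 :: complex)"
      by (intro tendsto_intros LIMSEQ_Suc[OF lim_inverse_n'])
    ultimately have "(\<lambda>n. zeta_reg (1 + of_real (1 / real (Suc n)))) \<longlonglongrightarrow> zeta_reg 1"
      by (intro isCont_tendsto_compose[where g = zeta_reg]) simp_all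
    moreover have "zeta_reg (1 + of_real (1 / real (Suc n))) = 0" for n
      by (rule zero) simp
    ultimately have "(\<lambda>n. 0) \<longlonglongrightarrow> zeta_reg 1" by simp
    then show False by (simp add: LIMSEQ_const_iff)
  qed
  then show ?thesis using c[of s] s by (auto simp: S_def)
qed

text \<open>Written through \<open>zeta_reg\<close>, the series of \<Lambda> shows its pole at 1
  explicitly; the remaining quotient is regular wherever \<open>zeta_reg\<close> does not vanish,
  which yields the continuation to the left.\<close>

lemma dirichlet_series_mangoldt_eq:
  assumes s: "Re s > 1"
  shows "dirichlet_series mangoldt s = 1 / (s - 1) - deriv zeta_reg s / zeta_reg s"
proof -
  have s1: "s \<noteq> 1" using s by auto
  have "((\<lambda>s. (s - 1) * riemann_zeta s) has_field_derivative
      riemann_zeta s - (s - 1) * (dirichlet_series mangoldt s * riemann_zeta s)) (at s)"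
    by (rule derivative_eq_intros refl zeta_deriv[OF s])+ simp
  then have "(zeta_reg has_field_derivative
      riemann_zeta s - (s - 1) * (dirichlet_series mangoldt s * riemann_zeta s)) (at s)"
    by (rule has_field_derivative_transform_within_open[where S = "{s. Re s > 1}"])
       (use s in \<open>auto simp: open_halfspace_Re_gt zeta_reg_eq_right\<close>)
  then have "deriv zeta_reg s = riemann_zeta s - (s - 1) * (dirichlet_series mangoldt s * riemann_zeta s)"
    by (rule DERIV_imp_deriv)
  then have "deriv zeta_reg s / zeta_reg s
      = ((1 - (s - 1) * dirichlet_series mangoldt s) * riemann_zeta s) / ((s - 1) * riemann_zeta s)"
    by (simp add: zeta_reg_eq_right[OF s] algebra_simps)
  also have "\<dots> = 1 / (s - 1) - dirichlet_series mangoldt s"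
    using s1 zeta_nonzero_right[OF s] by (simp add: diff_divide_distrib)
  finally show ?thesis by simp
qed

text \<open>\<open>m\<close> is the order of vanishing at \<open>z\<close>: at a zero of order m the
  logarithmic derivative has a simple pole with residue m, and elsewhere it is continuous.\<close>

lemma zeta_reg_logderiv_limit:
  assumes z: "Re z > 0"
  obtains m :: nat where "m = 0 \<longleftrightarrow> zeta_reg z \<noteq> 0"
    "((\<lambda>w. (w - z) * (deriv zeta_reg w / zeta_reg w)) \<longlongrightarrow> of_nat m) (at z)"
proof (cases "zeta_reg z = 0")
  case False
  define S where "S = {s. 0 < Re s}"
  have S: "open S" "z \<in> S" using z by (auto simp: S_def open_halfspace_Re_gt)
  note hol = zeta_reg_holomorphic[folded S_def]
  have "isCont (\<lambda>w. (w - z) * (deriv zeta_reg w / zeta_reg w)) z"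
    using holomorphic_on_imp_continuous_on[OF hol]
      holomorphic_on_imp_continuous_on[OF holomorphic_deriv[OF hol S(1)]] False S
    by (intro continuous_intros) (auto simp: continuous_on_eq_continuous_at)
  then have "((\<lambda>w. (w - z) * (deriv zeta_reg w / zeta_reg w)) \<longlongrightarrow> of_nat 0) (at z)"
    by (simp add: isCont_def)
  with False show ?thesis by (intro that[of 0]) auto
next
  case True
  define S where "S = {s. 0 < Re s}"
  have S: "open S" "connected S" "z \<in> S"
    using z by (auto simp: S_def open_halfspace_Re_gt convex_connected convex_halfspace_Re_gt)
  note hol = zeta_reg_holomorphic[folded S_def]
  \<comment> \<open>The local factorisation (w - z)^n g(w) needs a nonconstant function; the values
    1 at the point 1 and 0 at \<open>z\<close> provide this.\<close>
  have nc: "\<not> zeta_reg constant_on S"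
  proof
    assume "zeta_reg constant_on S"
    then obtain y where y: "\<And>x. x \<in> S \<Longrightarrow> zeta_reg x = y"
      by (auto simp: constant_on_def)
    have "(1::complex) \<in> S" by (simp add: S_def)
    from y[OF this] y[OF S(3)] True show False by simp
  qed
  obtain g r n where g: "0 < n" "0 < r" "ball z r \<subseteq> S" "g holomorphic_on ball z r"
    "\<And>w. w \<in> ball z r \<Longrightarrow> zeta_reg w = (w - z) ^ n * g w"
    "\<And>w. w \<in> ball z r \<Longrightarrow> g w \<noteq> 0"
    by (rule holomorphic_factor_zero_nonconstant[OF hol S(1-3) True nc], rule that)
  have "isCont (\<lambda>w. of_nat n + (w - z) * (deriv g w / g w)) z"
    using holomorphic_on_imp_continuous_on[OF g(4)] g(2,6)
      holomorphic_on_imp_continuous_on[OF holomorphic_deriv[OF g(4) open_ball]]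
    by (intro continuous_intros) (auto simp: continuous_on_eq_continuous_at)
  then have "((\<lambda>w. of_nat n + (w - z) * (deriv g w / g w)) \<longlongrightarrow> of_nat n) (at z)"
    by (simp add: isCont_def)
  then have "((\<lambda>w. (w - z) * (deriv zeta_reg w / zeta_reg w)) \<longlongrightarrow> of_nat n) (at z)"
  proof (rule Lim_transform_within_open[where s = "ball z r"])
    fix w assume w: "w \<in> ball z r" "w \<noteq> z"
    have dg: "(g has_field_derivative deriv g w) (at w)"
      using w by (intro holomorphic_derivI[OF g(4)]) auto
    have "((\<lambda>w. (w - z) ^ n * g w) has_field_derivative
        of_nat n * (w - z) ^ (n - 1) * g w + (w - z) ^ n * deriv g w) (at w)"
      by (rule derivative_eq_intros refl dg)+ simp
    then have "(zeta_reg has_field_derivative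
        of_nat n * (w - z) ^ (n - 1) * g w + (w - z) ^ n * deriv g w) (at w)"
      by (rule has_field_derivative_transform_within_open[where S = "ball z r"]) (use w g in auto)
    then have "deriv zeta_reg w = of_nat n * (w - z) ^ (n - 1) * g w + (w - z) ^ n * deriv g w"
      by (rule DERIV_imp_deriv)
    moreover have "(w - z) ^ n = (w - z) * (w - z) ^ (n - 1)"
      using g(1) by (cases n) auto
    moreover have "u * ((k * q * v + u * q * v') / (u * q * v)) = k + u * (v' / v)"
      if "u \<noteq> 0" "q \<noteq> 0" "v \<noteq> 0" for u k q v v' :: complex
      using that by (simp add: field_simps)
    note this[of "w - z" "(w - z) ^ (n - 1)" "g w" "of_nat n" "deriv g w"]
    ultimately show "of_nat n + (w - z) * (deriv g w / g w) = (w - z) * (deriv zeta_reg w / zeta_reg w)"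
      using w g(6)[OF w(1)] by (simp add: g(5)[OF w(1)])
  qed (use g in auto)
  with True g(1) show ?thesis by (intro that[of n]) auto
qed

text \<open>Mertens' inequality, from 3 + 4 cos a + cos 2a = 2 (1 + cos a)^2 with a = t log n and
  the nonnegativity of \<Lambda>.\<close>

lemma dirichlet_series_mangoldt_341:
  assumes "\<sigma> > 1"
  shows "3 * Re (dirichlet_series mangoldt (Complex \<sigma> 0)) + 4 * Re (dirichlet_series mangoldt (Complex \<sigma> t))
      + Re (dirichlet_series mangoldt (Complex \<sigma> (2 * t))) \<ge> 0"
proof -
  have sm: "(\<lambda>n. Re (mangoldt n * of_nat n powr (- Complex \<sigma> t))) sums Re (dirichlet_series mangoldt (Complex \<sigma> t))" for t
    using assms by (intro sums_Re dirichlet_series_sums_deriv summable_mangoldt_powr) auto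
  have re: "Re (mangoldt n * of_nat n powr (- Complex \<sigma> t)) =
      mangoldt n * real n powr (-\<sigma>) * cos (t * ln (real n))" for n t
  proof (cases "n = 0")
    case False
    have "mangoldt n * of_nat n powr (- Complex \<sigma> t)
        = of_real (mangoldt n) * exp (- Complex \<sigma> t * of_real (ln (real n)))"
      using False by (simp add: powr_def Ln_of_nat)
    then show ?thesis
      using False by (simp add: Re_exp powr_def)
  qed simp
  have "0 \<le> 3 * Re (mangoldt n * of_nat n powr (- Complex \<sigma> 0)) + 4 * Re (mangoldt n * of_nat n powr (- Complex \<sigma> t))
      + Re (mangoldt n * of_nat n powr (- Complex \<sigma> (2 * t)))" for n
  proof -
    have "0 \<le> 2 * (1 + cos (t * ln (real n)))\<^sup>2" by simp
    also have "\<dots> = 3 + 4 * cos (t * ln (real n)) + cos (2 * (t * ln (real n)))"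
      unfolding cos_double_cos by (simp add: power2_eq_square algebra_simps)
    finally have "0 \<le> mangoldt n * real n powr (-\<sigma>) * (3 + 4 * cos (t * ln (real n)) + cos (2 * (t * ln (real n))))"
      by (intro mult_nonneg_nonneg mangoldt_nonneg) auto
    then show ?thesis
      unfolding re by (simp add: algebra_simps)
  qed
  moreover have "(\<lambda>n. 3 * Re (mangoldt n * of_nat n powr (- Complex \<sigma> 0)) + 4 * Re (mangoldt n * of_nat n powr (- Complex \<sigma> t))
      + Re (mangoldt n * of_nat n powr (- Complex \<sigma> (2 * t)))) sums
     (3 * Re (dirichlet_series mangoldt (Complex \<sigma> 0)) + 4 * Re (dirichlet_series mangoldt (Complex \<sigma> t))
      + Re (dirichlet_series mangoldt (Complex \<sigma> (2 * t))))"
    by (intro sums_add sums_mult sm)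
  ultimately show ?thesis
    by (rule sums_le[OF _ sums_zero])
qed

text \<open>Multiply the 3-4-1 inequality by \<epsilon> = \<sigma> - 1 and let \<epsilon> tend to 0.
  The pole at 1 contributes 3, the orders of vanishing m1 at height t and m2 at height 2t contribute
  -4 m1 and -m2; but 3 - 4 m1 - m2 is negative once m1 >= 1.\<close>

lemma zeta_reg_nonzero_line: "zeta_reg (Complex 1 t) \<noteq> 0"
proof
  assume zero: "zeta_reg (Complex 1 t) = 0"
  have lim: "\<exists>m::nat. (m = 0 \<longleftrightarrow> zeta_reg (Complex 1 u) \<noteq> 0) \<and>
      ((\<lambda>\<epsilon>. \<epsilon> * Re (deriv zeta_reg (Complex (1 + \<epsilon>) u) / zeta_reg (Complex (1 + \<epsilon>) u))) \<longlongrightarrow> of_nat m) (at_right 0)" for u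
  proof -
    obtain m where m: "m = 0 \<longleftrightarrow> zeta_reg (Complex 1 u) \<noteq> 0"
      "((\<lambda>w. (w - Complex 1 u) * (deriv zeta_reg w / zeta_reg w)) \<longlongrightarrow> of_nat m) (at (Complex 1 u))"
      by (rule zeta_reg_logderiv_limit[of "Complex 1 u"]) auto
    have "filterlim (\<lambda>\<epsilon>. Complex (1 + \<epsilon>) u) (at (Complex 1 u)) (at_right 0)"
      unfolding filterlim_at
      by (auto intro!: tendsto_eq_intros simp: eventually_at_filter)
    from tendsto_Re[OF filterlim_compose[OF m(2) this]]
    have "((\<lambda>\<epsilon>. Re ((Complex (1 + \<epsilon>) u - Complex 1 u) * (deriv zeta_reg (Complex (1 + \<epsilon>) u) / zeta_reg (Complex (1 + \<epsilon>) u))))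
        \<longlongrightarrow> of_nat m) (at_right 0)" by simp
    also have "(\<lambda>\<epsilon>. Re ((Complex (1 + \<epsilon>) u - Complex 1 u) * (deriv zeta_reg (Complex (1 + \<epsilon>) u) / zeta_reg (Complex (1 + \<epsilon>) u))))
        = (\<lambda>\<epsilon>. \<epsilon> * Re (deriv zeta_reg (Complex (1 + \<epsilon>) u) / zeta_reg (Complex (1 + \<epsilon>) u)))"
      by (rule ext) (subst times_complex.sel(1), simp)
    finally show ?thesis by (intro exI[of _ m] conjI m(1))
  qed
  obtain m1 :: nat where m1: "m1 \<noteq> 0"
    "((\<lambda>\<epsilon>. \<epsilon> * Re (deriv zeta_reg (Complex (1 + \<epsilon>) t) / zeta_reg (Complex (1 + \<epsilon>) t))) \<longlongrightarrow> of_nat m1) (at_right 0)"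
    using lim[of t] zero by auto
  obtain m2 :: nat where m2:
    "((\<lambda>\<epsilon>. \<epsilon> * Re (deriv zeta_reg (Complex (1 + \<epsilon>) (2 * t)) / zeta_reg (Complex (1 + \<epsilon>) (2 * t)))) \<longlongrightarrow> of_nat m2) (at_right 0)"
    using lim[of "2 * t"] by auto
  have "Complex 1 0 = 1" by (simp add: complex_eq_iff)
  then have m0:
    "((\<lambda>\<epsilon>. \<epsilon> * Re (deriv zeta_reg (Complex (1 + \<epsilon>) 0) / zeta_reg (Complex (1 + \<epsilon>) 0))) \<longlongrightarrow> 0) (at_right 0)"
    using lim[of 0] by auto
  have t: "t \<noteq> 0" using zero \<open>Complex 1 0 = 1\<close> by auto
  have pole: "((\<lambda>\<epsilon>. \<epsilon> * Re (1 / (Complex (1 + \<epsilon>) u - 1))) \<longlongrightarrow> 0) (at_right 0)" if "u \<noteq> 0" for u :: real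
    using that by (auto intro!: tendsto_eq_intros simp: Re_divide power2_eq_square)
  have pole0: "((\<lambda>\<epsilon>. \<epsilon> * Re (1 / (Complex (1 + \<epsilon>) 0 - 1))) \<longlongrightarrow> 1) (at_right 0)"
    by (rule tendsto_eventually)
       (auto simp: eventually_at_filter Re_divide power2_eq_square)
  let ?D = "\<lambda>u \<epsilon>. \<epsilon> * Re (1 / (Complex (1 + \<epsilon>) u - 1)) - \<epsilon> * Re (deriv zeta_reg (Complex (1 + \<epsilon>) u) / zeta_reg (Complex (1 + \<epsilon>) u))"
  have D: "?D u \<epsilon> = \<epsilon> * Re (dirichlet_series mangoldt (Complex (1 + \<epsilon>) u))" if "\<epsilon> > 0" for u \<epsilon>
    using that by (subst dirichlet_series_mangoldt_eq) (auto simp: right_diff_distrib)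
  have "((\<lambda>\<epsilon>. 3 * ?D 0 \<epsilon> + 4 * ?D t \<epsilon> + ?D (2 * t) \<epsilon>) \<longlongrightarrow> 3 * (1 - 0) + 4 * (0 - of_nat m1) + (0 - of_nat m2)) (at_right 0)"
    using t by (intro tendsto_intros pole pole0 m0 m1 m2) auto
  moreover have "\<forall>\<^sub>F \<epsilon> in at_right 0. 0 \<le> 3 * ?D 0 \<epsilon> + 4 * ?D t \<epsilon> + ?D (2 * t) \<epsilon>"
    unfolding eventually_at_filter
  proof (intro always_eventually allI impI)
    fix \<epsilon> :: real assume "\<epsilon> \<noteq> 0" "\<epsilon> \<in> {0<..}"
    then have e: "\<epsilon> > 0" by simp
    have "0 \<le> \<epsilon> * (3 * Re (dirichlet_series mangoldt (Complex (1 + \<epsilon>) 0)) + 4 * Re (dirichlet_series mangoldt (Complex (1 + \<epsilon>) t))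
      + Re (dirichlet_series mangoldt (Complex (1 + \<epsilon>) (2 * t))))"
      using e by (intro mult_nonneg_nonneg dirichlet_series_mangoldt_341) auto
    then show "0 \<le> 3 * ?D 0 \<epsilon> + 4 * ?D t \<epsilon> + ?D (2 * t) \<epsilon>"
      unfolding D[OF e] by (simp add: algebra_simps)
  qed
  ultimately have "0 \<le> 3 * (1 - 0) + 4 * (0 - real m1) + (0 - real m2)"
    by (rule tendsto_lowerbound) simp
  with m1 show False by simp
qed

lemma zeta_reg_nonzero:
  assumes RH: "Riemann_Hypothesis" and s: "Re s > 1/2"
  shows "zeta_reg s \<noteq> 0"
proof -
  consider "Re s > 1" | "Re s = 1" | "Re s < 1" by linarith
  then show ?thesis
  proof cases
    case 1
    then have "s \<noteq> 1" by auto
    with 1 show ?thesis using zeta_nonzero_right[OF 1] by (simp add: zeta_reg_eq_right)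
  next
    case 2
    then show ?thesis using zeta_reg_nonzero_line[of "Im s"] by (metis complex.collapse)
  next
    case 3
    then have "s \<in> zeta_domain" "s \<noteq> 1" using s by (auto simp: zeta_domain_def)
    moreover have "riemann_zeta s \<noteq> 0"
      using RH[unfolded Riemann_Hypothesis_def, rule_format, of s] s 3 by auto
    ultimately show ?thesis by (simp add: zeta_reg_eq)
  qed
qed

section \<open>Growth of the logarithmic derivative\<close>

text \<open>The Moebius map sending u to u / (2A - u) takes the half-plane Re u < A into the unit
  disc and fixes 0. Schwarz's lemma for the rescaled composite gives |f(z)| <= (|z - c| / R) (2A +
  |f(z)|), which is solved for |f(z)|.\<close>

lemma Borel_Caratheodory:
  fixes f :: "complex \<Rightarrow> complex"
  assumes hol: "f holomorphic_on ball c R" and fc: "f c = 0"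
    and A: "A > 0" "\<And>z. z \<in> ball c R \<Longrightarrow> Re (f z) < A"
    and R: "0 < R" and z: "z \<in> ball c R"
  shows "norm (f z) \<le> 2 * A * norm (z - c) / (R - norm (z - c))"
proof -
  define g where "g = (\<lambda>w. f (c + of_real R * w) / (2 * of_real A - f (c + of_real R * w)))"
  have in_ball: "c + of_real R * w \<in> ball c R" if "norm w < 1" for w
    using that R by (simp add: dist_norm norm_mult)
  have nz: "2 * of_real A - f w \<noteq> 0" if "w \<in> ball c R" for w
  proof
    assume "2 * of_real A - f w = 0"
    then have "Re (f w) = 2 * A" by (simp add: complex_eq_iff)
    with A(2)[OF that] A(1) show False by simp
  qed
  have lt: "norm (f w) < norm (2 * of_real A - f w)" if "w \<in> ball c R" for w
  proof -
    have "(norm (2 * of_real A - f w))\<^sup>2 - (norm (f w))\<^sup>2 = 4 * A * (A - Re (f w))"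
      unfolding cmod_power2 by (simp add: power2_eq_square algebra_simps)
    also have "\<dots> > 0" using A that by simp
    finally show ?thesis by (simp add: power2_less_imp_less)
  qed
  define \<xi> where "\<xi> = (z - c) / of_real R"
  have \<xi>: "norm \<xi> = norm (z - c) / R" "c + of_real R * \<xi> = z"
    using R by (simp_all add: \<xi>_def norm_divide)
  have "norm (g \<xi>) \<le> norm \<xi>"
  proof (rule Schwarz_Lemma(1))
    have "(f \<circ> (\<lambda>w. c + of_real R * w)) holomorphic_on ball 0 1"
      by (rule holomorphic_on_compose_gen[OF _ hol]) (auto intro!: holomorphic_intros in_ball)
    then show "g holomorphic_on ball 0 1"
      unfolding g_def o_def using nz in_ball by (intro holomorphic_intros) auto
    show "norm (g w) < 1" if "norm w < 1" for w
      using lt[OF in_ball[OF that]] nz[OF in_ball[OF that]] by (simp add: g_def norm_divide)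
    show "norm \<xi> < 1"
      using z R by (simp add: \<xi> dist_norm norm_minus_commute)
  qed (simp add: g_def fc)
  then have "norm (f z) \<le> norm (z - c) / R * norm (2 * of_real A - f z)"
    using nz[OF z] by (simp add: g_def \<xi> norm_divide pos_divide_le_eq)
  also have "\<dots> \<le> norm (z - c) / R * (2 * A + norm (f z))"
    using norm_triangle_ineq4[of "2 * of_real A" "f z"] A R by (intro mult_left_mono) auto
  finally have "norm (f z) * (R - norm (z - c)) \<le> 2 * A * norm (z - c)"
    using R by (simp add: field_simps)
  then show ?thesis
    using z by (simp add: dist_norm norm_minus_commute pos_le_divide_eq)
qed

text \<open>A zero-free function on a disc has a holomorphic logarithm. An upper bound for |f|
  controls only the real part of it; Borel--Caratheodory turns this into a bound for the modulus,
  and Cauchy's inequality then bounds the derivative.\<close>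

lemma norm_logderiv_le:
  fixes f :: "complex \<Rightarrow> complex"
  assumes hol: "f holomorphic_on ball c R" and nz: "\<And>w. w \<in> ball c R \<Longrightarrow> f w \<noteq> 0"
    and M: "M > 1" "\<And>w. w \<in> ball c R \<Longrightarrow> norm (f w) < M * norm (f c)"
    and r: "0 < r" "r < R" "norm (z - c) \<le> r"
  shows "norm (deriv f z / f z) \<le> 8 * R * ln M / (R - r)\<^sup>2"
proof -
  have cin: "c \<in> ball c R" using r by simp
  obtain g where g: "g holomorphic_on ball c R" "\<And>x. x \<in> ball c R \<Longrightarrow> exp (g x) = f x"
    using holomorphic_logarithm_exists[OF convex_ball open_ball hol nz cin] by metis
  define L where "L = (\<lambda>x. g x - g c)"
  have L: "deriv L x = deriv f x / f x" if x: "x \<in> ball c R" for x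
  proof -
    have dg: "(g has_field_derivative deriv g x) (at x)"
      by (rule holomorphic_derivI[OF g(1) open_ball x])
    then have "((\<lambda>x. exp (g x)) has_field_derivative exp (g x) * deriv g x) (at x)"
      by (rule DERIV_fun_exp)
    then have "(f has_field_derivative exp (g x) * deriv g x) (at x)"
      by (rule has_field_derivative_transform_within_open[OF _ open_ball x]) (rule g(2))
    then have "deriv f x = f x * deriv g x"
      using g(2)[OF x] by (simp add: DERIV_imp_deriv)
    moreover have "deriv L x = deriv g x"
      unfolding L_def using dg by (intro DERIV_imp_deriv) (auto intro!: derivative_eq_intros)
    ultimately show ?thesis using nz[OF x] by simp
  qed
  have holL: "L holomorphic_on ball c R"
    unfolding L_def by (intro holomorphic_intros g)
  have re: "Re (L x) < ln M" if x: "x \<in> ball c R" for x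
  proof -
    have "exp (L x) = f x / f c"
      by (simp add: L_def exp_diff g(2)[OF x] g(2)[OF cin])
    then have "exp (Re (L x)) = norm (f x) / norm (f c)"
      by (simp only: norm_exp_eq_Re[symmetric] norm_divide)
    also have "\<dots> < M" using M(2)[OF x] nz[OF cin] by (simp add: pos_divide_less_eq)
    also have "M = exp (ln M)" using M(1) by simp
    finally show ?thesis by simp
  qed
  \<comment> \<open>Half of the gap R - r: the circle of this radius about \<open>z\<close> keeps
    distance at least \<rho> from the boundary of the large disc.\<close>
  define \<rho> where "\<rho> = (R - r) / 2"
  have \<rho>: "\<rho> > 0" using r by (simp add: \<rho>_def)
  have sub: "cball z \<rho> \<subseteq> ball c R"
  proof
    fix w assume "w \<in> cball z \<rho>"
    then have "norm (w - z) \<le> \<rho>" by (simp add: dist_norm norm_minus_commute)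
    then have "norm (w - c) \<le> \<rho> + r"
      using norm_triangle_ineq[of "w - z" "z - c"] r by simp
    then show "w \<in> ball c R" using r by (simp add: dist_norm norm_minus_commute \<rho>_def field_simps)
  qed
  have bd: "norm (L w) \<le> 2 * ln M * R / \<rho>" if w: "norm (z - w) = \<rho>" for w
  proof -
    have win: "w \<in> ball c R" using sub w by (auto simp: dist_norm)
    have "norm (w - c) \<le> \<rho> + r"
      using norm_triangle_ineq[of "w - z" "z - c"] r w by (simp add: norm_minus_commute)
    then have d: "R - norm (w - c) \<ge> \<rho>" by (simp add: \<rho>_def field_simps)
    have "norm (L w) \<le> 2 * ln M * norm (w - c) / (R - norm (w - c))"
      using M(1) r by (intro Borel_Caratheodory[OF holL _ _ re _ win]) (auto simp: L_def)
    also have "\<dots> \<le> 2 * ln M * R / \<rho>"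
      using M(1) d \<rho> win r by (intro frac_le mult_mono mult_nonneg_nonneg) (auto simp: dist_norm norm_minus_commute)
    finally show ?thesis .
  qed
  have "norm ((deriv ^^ 1) L z) \<le> fact 1 * (2 * ln M * R / \<rho>) / \<rho> ^ 1"
    using bd \<rho> sub holL
    by (intro Cauchy_inequality) (auto intro: holomorphic_on_subset holomorphic_on_imp_continuous_on continuous_on_subset dest: subsetD[OF ball_subset_cball])
  moreover have "z \<in> ball c R" using r by (simp add: dist_norm norm_minus_commute)
  then have "deriv L z = deriv f z / f z" by (rule L)
  ultimately show ?thesis
    using r by (simp add: \<rho>_def power2_eq_square field_simps)
qed

text \<open>Supplies the value at the disc centre against which growth is measured. One factor 1/n
  of n^(-3) is traded for 1/2, after which the sum pi^2/6 of the inverse squares and pi < 4 suffice;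
  at Re s = 2 these crude bounds would not.\<close>

lemma norm_zeta_reg_lower:
  assumes "Re s = 3"
  shows "norm (zeta_reg s) \<ge> 1 / 3"
proof -
  have z: "(\<lambda>n. of_nat (Suc n) powr (-s)) sums riemann_zeta s"
    using zeta_sums[of s] assms sums_Suc_iff[of "\<lambda>n. of_nat n powr (-s)" "riemann_zeta s"] by simp
  have z1: "(\<lambda>n. of_nat (Suc (Suc n)) powr (-s)) sums (riemann_zeta s - 1)"
    using z sums_Suc_iff[of "\<lambda>n. of_nat (Suc n) powr (-s)" "riemann_zeta s - 1"] by simp
  have b: "(\<lambda>n. 1 / (real (Suc (Suc n)))\<^sup>2) sums (pi\<^sup>2 / 6 - 1)"
    using inverse_squares_sums sums_Suc_iff[of "\<lambda>n. 1 / (real (Suc n))\<^sup>2" "pi\<^sup>2 / 6 - 1"]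
    by (simp add: add_ac)
  have "norm (riemann_zeta s - 1) \<le> 1/2 * (pi\<^sup>2 / 6 - 1)"
  proof (rule norm_sums_le[OF z1 sums_mult[OF b]])
    fix n
    have "norm (of_nat (Suc (Suc n)) powr (-s) :: complex) = real (Suc (Suc n)) powr (-3)"
      using assms by (simp only: norm_of_nat_powr) simp
    also have "\<dots> = 1 / real (Suc (Suc n)) * (1 / (real (Suc (Suc n)))\<^sup>2)"
      by (simp add: powr_minus powr_numeral field_simps power2_eq_square power3_eq_cube del: of_nat_Suc)
    also have "\<dots> \<le> 1/2 * (1 / (real (Suc (Suc n)))\<^sup>2)"
      by (intro mult_right_mono) (auto simp: field_simps)
    finally show "norm (of_nat (Suc (Suc n)) powr (-s) :: complex) \<le> 1/2 * (1 / (real (Suc (Suc n)))\<^sup>2)" .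
  qed
  also have "pi\<^sup>2 \<le> 4\<^sup>2" using pi_less_4 by (intro power_mono) auto
  finally have "norm (riemann_zeta s - 1) \<le> 5/6" by simp
  then have z2: "norm (riemann_zeta s) \<ge> 1/6"
    using norm_triangle_ineq2[of 1 "1 - riemann_zeta s"] by (simp add: norm_minus_commute)
  have "norm (s - 1) \<ge> 2" using abs_Re_le_cmod[of "s - 1"] assms by simp
  then have "2 * (1/6) \<le> norm (s - 1) * norm (riemann_zeta s)"
    using z2 by (intro mult_mono) auto
  then show ?thesis using assms by (simp add: zeta_reg_eq_right norm_mult)
qed

text \<open>Discs of radius 19/8 centred at 3 + i Im s reach left only to 5/8 > 1/2, so they are
  zero-free under the hypothesis, while the strip lies within 9/4 of the centres. The resulting
  logarithmic growth is then weakened to a linear bound.\<close>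

lemma zeta_reg_logderiv_le:
  assumes RH: "Riemann_Hypothesis"
  obtains K where "K > 0"
    "\<And>s. 3/4 \<le> Re s \<Longrightarrow> Re s \<le> 1 \<Longrightarrow> norm (deriv zeta_reg s / zeta_reg s) \<le> K * (1 + \<bar>Im s\<bar>)"
proof -
  obtain C where C: "C > 0" "\<And>s. Re s \<ge> 1/2 \<Longrightarrow> norm (zeta_reg s) \<le> 1 + C * norm (1 - s) * norm s"
    by (rule norm_zeta_reg_le) (rule that)
  \<comment> \<open>1216 = 8 * (19/8) / (19/8 - 9/4)^2, and 14 = 2 * 7 comes from 2 log(7 + |Im s|)
    <= 2 (7 + |Im s|).\<close>
  define K where "K = 1216 * (\<bar>ln (3 * (1 + C))\<bar> + 14)"
  have K: "K > 0" by (simp add: K_def)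
  have "norm (deriv zeta_reg s / zeta_reg s) \<le> K * (1 + \<bar>Im s\<bar>)" if s: "3/4 \<le> Re s" "Re s \<le> 1" for s
  proof -
    define c where "c = Complex 3 (Im s)"
    \<comment> \<open>The factor 3 is the reciprocal of the lower bound for
      |\<open>zeta_reg c\<close>|; points of the disc satisfy |1 - w| <= 7 + |Im s|.\<close>
    define M where "M = 3 * (1 + C) * (7 + \<bar>Im s\<bar>)\<^sup>2"
    have re: "Re w > 1/2" if "w \<in> ball c (19/8)" for w
      using abs_Re_le_cmod[of "c - w"] that by (simp add: dist_norm c_def)
    have nc: "norm c \<le> 3 + \<bar>Im s\<bar>" using cmod_le[of c] by (simp add: c_def)
    have "norm (deriv zeta_reg s / zeta_reg s) \<le> 8 * (19/8) * ln M / (19/8 - 9/4)\<^sup>2"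
    proof (rule norm_logderiv_le)
      show "zeta_reg holomorphic_on ball c (19/8)"
        by (rule holomorphic_on_subset[OF zeta_reg_holomorphic]) (use re in fastforce)
      show "zeta_reg w \<noteq> 0" if "w \<in> ball c (19/8)" for w
        using zeta_reg_nonzero[OF RH re[OF that]] .
      have "M \<ge> 3 * 1 * 7\<^sup>2"
        unfolding M_def using C(1) by (intro mult_mono power_mono) auto
      then show "M > 1" by simp
      show "norm (zeta_reg w) < M * norm (zeta_reg c)" if w: "w \<in> ball c (19/8)" for w
      proof -
        have "norm (c - w) < 19/8" using w by (simp add: dist_norm)
        then have n: "norm w \<le> 6 + \<bar>Im s\<bar>"
          using norm_triangle_ineq4[of c "c - w"] nc by simp
        then have n1: "norm (1 - w) \<le> 7 + \<bar>Im s\<bar>"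
          using norm_triangle_ineq4[of 1 w] by simp
        have "norm (zeta_reg w) \<le> 1 + C * norm (1 - w) * norm w"
          using re[OF w] by (intro C) auto
        also have "\<dots> \<le> 1 + C * (7 + \<bar>Im s\<bar>) * (7 + \<bar>Im s\<bar>)"
          using C(1) n n1 by (intro add_left_mono mult_mono) auto
        also have "\<dots> < (7 + \<bar>Im s\<bar>)\<^sup>2 + C * (7 + \<bar>Im s\<bar>) * (7 + \<bar>Im s\<bar>)"
          by (intro add_strict_right_mono one_less_power) auto
        also have "\<dots> = M * (1/3)" by (simp add: M_def power2_eq_square algebra_simps)
        also have "\<dots> \<le> M * norm (zeta_reg c)"
          using C(1) by (intro mult_left_mono norm_zeta_reg_lower) (auto simp: M_def c_def)
        finally show ?thesis .
      qed
      have "s - c = of_real (Re s - 3)" by (simp add: c_def complex_eq_iff)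
      then show "norm (s - c) \<le> 9/4" using s by (simp only: norm_of_real)
    qed auto
    also have "\<dots> = 1216 * ln M" by (simp add: power2_eq_square)
    also have "ln M = ln (3 * (1 + C)) + 2 * ln (7 + \<bar>Im s\<bar>)"
      unfolding M_def using C(1) by (subst ln_mult) (auto simp: ln_realpow)
    also have "\<dots> \<le> \<bar>ln (3 * (1 + C))\<bar> + 2 * (7 + \<bar>Im s\<bar>)"
      using ln_bound[of "7 + \<bar>Im s\<bar>"] abs_ge_zero[of "Im s"] by (intro add_mono mult_left_mono) auto
    also have "\<dots> \<le> (\<bar>ln (3 * (1 + C))\<bar> + 14) * (1 + \<bar>Im s\<bar>)"
      by (simp add: algebra_simps)
    finally show ?thesis by (simp only: K_def mult.assoc)
  qed
  with K show ?thesis by (rule that)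
qed

section \<open>Newman's contour method\<close>

text \<open>Integral comparison by telescoping: the Bernoulli-type inequality (1 - 1/v)^(-y) >= 1 +
  y/v yields y v^(-y-1) <= (v-1)^(-y) - v^(-y).\<close>

lemma sum_powr_tail_le:
  fixes y :: real
  assumes y: "y > 0" and N: "N \<ge> 1"
  shows "(\<Sum>n. real (n + Suc N) powr (-y-1)) \<le> real N powr (-y) / y"
    and "summable (\<lambda>n. real (n + Suc N) powr (-y-1))"
proof -
  show sm: "summable (\<lambda>n. real (n + Suc N) powr (-y-1))"
    using y by (subst summable_iff_shift[of "\<lambda>n. real n powr (-y-1)"]) (simp add: summable_real_powr_iff)
  have le: "real (n + Suc N) powr (-y-1) \<le> (real (n + N) powr (-y) - real (n + Suc N) powr (-y)) / y" for n
  proof -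
    define v where "v = real (n + Suc N)"
    have v: "v \<ge> 2" using N by (simp add: v_def)
    have "ln (1 - 1 / v) \<le> - 1 / v" using ln_le_minus_one[of "1 - 1 / v"] v by simp
    then have "y * (1 / v) \<le> y * (- ln (1 - 1 / v))"
      using y by (intro mult_left_mono) auto
    then have "1 + y / v \<le> exp (- y * ln (1 - 1 / v))"
      using exp_ge_add_one_self[of "- y * ln (1 - 1 / v)"] by simp
    also have "\<dots> = (1 - 1 / v) powr (-y)" using v by (simp add: powr_def)
    finally have "v powr (-y) * (1 + y / v) \<le> v powr (-y) * (1 - 1 / v) powr (-y)"
      by (intro mult_left_mono) auto
    also have "\<dots> = (v - 1) powr (-y)"
      using v powr_mult[of v "1 - 1 / v" "-y"] by (simp add: right_diff_distrib)
    also have "v powr (-y) * (1 + y / v) = v powr (-y) + y * v powr (-y-1)"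
      using v by (simp add: powr_diff field_simps)
    finally have "y * v powr (-y-1) \<le> (v - 1) powr (-y) - v powr (-y)" by simp
    then show ?thesis using y by (simp add: v_def field_simps)
  qed
  show "(\<Sum>n. real (n + Suc N) powr (-y-1)) \<le> real N powr (-y) / y"
  proof (rule suminf_le_const[OF sm])
    fix m
    have "(\<Sum>n<m. real (n + Suc N) powr (-y-1))
        \<le> (\<Sum>n<m. (real (n + N) powr (-y) - real (Suc n + N) powr (-y)) / y)"
      using le by (intro sum_mono) simp
    also have "\<dots> = (real (0 + N) powr (-y) - real (m + N) powr (-y)) / y"
      unfolding sum_divide_distrib[symmetric] by (subst sum_lessThan_telescope') simp
    also have "\<dots> \<le> real N powr (-y) / y"
      using y by (intro divide_right_mono) auto
    finally show "(\<Sum>n<m. real (n + Suc N) powr (-y-1)) \<le> real N powr (-y) / y" .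
  qed
qed

text \<open>For y <= 1 the summand decreases and N^y / y alone suffices; for y > 1 it increases and
  its last value must be added. Large y do occur: on the left arc of the contour -Re z runs up to
  R.\<close>

lemma sum_powr_initial_le:
  fixes y :: real
  assumes y: "y > 0" and N: "N \<ge> 1"
  shows "(\<Sum>n=1..N. real n powr (y-1)) \<le> real N powr y / y + real N powr (y-1)"
proof -
  have mvt: "\<exists>z. real n < z \<and> z < real (Suc n) \<and> real (Suc n) powr y - real n powr y = y * z powr (y-1)"
    if "n \<ge> 1" for n
  proof -
    have "\<exists>z>real n. z < real (Suc n) \<and> real (Suc n) powr y - real n powr y = (real (Suc n) - real n) * (y * z powr (y-1))"
      using that by (intro MVT2) (auto intro!: derivative_eq_intros)
    then show ?thesis by auto
  qed
  show ?thesis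
  proof (cases "y \<le> 1")
    case True
    have "(\<Sum>n=1..N. real n powr (y-1)) \<le> real N powr y / y"
      using N
    proof (induction N rule: dec_induct)
      case base
      then show ?case using y True by simp
    next
      case (step n)
      obtain z where z: "real n < z" "z < real (Suc n)" "real (Suc n) powr y - real n powr y = y * z powr (y-1)"
        using mvt step.hyps by auto
      have "y * real (Suc n) powr (y-1) \<le> y * z powr (y-1)"
        using z y True by (intro mult_left_mono powr_mono2') auto
      then have "real (Suc n) powr (y-1) \<le> (real (Suc n) powr y - real n powr y) / y"
        using y z(3) by (simp add: field_simps del: of_nat_Suc)
      then show ?case using step.IH y step.hyps by (simp add: diff_divide_distrib)
    qed
    then show ?thesis by (simp add: add_increasing2)
  next
    case False
    show ?thesis using N
    proof (induction N rule: dec_induct)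
      case base
      then show ?case using y by simp
    next
      case (step n)
      obtain z where z: "real n < z" "z < real (Suc n)" "real (Suc n) powr y - real n powr y = y * z powr (y-1)"
        using mvt step.hyps by auto
      have "y * real n powr (y-1) \<le> y * z powr (y-1)"
        using z y False by (intro mult_left_mono powr_mono2) auto
      then have "real n powr (y-1) \<le> (real (Suc n) powr y - real n powr y) / y"
        using y z(3) by (simp add: field_simps del: of_nat_Suc)
      then show ?case using step.IH y step.hyps by (simp add: diff_divide_distrib)
    qed
  qed
qed

lemma norm_initial_dirichlet_le:
  fixes a :: "nat \<Rightarrow> complex"
  assumes a: "\<And>n. n \<ge> 1 \<Longrightarrow> norm (a n) \<le> 1 + ln (real n)" and N: "N \<ge> 1" and z: "Re z < 0"
  shows "norm (\<Sum>n\<le>N. a n * of_nat n powr (-z-1))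
    \<le> (1 + ln (real N)) * (real N powr (- Re z) / (- Re z) + real N powr (- Re z - 1))"
proof -
  have "norm (\<Sum>n\<le>N. a n * of_nat n powr (-z-1)) \<le> (\<Sum>n\<le>N. norm (a n) * real n powr (- Re z - 1))"
    by (rule order_trans[OF norm_sum]) (simp add: norm_mult norm_of_nat_powr)
  also have "\<dots> = (\<Sum>n=1..N. norm (a n) * real n powr (- Re z - 1))"
    by (rule sum.mono_neutral_right) (auto simp: Suc_le_eq)
  also have "\<dots> \<le> (\<Sum>n=1..N. (1 + ln (real N)) * real n powr (- Re z - 1))"
    using a by (intro sum_mono mult_right_mono order_trans[OF a]) auto
  also have "\<dots> = (1 + ln (real N)) * (\<Sum>n=1..N. real n powr (- Re z - 1))"
    by (simp add: sum_distrib_left)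
  also have "\<dots> \<le> (1 + ln (real N)) * (real N powr (- Re z) / (- Re z) + real N powr (- Re z - 1))"
    using z N by (intro mult_left_mono sum_powr_initial_le add_nonneg_nonneg) auto
  finally show ?thesis .
qed

text \<open>In log m = log N + log(m/N) the second logarithm is at most (2/x) (m/N)^(x/2), where x =
  Re z. Half of the decay pays for it, and the price is the term 4 / x^2, which the kernel has to
  cancel.\<close>

lemma norm_tail_dirichlet_le:
  fixes a :: "nat \<Rightarrow> complex"
  assumes a: "\<And>n. n \<ge> 1 \<Longrightarrow> norm (a n) \<le> 1 + ln (real n)" and N: "N \<ge> 1" and z: "Re z > 0"
    and G: "(\<lambda>n. a n * of_nat n powr (-z-1)) sums G"
  shows "norm (G - (\<Sum>n\<le>N. a n * of_nat n powr (-z-1)))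
    \<le> real N powr (- Re z) * ((1 + ln (real N)) / Re z + 4 / (Re z)\<^sup>2)"
proof -
  define x where "x = Re z"
  have x: "x > 0" using z by (simp add: x_def)
  let ?h = "\<lambda>n. (1 + ln (real N)) * real (n + Suc N) powr (-x-1)
      + 2 / x * real N powr (-x/2) * real (n + Suc N) powr (-(x/2)-1)"
  have "(\<lambda>n. a (n + Suc N) * of_nat (n + Suc N) powr (-z-1)) sums (G - (\<Sum>n<Suc N. a n * of_nat n powr (-z-1)))"
    using G by (subst sums_iff_shift) simp
  then have s: "(\<lambda>n. a (n + Suc N) * of_nat (n + Suc N) powr (-z-1)) sums (G - (\<Sum>n\<le>N. a n * of_nat n powr (-z-1)))"
    by (simp only: lessThan_Suc_atMost)
  have t1: "summable (\<lambda>n. real (n + Suc N) powr (-x-1))" "(\<Sum>n. real (n + Suc N) powr (-x-1)) \<le> real N powr (-x) / x"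
    using sum_powr_tail_le[OF x N] by simp_all
  have t2: "summable (\<lambda>n. real (n + Suc N) powr (-(x/2)-1))"
      "(\<Sum>n. real (n + Suc N) powr (-(x/2)-1)) \<le> real N powr (-(x/2)) / (x/2)"
    using sum_powr_tail_le[of "x/2" N] x N by simp_all
  have "norm (G - (\<Sum>n\<le>N. a n * of_nat n powr (-z-1))) \<le> suminf ?h"
  proof (rule norm_sums_le[OF s summable_sums])
    show "summable ?h" using t1(1) t2(1) by (intro summable_add summable_mult)
    fix n
    define m where "m = real (n + Suc N)"
    have m: "m \<ge> real N" "m > 0" using N by (auto simp: m_def)
    have N0: "real N > 0" using N by simp
    have "ln m = ln (real N) + ln (m / real N)" using m N0 by (simp add: ln_div)
    also have "ln (m / real N) \<le> (m / real N) powr (x/2) / (x/2)"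
      using m N0 x by (intro ln_powr_bound) auto
    also have "(m / real N) powr (x/2) = m powr (x/2) * real N powr (-x/2)"
      using m N0 by (simp add: powr_divide powr_minus_divide)
    finally have lnm: "ln m \<le> ln (real N) + 2 / x * real N powr (-x/2) * m powr (x/2)"
      using x by (simp add: field_simps)
    have "norm (a (n + Suc N) * of_nat (n + Suc N) powr (-z-1)) = norm (a (n + Suc N)) * m powr (-x-1)"
      by (simp add: norm_mult norm_of_nat_powr m_def x_def del: of_nat_Suc of_nat_add)
    also have "\<dots> \<le> (1 + ln m) * m powr (-x-1)"
      unfolding m_def by (intro mult_right_mono a) auto
    also have "\<dots> \<le> (1 + (ln (real N) + 2 / x * real N powr (-x/2) * m powr (x/2))) * m powr (-x-1)"
      using lnm by (intro mult_right_mono add_left_mono) auto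
    also have "\<dots> = (1 + ln (real N)) * m powr (-x-1) + 2 / x * real N powr (-x/2) * (m powr (x/2) * m powr (-x-1))"
      by (simp add: algebra_simps)
    also have "m powr (x/2) * m powr (-x-1) = m powr (-(x/2)-1)"
      by (simp add: powr_add[symmetric])
    finally show "norm (a (n + Suc N) * of_nat (n + Suc N) powr (-z-1)) \<le> ?h n"
      by (simp only: m_def)
  qed
  also have "suminf ?h = (1 + ln (real N)) * (\<Sum>n. real (n + Suc N) powr (-x-1))
      + 2 / x * real N powr (-x/2) * (\<Sum>n. real (n + Suc N) powr (-(x/2)-1))"
    by (subst suminf_add[symmetric]) (intro summable_mult t1(1) t2(1) | simp only: suminf_mult[OF t1(1)] suminf_mult[OF t2(1)])+
  also have "\<dots> \<le> (1 + ln (real N)) * (real N powr (-x) / x)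
      + 2 / x * real N powr (-x/2) * (real N powr (-(x/2)) / (x/2))"
    using t1(2) t2(2) x N by (intro add_mono mult_left_mono) auto
  also have "\<dots> = real N powr (-x) * ((1 + ln (real N)) / x + 4 / x\<^sup>2)"
  proof -
    have "real N powr (-x/2) * real N powr (-(x/2)) = real N powr (-x)"
      by (simp add: powr_add[symmetric])
    then have "2 / x * real N powr (-x/2) * (real N powr (-(x/2)) / (x/2)) = 4 / x\<^sup>2 * real N powr (-x)"
      by (simp add: power2_eq_square field_simps)
    then show ?thesis by (simp add: algebra_simps)
  qed
  finally show ?thesis by (simp add: x_def)
qed

text \<open>The contour comes in two pieces because the same right-hand piece is closed up in two
  ways: by a chord for the continued function, by the rest of the circle for the entire partial sum.
  The condition on 1/z stands in for winding number 1.\<close>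

lemma Cauchy_formula_two_arcs:
  fixes f :: "complex \<Rightarrow> complex"
  assumes S: "open S" "convex S" "0 \<in> S" and f: "f holomorphic_on S"
    and p: "valid_path p" "path_image p \<subseteq> S - {0}" and q: "valid_path q" "path_image q \<subseteq> S - {0}"
    and pq: "pathfinish p = pathstart q" "pathfinish q = pathstart p"
    and one: "contour_integral p (\<lambda>z. 1 / z) + contour_integral q (\<lambda>z. 1 / z) = 2 * pi * \<i>"
  shows "contour_integral p (\<lambda>z. f z / z) + contour_integral q (\<lambda>z. f z / z) = 2 * pi * \<i> * f 0"
proof -
  \<comment> \<open>The difference quotient with its removable singularity filled in. It integrates
    to 0 around the closed path, leaving f(0) times the integral of 1/z.\<close>
  define h where "h = (\<lambda>z. if z = 0 then deriv f 0 else (f z - f 0) / (z - 0))"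
  have hol: "h holomorphic_on S"
    unfolding h_def using f S(1) by (rule pole_lemma_open)
  have int: "g contour_integrable_on p" "g contour_integrable_on q" if "g holomorphic_on S - {0}" for g
    using that p q S by (auto intro!: contour_integrable_holomorphic_simple[of _ "S - {0}"])
  have hol': "h holomorphic_on S - {0}" "(\<lambda>z. 1 / z) holomorphic_on S - {0}"
    by (rule holomorphic_on_subset[OF hol]) (auto intro!: holomorphic_intros)
  have "(h has_contour_integral 0) (p +++ q)"
    using hol S p q pq
    by (intro Cauchy_theorem_convex_simple[of h S])
       (auto simp: path_image_join[OF pq(1)] intro!: valid_path_join)
  then have zero: "contour_integral p h + contour_integral q h = 0"
    using contour_integral_join[OF int(1)[OF hol'(1)] int(2)[OF hol'(1)] p(1) q(1)]
    by (simp add: contour_integral_unique)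
  have eq: "contour_integral r (\<lambda>z. f z / z) = contour_integral r h + f 0 * contour_integral r (\<lambda>z. 1 / z)"
    if r: "path_image r \<subseteq> S - {0}" "h contour_integrable_on r" "(\<lambda>z. 1 / z) contour_integrable_on r" for r
  proof -
    have "contour_integral r (\<lambda>z. f z / z) = contour_integral r (\<lambda>z. h z + f 0 * (1 / z))"
      by (rule contour_integral_eq) (use r in \<open>auto simp: h_def field_simps\<close>)
    also have "\<dots> = contour_integral r h + contour_integral r (\<lambda>z. f 0 * (1 / z))"
      by (intro contour_integral_add r contour_integrable_lmul)
    also have "contour_integral r (\<lambda>z. f 0 * (1 / z)) = f 0 * contour_integral r (\<lambda>z. 1 / z)"
      by (intro contour_integral_lmul r)
    finally show ?thesis .
  qed
  have "contour_integral p (\<lambda>z. f z / z) + contour_integral q (\<lambda>z. f z / z)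
      = (contour_integral p h + contour_integral q h)
        + f 0 * (contour_integral p (\<lambda>z. 1 / z) + contour_integral q (\<lambda>z. 1 / z))"
    by (simp add: eq p q int hol' distrib_left)
  then show ?thesis by (simp add: zero one)
qed

lemma contour_integral_part_circlepath_inverse:
  assumes "s < t" "R > 0"
  shows "contour_integral (part_circlepath 0 R s t) (\<lambda>z. 1 / z) = \<i> * of_real (t - s)"
proof -
  have "contour_integral (part_circlepath 0 R s t) (\<lambda>z. 1 / z)
      = integral {s..t} (\<lambda>u. 1 / (0 + R * cis u) * R * \<i> * cis u)"
    using assms(1) by (rule contour_integral_part_circlepath_eq)
  also have "(\<lambda>u. 1 / (0 + R * cis u) * R * \<i> * cis u) = (\<lambda>u. \<i>)"
    using assms(2) by (simp add: field_simps fun_eq_iff)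
  finally show ?thesis using assms by (simp add: scaleR_conv_of_real mult.commute)
qed

text \<open>On the circle R^2 = z * cnj z, so z^2 + R^2 = 2 z Re z: the factor vanishes exactly
  where the circle meets the imaginary axis.\<close>

lemma norm_one_plus_square_circle:
  fixes z :: complex
  assumes "norm z = R" "R > 0"
  shows "norm (1 + (z / of_real R)\<^sup>2) = 2 * \<bar>Re z\<bar> / R"
proof -
  have "of_real (R\<^sup>2) = z * cnj z"
    using assms(1) by (simp add: complex_norm_square[symmetric])
  then have "z\<^sup>2 + of_real (R\<^sup>2) = z * of_real (2 * Re z)"
    by (simp add: power2_eq_square distrib_left[symmetric] complex_add_cnj)
  moreover have "1 + (z / of_real R)\<^sup>2 = (z\<^sup>2 + of_real (R\<^sup>2)) / of_real (R\<^sup>2)"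
    using assms(2) by (simp add: field_simps)
  ultimately have "norm (1 + (z / of_real R)\<^sup>2) = norm z * (2 * \<bar>Re z\<bar>) / R\<^sup>2"
    by (simp only: norm_divide norm_mult norm_of_real) (simp add: abs_mult)
  then show ?thesis using assms by (simp add: power2_eq_square)
qed

text \<open>\<phi> is the angle with R cos \<phi> = -1/4. Shifted by 1 this abscissa becomes Re s =
  3/4, the left edge of the strip in which the logarithmic derivative of \<open>zeta_reg\<close> is
  bounded.\<close>

lemma Newman_contour:
  fixes R :: real
  assumes R: "R \<ge> 1"
  obtains \<phi> where "0 < \<phi>" "\<phi> < pi"
    "\<And>z. z \<in> path_image (part_circlepath 0 R (-\<phi>) \<phi>) \<Longrightarrow> norm z = R \<and> Re z \<ge> -1/4"
    "\<And>z. z \<in> path_image (part_circlepath 0 R \<phi> (2 * pi - \<phi>)) \<Longrightarrow> norm z = R \<and> Re z \<le> -1/4"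
    "\<And>z. z \<in> closed_segment (R * exp (\<i> * \<phi>)) (R * exp (\<i> * of_real (-\<phi>))) \<Longrightarrow> norm z \<le> R \<and> Re z = -1/4"
    "R * exp (\<i> * of_real (-\<phi>)) = R * exp (\<i> * of_real (2 * pi - \<phi>))"
proof -
  define \<phi> where "\<phi> = arccos (- (1/4) / R)"
  have b: "-1 < - (1/4) / R" "- (1/4) / R < 1" using R by (auto simp: field_simps)
  have \<phi>: "0 < \<phi>" "\<phi> < pi" "R * cos \<phi> = -1/4"
    using arccos_lt_bounded[OF b] cos_arccos[of "- (1/4) / R"] b R by (auto simp: \<phi>_def)
  have re: "Re (R * exp (\<i> * of_real t)) = R * cos t" "norm (R * exp (\<i> * of_real t)) = R" for t
    using R by (auto simp: Re_exp norm_mult)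
  have c1: "R * cos t \<ge> -1/4" if "-\<phi> \<le> t" "t \<le> \<phi>" for t
  proof -
    have "cos \<bar>t\<bar> \<ge> cos \<phi>" using that \<phi> by (intro cos_monotone_0_pi_le) auto
    then have "R * cos \<bar>t\<bar> \<ge> R * cos \<phi>" using R by (intro mult_left_mono) auto
    then show ?thesis using \<phi> by simp
  qed
  have c2: "R * cos t \<le> -1/4" if "\<phi> \<le> t" "t \<le> 2 * pi - \<phi>" for t
  proof -
    have "cos t \<le> cos \<phi>"
    proof (cases "t \<le> pi")
      case True
      then show ?thesis using that \<phi> by (intro cos_monotone_0_pi_le) auto
    next
      case False
      then have "cos (2 * pi - t) \<le> cos \<phi>" using that \<phi> by (intro cos_monotone_0_pi_le) auto
      then show ?thesis by (simp add: cos_diff)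
    qed
    then have "R * cos t \<le> R * cos \<phi>" using R by (intro mult_left_mono) auto
    then show ?thesis using \<phi> by simp
  qed
  show ?thesis
  proof (rule that[OF \<phi>(1,2)])
    fix z assume "z \<in> path_image (part_circlepath 0 R (-\<phi>) \<phi>)"
    then obtain t where t: "z = R * exp (\<i> * of_real t)" "-\<phi> \<le> t" "t \<le> \<phi>"
      using \<phi> by (auto simp: path_image_part_circlepath)
    show "norm z = R \<and> Re z \<ge> -1/4" unfolding t(1) re using c1[OF t(2,3)] by simp
  next
    fix z assume "z \<in> path_image (part_circlepath 0 R \<phi> (2 * pi - \<phi>))"
    then obtain t where t: "z = R * exp (\<i> * of_real t)" "\<phi> \<le> t" "t \<le> 2 * pi - \<phi>"
      using \<phi> by (auto simp: path_image_part_circlepath)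
    show "norm z = R \<and> Re z \<le> -1/4" unfolding t(1) re using c2[OF t(2,3)] by simp
  next
    fix z assume z: "z \<in> closed_segment (R * exp (\<i> * \<phi>)) (R * exp (\<i> * of_real (-\<phi>)))"
    have "closed_segment (R * exp (\<i> * \<phi>)) (R * exp (\<i> * of_real (-\<phi>))) \<subseteq> cball 0 R"
      using re(2)[of \<phi>] re(2)[of "-\<phi>"] by (intro closed_segment_subset) (auto simp: dist_norm)
    moreover have "closed_segment (R * exp (\<i> * \<phi>)) (R * exp (\<i> * of_real (-\<phi>))) \<subseteq> {z. Re z = -1/4}"
    proof (rule closed_segment_subset)
      show "convex {z. Re z = -1/4}"
        by (auto simp: convex_def distrib_right[symmetric] simp flip: distrib_left)
    qed (use re(1)[of \<phi>] re(1)[of "-\<phi>"] \<phi>(3) in auto)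
    ultimately show "norm z \<le> R \<and> Re z = -1/4" using z by auto
  next
    have "exp (\<i> * of_real (2 * pi - \<phi>)) = exp (\<i> * of_real (-\<phi>)) * exp (\<i> * of_real (2 * pi))"
      by (simp only: exp_add[symmetric] distrib_left[symmetric] of_real_add[symmetric]) simp
    also have "exp (\<i> * of_real (2 * pi)) = 1" by (simp add: exp_eq_polar cis_2pi)
    finally show "R * exp (\<i> * of_real (-\<phi>)) = R * exp (\<i> * of_real (2 * pi - \<phi>))" by simp
  qed
qed

text \<open>
  The square in the kernel \<open>(1 + z\<^sup>2 / R\<^sup>2)\<^sup>2 N\<^sup>z / z\<close> makes it vanish to second order at \<open>\<plusminus> i R\<close>. This
  compensates the factor \<open>1 / (Re z)\<^sup>2\<close> by which the tail of a series with logarithmically growing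
  coefficients blows up near the imaginary axis.
\<close>

lemma Newman_estimate:
  fixes a :: "nat \<Rightarrow> complex" and R B :: real
  assumes a: "\<And>n. n \<ge> 1 \<Longrightarrow> norm (a n) \<le> 1 + ln (real n)"
    and hol: "G holomorphic_on {z. Re z > -1/2}"
    and sums: "\<And>z. Re z > 0 \<Longrightarrow> (\<lambda>n. a n * of_nat n powr (-z-1)) sums G z"
    and B: "B > 0" "\<And>z. -1/4 \<le> Re z \<Longrightarrow> Re z \<le> 0 \<Longrightarrow> norm z \<ge> 1/4 \<Longrightarrow> norm (G z) \<le> B * (1 + norm z)"
    and R: "1 \<le> R" "R \<le> real N"
  shows "norm (G 0 - (\<Sum>n\<le>N. a n * of_nat n powr (-1)))
    \<le> (28 + B) * (1 + ln (real N)) / R + 11 * B * R\<^sup>2 * real N powr (-1/4)"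
proof -
  have N: "real N \<ge> 1" "N \<ge> 1" using R by auto
  define l where "l = 1 + ln (real N)"
  have l: "l \<ge> 1" using N by (simp add: l_def)
  \<comment> \<open>The partial sum is entire, so its Cauchy integral may use the whole circle,
    including the left arc, which leaves the half-plane on which \<open>G\<close> is given.\<close>
  define S where "S = (\<lambda>z. \<Sum>n\<le>N. a n * of_nat n powr (-z-1))"
  define k :: "complex \<Rightarrow> complex" where "k = (\<lambda>z. of_nat N powr z * (1 + (z / of_real R)\<^sup>2)\<^sup>2)"
  have holS: "S holomorphic_on UNIV"
  proof -
    have "(\<lambda>z. a n * of_nat n powr (-z-1)) holomorphic_on UNIV" for n
      by (cases "n = 0") (auto intro!: holomorphic_intros simp: complex_nonpos_Reals_iff)
    then show ?thesis unfolding S_def by (rule holomorphic_on_sum)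
  qed
  have holk: "k holomorphic_on UNIV"
    unfolding k_def using N R by (intro holomorphic_intros) (auto simp: complex_nonpos_Reals_iff)
  have k0: "k 0 = 1" using N by (simp add: k_def)
  obtain \<phi> where \<phi>: "0 < \<phi>" "\<phi> < pi"
    and A1: "\<And>z. z \<in> path_image (part_circlepath 0 R (-\<phi>) \<phi>) \<Longrightarrow> norm z = R \<and> Re z \<ge> -1/4"
    and A2: "\<And>z. z \<in> path_image (part_circlepath 0 R \<phi> (2 * pi - \<phi>)) \<Longrightarrow> norm z = R \<and> Re z \<le> -1/4"
    and A3: "\<And>z. z \<in> closed_segment (R * exp (\<i> * \<phi>)) (R * exp (\<i> * of_real (-\<phi>))) \<Longrightarrow> norm z \<le> R \<and> Re z = -1/4"
    and ends: "R * exp (\<i> * of_real (-\<phi>)) = R * exp (\<i> * of_real (2 * pi - \<phi>))"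
    by (rule Newman_contour[OF R(1)]) (rule that)
  define p where "p = part_circlepath 0 R (-\<phi>) \<phi>"
  define q where "q = part_circlepath 0 R \<phi> (2 * pi - \<phi>)"
  define r where "r = linepath (R * exp (\<i> * \<phi>)) (R * exp (\<i> * of_real (-\<phi>)))"
  have vp: "valid_path p" "valid_path q" "valid_path r"
    by (simp_all add: p_def q_def r_def)
  have P: "norm z = R" "Re z \<ge> -1/4" if "z \<in> path_image p" for z
    using A1[of z] that by (simp_all add: p_def)
  have Q: "norm z = R" "Re z \<le> -1/4" if "z \<in> path_image q" for z
    using A2[of z] that by (simp_all add: q_def)
  have L: "norm z \<le> R" "Re z = -1/4" if "z \<in> path_image r" for z
    using A3[of z] that by (simp_all add: r_def)
  have ip: "path_image p \<subseteq> UNIV - {0}" "path_image p \<subseteq> {z. Re z > -1/2} - {0}"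
    using P R by fastforce+
  have iq: "path_image q \<subseteq> UNIV - {0}" "path_image q \<subseteq> {z. Re z < 0}"
    using Q R by fastforce+
  have ir: "path_image r \<subseteq> {z. Re z > -1/2} - {0}" "path_image r \<subseteq> {z. Re z < 0}"
    using L by fastforce+
  have pq: "pathfinish p = pathstart q" "pathfinish q = pathstart p"
    using ends[symmetric] by (simp_all only: p_def q_def pathstart_part_circlepath pathfinish_part_circlepath)
  have pr: "pathfinish p = pathstart r" "pathfinish r = pathstart p"
    by (simp_all add: p_def r_def)
  have one_pq: "contour_integral p (\<lambda>z. 1 / z) + contour_integral q (\<lambda>z. 1 / z) = 2 * pi * \<i>"
    unfolding p_def q_def using \<phi> R
    by (simp add: contour_integral_part_circlepath_inverse algebra_simps)
  have inv_hol: "(\<lambda>z. 1 / z) holomorphic_on {z. Re z < 0}"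
    by (intro holomorphic_intros) auto
  have inv_int: "(\<lambda>z. 1 / z) contour_integrable_on q" "(\<lambda>z. 1 / z) contour_integrable_on r"
    using vp iq ir by (auto intro!: contour_integrable_holomorphic_simple[OF inv_hol open_halfspace_Re_lt])
  \<comment> \<open>The chord \<open>r\<close> and the left arc \<open>q\<close> share their
    endpoints and lie in Re z < 0, where 1/z is holomorphic. Exchanging them keeps the integral of
    1/z, so \<open>p\<close> followed by \<open>r\<close> also winds once about 0.\<close>
  have "((\<lambda>z. 1 / z) has_contour_integral 0) (r +++ reversepath q)"
    using vp iq ir pq pr
    by (intro Cauchy_theorem_convex_simple[OF inv_hol convex_halfspace_Re_lt])
       (auto simp: path_image_join intro!: valid_path_join)
  then have "contour_integral r (\<lambda>z. 1 / z) + contour_integral (reversepath q) (\<lambda>z. 1 / z) = 0"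
    using vp inv_int
    by (subst contour_integral_join[symmetric])
       (auto simp: contour_integral_unique contour_integrable_reversepath)
  then have "contour_integral r (\<lambda>z. 1 / z) = contour_integral q (\<lambda>z. 1 / z)"
    using vp by (simp add: contour_integral_reversepath)
  then have one_pr: "contour_integral p (\<lambda>z. 1 / z) + contour_integral r (\<lambda>z. 1 / z) = 2 * pi * \<i>"
    using one_pq by simp
  define H where "H = {z. Re z > -1/2}"
  have H: "open H" "convex H" "0 \<in> H"
    by (auto simp: H_def open_halfspace_Re_gt convex_halfspace_Re_gt)
  have holGk: "(\<lambda>z. G z * k z) holomorphic_on H"
    unfolding H_def by (intro holomorphic_intros hol holomorphic_on_subset[OF holk]) auto
  have holSk: "(\<lambda>z. S z * k z) holomorphic_on UNIV"
    by (intro holomorphic_intros holS holk)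
  have int: "(\<lambda>z. G z * k z / z) contour_integrable_on p" "(\<lambda>z. G z * k z / z) contour_integrable_on r"
    "(\<lambda>z. S z * k z / z) contour_integrable_on p" "(\<lambda>z. S z * k z / z) contour_integrable_on q"
  proof -
    have "(\<lambda>z. G z * k z / z) holomorphic_on H - {0}"
      by (intro holomorphic_intros holomorphic_on_subset[OF holGk]) auto
    then show "(\<lambda>z. G z * k z / z) contour_integrable_on p" "(\<lambda>z. G z * k z / z) contour_integrable_on r"
      using vp ip ir H by (auto simp: H_def intro!: contour_integrable_holomorphic_simple[of _ "H - {0}"])
    have "(\<lambda>z. S z * k z / z) holomorphic_on UNIV - {0}"
      by (intro holomorphic_intros holomorphic_on_subset[OF holSk]) auto
    then show "(\<lambda>z. S z * k z / z) contour_integrable_on p" "(\<lambda>z. S z * k z / z) contour_integrable_on q"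
      using vp ip iq by (auto intro!: contour_integrable_holomorphic_simple[of _ "UNIV - {0}"])
  qed
  have cG: "contour_integral p (\<lambda>z. G z * k z / z) + contour_integral r (\<lambda>z. G z * k z / z) = 2 * pi * \<i> * (G 0 * k 0)"
    using H holGk vp ip ir pr one_pr by (intro Cauchy_formula_two_arcs[of H]) (auto simp: H_def)
  have cS: "contour_integral p (\<lambda>z. S z * k z / z) + contour_integral q (\<lambda>z. S z * k z / z) = 2 * pi * \<i> * (S 0 * k 0)"
    using holSk vp ip iq pq one_pq by (intro Cauchy_formula_two_arcs[of UNIV]) auto
  \<comment> \<open>On the shared arc \<open>p\<close> only the difference G - S has to be
    estimated.\<close>
  have main: "2 * pi * \<i> * (G 0 - S 0) =
      contour_integral p (\<lambda>z. G z * k z / z - S z * k z / z)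
      + contour_integral r (\<lambda>z. G z * k z / z) - contour_integral q (\<lambda>z. S z * k z / z)"
    using cG cS by (simp add: contour_integral_diff[OF int(1,3)] k0 algebra_simps)

  have kb: "norm (k z / z) = real N powr Re z * 4 * (Re z)\<^sup>2 / R ^ 3" if "norm z = R" for z
  proof -
    have "norm (k z / z) = real N powr Re z * (2 * \<bar>Re z\<bar> / R)\<^sup>2 / R"
      using that R by (simp add: k_def norm_divide norm_mult norm_power norm_of_nat_powr norm_one_plus_square_circle)
    also have "\<dots> = real N powr Re z * 4 * (Re z)\<^sup>2 / R ^ 3"
      by (simp add: power_divide power_mult_distrib power2_eq_square power3_eq_cube)
    finally show ?thesis .
  qed
  \<comment> \<open>The growth N^(-Re z) of S on the left is cancelled by the factor N^z of the
    kernel.\<close>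
  have Sb: "norm (S z * k z / z) \<le> 8 * l / R\<^sup>2" if z: "norm z = R" "Re z < 0" for z
  proof -
    define x where "x = - Re z"
    have x: "x > 0" "x \<le> R" using z abs_Re_le_cmod[of z] by (auto simp: x_def)
    have "norm (S z * k z / z) = norm (S z) * norm (k z / z)" by (simp add: norm_mult norm_divide)
    also have "\<dots> \<le> (l * (real N powr x / x + real N powr (x - 1))) * (real N powr (-x) * 4 * x\<^sup>2 / R ^ 3)"
    proof (intro mult_mono)
      show "norm (S z) \<le> l * (real N powr x / x + real N powr (x - 1))"
        using norm_initial_dirichlet_le[OF a N(2) z(2)] by (simp add: S_def l_def x_def)
      show "norm (k z / z) \<le> real N powr (-x) * 4 * x\<^sup>2 / R ^ 3"
        using kb[OF z(1)] by (simp add: x_def)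
    qed (use l x R in auto)
    also have "\<dots> = l * (4 * x + 4 * x\<^sup>2 / real N) / R ^ 3"
      using x N R by (simp add: powr_diff powr_minus field_simps power2_eq_square)
    also have "\<dots> \<le> l * (4 * R + 4 * R) / R ^ 3"
    proof (intro divide_right_mono mult_left_mono add_mono)
      have "x\<^sup>2 \<le> R * real N" unfolding power2_eq_square using x R by (intro mult_mono) auto
      then show "4 * x\<^sup>2 / real N \<le> 4 * R" using N by (simp add: field_simps)
    qed (use x l R in auto)
    also have "\<dots> = 8 * l / R\<^sup>2" using R by (simp add: power2_eq_square power3_eq_cube)
    finally show ?thesis .
  qed
  \<comment> \<open>Right of the axis the factor (Re z)^2 of the kernel cancels the singularity of
    the tail bound; on the axis the kernel is 0. On the two short arcs with -1/4 <= Re z < 0 the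
    functions are bounded separately, \<open>k z / z\<close> being O(R^(-3)) against the linear
    bound for \<open>G\<close>.\<close>
  have bp: "norm (G z * k z / z - S z * k z / z) \<le> (20 + B) * l / R\<^sup>2" if "z \<in> path_image p" for z
  proof -
    note z = P[OF that]
    consider "Re z > 0" | "Re z = 0" | "Re z < 0" by linarith
    then show ?thesis
    proof cases
      case 1
      define x where "x = Re z"
      have x: "x > 0" "x \<le> R" using z 1 abs_Re_le_cmod[of z] by (auto simp: x_def)
      have "norm (G z * k z / z - S z * k z / z) = norm (G z - S z) * norm (k z / z)"
        by (simp add: norm_mult[symmetric] norm_divide[symmetric] algebra_simps diff_divide_distrib)
      also have "\<dots> \<le> (real N powr (- x) * (l / x + 4 / x\<^sup>2)) * (real N powr x * 4 * x\<^sup>2 / R ^ 3)"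
      proof (intro mult_mono)
        show "norm (G z - S z) \<le> real N powr (- x) * (l / x + 4 / x\<^sup>2)"
          using norm_tail_dirichlet_le[OF a N(2) 1 sums[OF 1]] by (simp add: S_def l_def x_def)
        show "norm (k z / z) \<le> real N powr x * 4 * x\<^sup>2 / R ^ 3"
          using kb[OF z(1)] by (simp add: x_def)
      qed (use l x R in auto)
      also have "\<dots> = (4 * (x * l) + 16) / R ^ 3"
        using x N R by (simp add: powr_minus field_simps power2_eq_square)
      also have "\<dots> \<le> (4 * (R * l) + 16 * (R * l)) / R ^ 3"
        using x l R mult_mono[of 1 R 1 l] by (intro divide_right_mono add_mono mult_left_mono mult_right_mono) auto
      also have "\<dots> = 20 * l / R\<^sup>2" using R by (simp add: power2_eq_square power3_eq_cube)
      also have "\<dots> \<le> (20 + B) * l / R\<^sup>2"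
        using B l by (intro divide_right_mono mult_right_mono) auto
      finally show ?thesis .
    next
      case 2
      then have "k z = 0" using kb[OF z(1)] R z by auto
      then show ?thesis using B l by simp
    next
      case 3
      have "norm (G z * k z / z) = norm (G z) * norm (k z / z)" by (simp add: norm_mult norm_divide)
      also have "\<dots> \<le> (B * (1 + R)) * (1 * 4 * (1/4)\<^sup>2 / R ^ 3)"
      proof (intro mult_mono)
        show "norm (G z) \<le> B * (1 + R)" using B(2)[of z] z 3 R by simp
        have "(Re z)\<^sup>2 \<le> (1/4)\<^sup>2" using z 3 by (simp add: abs_le_square_iff[symmetric])
        moreover have "real N powr Re z \<le> 1" using N 3 powr_mono[of "Re z" 0 "real N"] by simp
        ultimately show "norm (k z / z) \<le> 1 * 4 * (1/4)\<^sup>2 / R ^ 3"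
          unfolding kb[OF z(1)] using R by (intro divide_right_mono mult_mono) auto
      qed (use B R in auto)
      also have "\<dots> \<le> (B * (2 * R)) * (1 * 4 * (1/4)\<^sup>2 / R ^ 3)"
        using B R by (intro mult_right_mono mult_left_mono) auto
      also have "\<dots> \<le> B / R\<^sup>2" using R B by (simp add: power2_eq_square power3_eq_cube field_simps)
      also have "\<dots> \<le> B * l / R\<^sup>2" using B l by (intro divide_right_mono) auto
      finally have "norm (G z * k z / z) + norm (S z * k z / z) \<le> B * l / R\<^sup>2 + 8 * l / R\<^sup>2"
        using Sb[OF z(1) 3] by (intro add_mono)
      also have "\<dots> \<le> (20 + B) * l / R\<^sup>2"
        using l by (simp add: add_divide_distrib[symmetric] distrib_right divide_right_mono)
      finally show ?thesis using norm_triangle_ineq4[of "G z * k z / z" "S z * k z / z"] by linarith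
    qed
  qed
  have len: "\<bar>\<phi> - (-\<phi>)\<bar> \<le> 2 * pi" "\<bar>2 * pi - \<phi> - \<phi>\<bar> \<le> 2 * pi" using \<phi> by auto
  have Ip: "norm (contour_integral p (\<lambda>z. G z * k z / z - S z * k z / z)) \<le> (20 + B) * l / R\<^sup>2 * R * (2 * pi)"
  proof -
    have "norm (contour_integral p (\<lambda>z. G z * k z / z - S z * k z / z)) \<le> (20 + B) * l / R\<^sup>2 * R * \<bar>\<phi> - (-\<phi>)\<bar>"
      unfolding p_def using B l R bp int
      by (intro contour_integral_bound_part_circlepath contour_integrable_diff) (auto simp: p_def)
    also have "\<dots> \<le> (20 + B) * l / R\<^sup>2 * R * (2 * pi)"
      using B l R by (intro mult_left_mono len) auto
    finally show ?thesis .
  qed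
  have Iq: "norm (contour_integral q (\<lambda>z. S z * k z / z)) \<le> 8 * l / R\<^sup>2 * R * (2 * pi)"
  proof -
    have "norm (S z * k z / z) \<le> 8 * l / R\<^sup>2" if "z \<in> path_image q" for z
      using Q[OF that] by (intro Sb) auto
    then have "norm (contour_integral q (\<lambda>z. S z * k z / z)) \<le> 8 * l / R\<^sup>2 * R * \<bar>2 * pi - \<phi> - \<phi>\<bar>"
      unfolding q_def using l R int
      by (intro contour_integral_bound_part_circlepath) (auto simp: q_def)
    also have "\<dots> \<le> 8 * l / R\<^sup>2 * R * (2 * pi)"
      using l R by (intro mult_left_mono len) auto
    finally show ?thesis .
  qed
  \<comment> \<open>The decay on the chord is |N^z| = N^(-1/4). The 32 is 2 * 4 * 4, from 1 + |z| <=
    2R, (1 + (|z|/R)^2)^2 <= 4 and 1/|z| <= 4; the chord has length at most 2R.\<close>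
  have Ir: "norm (contour_integral r (\<lambda>z. G z * k z / z)) \<le> 32 * B * R * real N powr (-1/4) * (2 * R)"
  proof -
    have b: "norm (G z * k z / z) \<le> 32 * B * R * real N powr (-1/4)" if z: "z \<in> path_image r" for z
    proof -
      have n: "norm z \<ge> 1/4" using abs_Re_le_cmod[of z] L[OF z] by simp
      have G: "norm (G z) \<le> B * (2 * R)"
      proof -
        have "norm (G z) \<le> B * (1 + norm z)" using L[OF z] n by (intro B) auto
        also have "\<dots> \<le> B * (2 * R)" using B L[OF z] R by (intro mult_left_mono) auto
        finally show ?thesis .
      qed
      have "norm (1 + (z / of_real R)\<^sup>2) \<le> 1 + (norm z / R)\<^sup>2"
        using norm_triangle_ineq[of 1 "(z / of_real R)\<^sup>2"] R by (simp add: norm_power norm_divide)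
      also have "\<dots> \<le> 1 + 1\<^sup>2"
        using L[OF z] R by (intro add_left_mono power_mono) auto
      finally have "norm (1 + (z / of_real R)\<^sup>2) ^ 2 \<le> 2 ^ 2" by (intro power_mono) auto
      then have "norm (k z) \<le> real N powr (-1/4) * 4"
        using L[OF z] by (simp add: k_def norm_mult norm_power norm_of_nat_powr mult_left_mono)
      then have "norm (k z) / norm z \<le> real N powr (-1/4) * 4 / (1/4)"
        using n by (intro frac_le) auto
      then have "norm (G z) * (norm (k z) / norm z) \<le> B * (2 * R) * (real N powr (-1/4) * 4 / (1/4))"
        using G B R by (intro mult_mono) auto
      then show ?thesis by (simp add: norm_mult norm_divide mult_ac)
    qed
    have "norm (R * exp (\<i> * of_real (-\<phi>)) - R * exp (\<i> * \<phi>)) \<le> R + R"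
      by (rule order_trans[OF norm_triangle_ineq4]) (use R in \<open>simp add: norm_mult\<close>)
    moreover have "norm (contour_integral r (\<lambda>z. G z * k z / z))
        \<le> 32 * B * R * real N powr (-1/4) * norm (R * exp (\<i> * of_real (-\<phi>)) - R * exp (\<i> * \<phi>))"
      unfolding r_def using B R b int
      by (intro contour_integral_bound_linepath) (auto simp: r_def)
    ultimately show ?thesis using B R by (elim order_trans) (intro mult_left_mono, auto)
  qed
  have "2 * pi * norm (G 0 - S 0) = norm (2 * pi * \<i> * (G 0 - S 0))"
    by (simp add: norm_mult)
  also have "\<dots> \<le> (20 + B) * l / R\<^sup>2 * R * (2 * pi) + 32 * B * R * real N powr (-1/4) * (2 * R) + 8 * l / R\<^sup>2 * R * (2 * pi)"
    unfolding main
    by (rule order_trans[OF norm_triangle_ineq4 add_mono[OF order_trans[OF norm_triangle_ineq add_mono[OF Ip Ir]] Iq]])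
  also have "\<dots> = 2 * pi * ((28 + B) * l / R) + 64 * (B * R\<^sup>2 * real N powr (-1/4))"
    using R by (simp add: field_simps power2_eq_square)
  also have "\<dots> \<le> 2 * pi * ((28 + B) * l / R) + 2 * pi * (11 * (B * R\<^sup>2 * real N powr (-1/4)))"
  proof -
    have "64 * (B * R\<^sup>2 * real N powr (-1/4)) \<le> (22 * pi) * (B * R\<^sup>2 * real N powr (-1/4))"
      using pi_gt3 B by (intro mult_right_mono) auto
    then show ?thesis by simp
  qed
  finally have "2 * pi * norm (G 0 - S 0) \<le> 2 * pi * ((28 + B) * l / R + 11 * (B * R\<^sup>2 * real N powr (-1/4)))"
    by (simp add: distrib_left)
  then have "norm (G 0 - S 0) \<le> (28 + B) * l / R + 11 * (B * R\<^sup>2 * real N powr (-1/4))"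
    by (rule mult_left_le_imp_le) simp
  then show ?thesis by (simp add: S_def l_def mult_ac)
qed

section \<open>The prime number theorem with a power saving\<close>

text \<open>For the coefficients \<Lambda>(n) - 1 the poles of -zeta'/zeta and of zeta at 1 cancel,
  so the sum of the series continues to Re z > -1/2 and Newman's estimate can be read off at z =
  0.\<close>

lemma sum_mangoldt_over_n:
  assumes RH: "Riemann_Hypothesis"
  obtains c K :: real where "K > 0"
    "\<And>N. N \<ge> 1 \<Longrightarrow> \<bar>(\<Sum>n\<le>N. (mangoldt n - 1) / real n) - c\<bar> \<le> K * real N powr (-1/32)"
proof -
  define a where "a = (\<lambda>n. mangoldt n - 1 :: complex)"
  \<comment> \<open>The continuation of zeta(s) - 1/(s - 1), with the removable point 1 filled
    in.\<close>
  define h where "h = (\<lambda>s. if s = 1 then deriv zeta_reg 1 else (zeta_reg s - zeta_reg 1) / (s - 1))"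
  define G where "G = (\<lambda>z. - (deriv zeta_reg (1 + z) / zeta_reg (1 + z)) - h (1 + z))"
  have op: "open {s. 0 < Re s}" by (rule open_halfspace_Re_gt)
  have hol_h: "h holomorphic_on {s. 0 < Re s}"
    unfolding h_def by (rule pole_lemma_open[OF zeta_reg_holomorphic op])
  have hol0: "(\<lambda>s. - (deriv zeta_reg s / zeta_reg s) - h s) holomorphic_on {s. 1/2 < Re s}"
    using zeta_reg_nonzero[OF RH]
    by (intro holomorphic_intros holomorphic_on_subset[OF hol_h]
          holomorphic_on_subset[OF zeta_reg_holomorphic]
          holomorphic_on_subset[OF holomorphic_deriv[OF zeta_reg_holomorphic op]]) auto
  have "((\<lambda>s. - (deriv zeta_reg s / zeta_reg s) - h s) \<circ> (\<lambda>z. 1 + z)) holomorphic_on {z. Re z > -1/2}"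
    by (rule holomorphic_on_compose_gen[OF _ hol0]) (auto intro!: holomorphic_intros)
  then have holG: "G holomorphic_on {z. Re z > -1/2}" by (simp add: G_def o_def)
  have a: "norm (a n) \<le> 1 + ln (real n)" for n
    using norm_triangle_ineq4[of "mangoldt n" "1::complex"] mangoldt_le_ln[of n] by (simp add: a_def)
  have sums: "(\<lambda>n. a n * of_nat n powr (-z-1)) sums G z" if z: "Re z > 0" for z
  proof -
    define s where "s = 1 + z"
    have s: "Re s > 1" "s \<noteq> 1" "z \<noteq> 0" using z by (auto simp: s_def)
    have "(\<lambda>n. mangoldt n * of_nat n powr (-s) - 1 * of_nat n powr (-s)) sums (dirichlet_series mangoldt s - riemann_zeta s)"
      by (intro sums_diff dirichlet_series_sums_deriv(1)[OF summable_mangoldt_powr s(1)] zeta_sums s)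
    moreover have "(zeta_reg s - 1) / (s - 1) = riemann_zeta s - 1 / (s - 1)"
      using s by (simp add: zeta_reg_eq_right diff_divide_distrib)
    then have "dirichlet_series mangoldt s - riemann_zeta s = G z"
      using s by (simp add: G_def s_def[symmetric] h_def dirichlet_series_mangoldt_eq)
    moreover have "- s = - z - 1" by (simp add: s_def)
    ultimately show ?thesis by (simp only: a_def left_diff_distrib)
  qed
  obtain K0 where K0: "K0 > 0"
    "\<And>s. 3/4 \<le> Re s \<Longrightarrow> Re s \<le> 1 \<Longrightarrow> norm (deriv zeta_reg s / zeta_reg s) \<le> K0 * (1 + \<bar>Im s\<bar>)"
    by (rule zeta_reg_logderiv_le[OF RH]) (rule that)
  obtain C where C: "C > 0" "\<And>s. Re s \<ge> 1/2 \<Longrightarrow> norm (zeta_reg s) \<le> 1 + C * norm (1 - s) * norm s"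
    by (rule norm_zeta_reg_le) (rule that)
  \<comment> \<open>8 = 2 / (1/4): the quotient \<open>h\<close> is bounded by its numerator, using
    |z| >= 1/4.\<close>
  define B where "B = K0 + C + 8"
  have B: "B > 0" using K0 C by (simp add: B_def)
  have GB: "norm (G z) \<le> B * (1 + norm z)" if z: "-1/4 \<le> Re z" "Re z \<le> 0" "norm z \<ge> 1/4" for z
  proof -
    have "z \<noteq> 0" using z by auto
    have "norm (deriv zeta_reg (1 + z) / zeta_reg (1 + z)) \<le> K0 * (1 + \<bar>Im (1 + z)\<bar>)"
      using z by (intro K0) auto
    also have "\<dots> \<le> K0 * (1 + norm z)" using K0 abs_Im_le_cmod[of z] by (intro mult_left_mono) auto
    finally have 1: "norm (deriv zeta_reg (1 + z) / zeta_reg (1 + z)) \<le> K0 * (1 + norm z)" .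
    have "norm (zeta_reg (1 + z)) \<le> 1 + C * norm (1 - (1 + z)) * norm (1 + z)"
      using z by (intro C) auto
    then have F: "norm (zeta_reg (1 + z)) \<le> 1 + C * norm z * norm (1 + z)" by simp
    have "norm (h (1 + z)) = norm (zeta_reg (1 + z) - 1) / norm z"
      using \<open>z \<noteq> 0\<close> by (simp add: h_def norm_divide)
    also have "\<dots> \<le> (2 + C * norm z * norm (1 + z)) / norm z"
      using F norm_triangle_ineq4[of "zeta_reg (1 + z)" 1] by (intro divide_right_mono) auto
    also have "\<dots> = 2 / norm z + C * norm (1 + z)" using \<open>z \<noteq> 0\<close> by (simp add: field_simps)
    also have "\<dots> \<le> 2 / (1/4) + C * (1 + norm z)"
      using z C norm_triangle_ineq[of 1 z] by (intro add_mono frac_le mult_left_mono) auto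
    also have "\<dots> \<le> 8 * (1 + norm z) + C * (1 + norm z)" by simp
    finally have 2: "norm (h (1 + z)) \<le> 8 * (1 + norm z) + C * (1 + norm z)" .
    have "norm (G z) \<le> norm (deriv zeta_reg (1 + z) / zeta_reg (1 + z)) + norm (h (1 + z))"
      unfolding G_def by (metis norm_minus_cancel norm_triangle_ineq4)
    with 1 2 show ?thesis by (simp add: B_def algebra_simps)
  qed
  define K where "K = (28 + B) * 33 + 11 * B"
  have main: "\<bar>(\<Sum>n\<le>N. (mangoldt n - 1) / real n) - Re (G 0)\<bar> \<le> K * real N powr (-1/32)" if N: "N \<ge> 1" for N
  proof -
    \<comment> \<open>This radius makes the two errors N^(-1/16) log N and R^2 N^(-1/4) = N^(-1/8).
      The logarithm is absorbed by 1 + log N <= 33 N^(1/32), leaving N^(-1/32).\<close>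
    define R where "R = real N powr (1/16)"
    have R: "R \<ge> 1" "R \<le> real N"
      using N powr_mono[of "1/16" 1 "real N"] by (auto simp: R_def ge_one_powr_ge_zero)
    have "norm (G 0 - (\<Sum>n\<le>N. a n * of_nat n powr (-1)))
      \<le> (28 + B) * (1 + ln (real N)) / R + 11 * B * R\<^sup>2 * real N powr (-1/4)"
      by (rule Newman_estimate[OF a holG sums B GB R])
    also have "(28 + B) * (1 + ln (real N)) / R \<le> (28 + B) * (33 * real N powr (1/32)) / R"
    proof -
      have "ln (real N) \<le> real N powr (1/32) / (1/32)" using N by (intro ln_powr_bound) auto
      moreover have "1 \<le> real N powr (1/32)" using N by (intro ge_one_powr_ge_zero) auto
      ultimately have "1 + ln (real N) \<le> 33 * real N powr (1/32)" by simp
      then show ?thesis using B R by (intro divide_right_mono mult_left_mono) auto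
    qed
    also have "(28 + B) * (33 * real N powr (1/32)) / R = (28 + B) * 33 * (real N powr (1/32) * real N powr (-1/16))"
      by (simp add: R_def powr_minus_divide)
    also have "real N powr (1/32) * real N powr (-1/16) = real N powr (-1/32)"
      by (simp add: powr_add[symmetric])
    also have "11 * B * R\<^sup>2 * real N powr (-1/4) = 11 * B * real N powr (-1/8)"
      using N by (simp add: R_def power2_eq_square powr_add[symmetric])
    also have "11 * B * real N powr (-1/8) \<le> 11 * B * real N powr (-1/32)"
      using N B by (intro mult_left_mono powr_mono) auto
    finally have le: "norm (G 0 - (\<Sum>n\<le>N. a n * of_nat n powr (-1))) \<le> K * real N powr (-1/32)"
      by (simp add: K_def algebra_simps)
    have "Re (\<Sum>n\<le>N. a n * of_nat n powr (-1)) = (\<Sum>n\<le>N. (mangoldt n - 1) / real n)"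
      unfolding Re_sum
    proof (rule sum.cong)
      fix n
      \<comment> \<open>At n = 0 both sides are 0, by \<open>0 powr w = 0\<close> and division by
        zero.\<close>
      have "of_nat n powr (-1) = (of_real (1 / real n) :: complex)"
        by (cases "n = 0") (simp_all add: powr_minus_divide)
      moreover have "a n = of_real (mangoldt n - 1)" by (simp add: a_def)
      ultimately have "a n * of_nat n powr (-1) = of_real ((mangoldt n - 1) * (1 / real n))"
        by (simp only: of_real_mult)
      then show "Re (a n * of_nat n powr (-1)) = (mangoldt n - 1) / real n"
        by (simp only: Re_complex_of_real) simp
    qed simp
    then have "\<bar>(\<Sum>n\<le>N. (mangoldt n - 1) / real n) - Re (G 0)\<bar>
        = \<bar>Re (G 0 - (\<Sum>n\<le>N. a n * of_nat n powr (-1)))\<bar>"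
      by (simp only: minus_complex.sel abs_minus_commute)
    also have "\<dots> \<le> norm (G 0 - (\<Sum>n\<le>N. a n * of_nat n powr (-1)))" by (rule abs_Re_le_cmod)
    finally show ?thesis using le by linarith
  qed
  show ?thesis
    by (rule that[of K "Re (G 0)"]) (use B main in \<open>auto simp: K_def\<close>)
qed

lemma sum_mult_index_by_parts:
  fixes e :: "nat \<Rightarrow> real"
  shows "(\<Sum>n=1..N. real n * (e n - e (n - 1))) = real N * e N - (\<Sum>n<N. e n)"
  by (induction N) (auto simp: algebra_simps)

text \<open>Partial summation removes the weight 1/n. Measuring the partial sums from their limit
  \<open>c\<close> is what makes both resulting terms N^(1 - 1/32) in size.\<close>

lemma sum_mangoldt_asymp:
  assumes RH: "Riemann_Hypothesis"
  obtains K :: real where "K > 0"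
    "\<And>N. \<bar>(\<Sum>n=1..N. mangoldt n) - real N\<bar> \<le> K * real N powr (31/32)"
proof -
  obtain c K where K: "K > 0"
    "\<And>N. N \<ge> 1 \<Longrightarrow> \<bar>(\<Sum>n\<le>N. (mangoldt n - 1) / real n) - c\<bar> \<le> K * real N powr (-1/32)"
    by (rule sum_mangoldt_over_n[OF RH]) (rule that)
  define e where "e = (\<lambda>N. (\<Sum>n\<le>N. (mangoldt n - 1) / real n) - c)"
  have main: "\<bar>(\<Sum>n=1..N. mangoldt n) - real N\<bar> \<le> (\<bar>c\<bar> + 4 * K) * real N powr (31/32)" if N: "N \<ge> 1" for N
  proof -
    have "(\<Sum>n=1..N. mangoldt n) - real N = (\<Sum>n=1..N. mangoldt n - 1)"
      by (simp add: sum_subtractf)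
    also have "\<dots> = (\<Sum>n=1..N. real n * (e n - e (n - 1)))"
    proof (rule sum.cong)
      fix n assume "n \<in> {1..N}"
      then obtain m where m: "n = Suc m" by (cases n) auto
      show "mangoldt n - 1 = real n * (e n - e (n - 1))" by (simp add: m e_def)
    qed simp
    also have "\<dots> = real N * e N - (\<Sum>n<N. e n)" by (rule sum_mult_index_by_parts)
    finally have "\<bar>(\<Sum>n=1..N. mangoldt n) - real N\<bar> \<le> \<bar>real N * e N\<bar> + \<bar>\<Sum>n<N. e n\<bar>" by linarith
    also have "\<bar>real N * e N\<bar> \<le> real N * (K * real N powr (-1/32))"
      using K(2)[OF N] by (simp add: e_def abs_mult mult_left_mono)
    also have "\<dots> = K * real N powr (31/32)"
      using N by (simp add: powr_mult_base)
    also have "\<bar>\<Sum>n<N. e n\<bar> \<le> \<bar>c\<bar> + (\<Sum>n=1..N. K * real n powr (-1/32))"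
    proof -
      have "\<bar>\<Sum>n<N. e n\<bar> \<le> (\<Sum>n<N. \<bar>e n\<bar>)" by (rule sum_abs)
      \<comment> \<open>Index 0 is split off, since the rate is known from 1 on; there
        \<open>e 0 = - c\<close>.\<close>
      also have "\<dots> = \<bar>e 0\<bar> + (\<Sum>n=1..<N. \<bar>e n\<bar>)"
        using N by (simp add: lessThan_atLeast0 sum.atLeast_Suc_lessThan)
      also have "\<dots> \<le> \<bar>c\<bar> + (\<Sum>n=1..<N. K * real n powr (-1/32))"
        using K(2) by (intro add_mono sum_mono) (auto simp: e_def)
      also have "\<dots> \<le> \<bar>c\<bar> + (\<Sum>n=1..N. K * real n powr (-1/32))"
        using K(1) by (intro add_left_mono sum_mono2) auto
      finally show ?thesis .
    qed
    also have "(\<Sum>n=1..N. K * real n powr (-1/32)) = K * (\<Sum>n=1..N. real n powr (31/32 - 1))"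
      by (simp add: sum_distrib_left)
    also have "\<dots> \<le> K * (real N powr (31/32) / (31/32) + real N powr (31/32 - 1))"
      using K(1) N by (intro mult_left_mono sum_powr_initial_le) auto
    also have "\<dots> \<le> K * (2 * real N powr (31/32) + real N powr (31/32))"
      using K(1) N by (intro mult_left_mono add_mono powr_mono) auto
    also have "\<bar>c\<bar> \<le> \<bar>c\<bar> * real N powr (31/32)"
      using N ge_one_powr_ge_zero[of "real N" "31/32"] by (simp add: mult_left_mono[of 1 _ "\<bar>c\<bar>", simplified])
    finally show ?thesis by (simp add: algebra_simps)
  qed
  show ?thesis
  proof (rule that[of "\<bar>c\<bar> + 4 * K"])
    show "\<bar>(\<Sum>n=1..N. mangoldt n) - real N\<bar> \<le> (\<bar>c\<bar> + 4 * K) * real N powr (31/32)" for N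
      using main[of N] by (cases "N = 0") auto
  qed (use K in auto)
qed

section \<open>From the von Mangoldt function to primes\<close>

definition log_prime :: "nat \<Rightarrow> real"
  where "log_prime n = (if prime n then ln (real n) else 0)"

lemma log_prime_nonneg: "0 \<le> log_prime n"
  by (auto simp: log_prime_def dest: prime_gt_0_nat)

lemma log_prime_le_ln: "log_prime n \<le> ln (real n)"
  by (cases "n = 0") (auto simp: log_prime_def)

text \<open>The difference comes from prime powers p^k with k >= 2. There p <= sqrt N, and k <= 2
  log N because log 2 >= 1/2; so there are at most sqrt N (2 log N + 1) of them, each of weight at
  most log N.\<close>

lemma mangoldt_minus_log_prime:
  assumes N: "N \<ge> 1"
  shows "\<bar>(\<Sum>n=1..N. mangoldt n) - (\<Sum>n=1..N. log_prime n)\<bar> \<le> 4 * sqrt (real N) * (1 + ln (real N))\<^sup>2"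
proof -
  define A where "A = {n \<in> {1..N}. primepow n \<and> \<not> prime n}"
  define L where "L = nat \<lfloor>2 * ln (real N)\<rfloor>"
  define s where "s = nat \<lfloor>sqrt (real N)\<rfloor>"
  have lnN: "ln (real N) \<ge> 0" using N by simp
  have "A \<subseteq> (\<lambda>(p,k). p ^ k) ` ({1..s} \<times> {0..L})"
  proof
    fix n assume n: "n \<in> A"
    then obtain p k where p: "prime p" "k > 0" "n = p ^ k"
      by (auto simp: A_def primepow_def)
    have p2: "p \<ge> 2" using p by (simp add: prime_ge_2_nat)
    have "k \<noteq> 1" using n p by (auto simp: A_def)
    then have "k \<ge> 2" using p by simp
    then have "p\<^sup>2 \<le> p ^ k" using p2 by (intro power_increasing) auto
    then have "p\<^sup>2 \<le> N" using n p by (auto simp: A_def)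
    then have "real p \<le> sqrt (real N)"
      by (intro real_le_rsqrt) (simp flip: of_nat_power)
    then have "p \<le> s" unfolding s_def by (simp add: le_nat_floor)
    have "real k * ln 2 \<le> real k * ln (real p)" using p2 by (intro mult_left_mono) auto
    also have "\<dots> = ln (real n)" using p p2 by (simp add: ln_realpow)
    also have "\<dots> \<le> ln (real N)" using n by (auto simp: A_def)
    finally have "real k * ln 2 \<le> ln (real N)" .
    moreover have "real k * (1/2) \<le> real k * ln 2"
      using ln2_ge_two_thirds by (intro mult_left_mono) auto
    ultimately have "real k \<le> 2 * ln (real N)" by simp
    then have "k \<le> L" unfolding L_def by (simp add: le_nat_floor)
    with \<open>p \<le> s\<close> p p2 show "n \<in> (\<lambda>(p,k). p ^ k) ` ({1..s} \<times> {0..L})"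
      by (intro image_eqI[of _ _ "(p,k)"]) auto
  qed
  then have "card A \<le> card ((\<lambda>(p,k). p ^ k) ` ({1..s} \<times> {0..L}))"
    by (intro card_mono) auto
  also have "\<dots> \<le> card ({1..s} \<times> {0..L})" by (rule card_image_le) auto
  finally have "card A \<le> s * (L + 1)" by simp
  then have "real (card A) \<le> real s * (real L + 1)"
    by (metis of_nat_1 of_nat_add of_nat_le_iff of_nat_mult)
  also have "\<dots> \<le> sqrt (real N) * (2 * ln (real N) + 1)"
    using lnN by (intro mult_mono add_mono) (auto simp: s_def L_def)
  finally have card: "real (card A) \<le> sqrt (real N) * (2 * ln (real N) + 1)" .
  have "(\<Sum>n=1..N. mangoldt n) - (\<Sum>n=1..N. log_prime n) = (\<Sum>n=1..N. mangoldt n - log_prime n)"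
    by (simp add: sum_subtractf)
  also have "\<dots> = (\<Sum>n\<in>A. mangoldt n)"
    by (rule sum.mono_neutral_cong_right) (auto simp: A_def log_prime_def mangoldt_def)
  finally have eq: "(\<Sum>n=1..N. mangoldt n) - (\<Sum>n=1..N. log_prime n) = (\<Sum>n\<in>A. mangoldt n)" .
  have "(\<Sum>n\<in>A. mangoldt n) \<le> (\<Sum>n\<in>A. ln (real N))"
    by (intro sum_mono order_trans[OF mangoldt_le_ln]) (auto simp: A_def)
  also have "\<dots> = real (card A) * ln (real N)" by simp
  also have "\<dots> \<le> (sqrt (real N) * (2 * ln (real N) + 1)) * ln (real N)"
    using card lnN by (intro mult_right_mono) auto
  also have "\<dots> \<le> (sqrt (real N) * (2 * (1 + ln (real N)))) * (2 * (1 + ln (real N)))"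
    using lnN by (intro mult_mono mult_left_mono) auto
  finally show ?thesis
    unfolding eq using sum_nonneg[of A "mangoldt :: nat \<Rightarrow> real", OF mangoldt_nonneg]
    by (simp add: power2_eq_square algebra_simps)
qed

lemma sum_log_prime_asymp:
  assumes RH: "Riemann_Hypothesis"
  obtains K :: real where "K > 0"
    "\<And>N. \<bar>(\<Sum>n=1..N. log_prime n) - real N\<bar> \<le> K * real N powr (31/32)"
proof -
  obtain K where K: "K > 0" "\<And>N. \<bar>(\<Sum>n=1..N. mangoldt n) - real N\<bar> \<le> K * real N powr (31/32)"
    by (rule sum_mangoldt_asymp[OF RH]) (rule that)
  show ?thesis
  proof (rule that[of "K + 4 * 9\<^sup>2"])
    fix N
    show "\<bar>(\<Sum>n=1..N. log_prime n) - real N\<bar> \<le> (K + 4 * 9\<^sup>2) * real N powr (31/32)"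
    proof (cases "N = 0")
      case False
      then have N: "N \<ge> 1" by simp
      \<comment> \<open>Hence (1 + log N)^2 <= 81 N^(1/4), and the prime powers cost O(N^(3/4)),
        less than the error already present.\<close>
      have "ln (real N) \<le> real N powr (1/8) / (1/8)" using N by (intro ln_powr_bound) auto
      moreover have "1 \<le> real N powr (1/8)" using N by (intro ge_one_powr_ge_zero) auto
      ultimately have "1 + ln (real N) \<le> 9 * real N powr (1/8)" by simp
      then have "(1 + ln (real N))\<^sup>2 \<le> (9 * real N powr (1/8))\<^sup>2"
        using N by (intro power_mono) auto
      then have "4 * sqrt (real N) * (1 + ln (real N))\<^sup>2 \<le> 4 * sqrt (real N) * (9 * real N powr (1/8))\<^sup>2"
        by (intro mult_left_mono) auto
      also have "\<dots> = 4 * 9\<^sup>2 * real N powr (3/4)"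
        using N by (simp add: powr_half_sqrt[symmetric] power2_eq_square powr_add[symmetric])
      also have "\<dots> \<le> 4 * 9\<^sup>2 * real N powr (31/32)"
        using N by (intro mult_left_mono powr_mono) auto
      finally show ?thesis
        using K(2)[of N] mangoldt_minus_log_prime[OF N] by (simp add: algebra_simps)
    qed simp
  qed (use K in auto)
qed

section \<open>Lattice points in quarter annuli\<close>

text \<open>By truncated subtraction, \<open>chord M n\<close> is \<open>0\<close> for \<open>n\<^sup>2 > M\<close>.\<close>

definition chord :: "nat \<Rightarrow> nat \<Rightarrow> real"
  where "chord M n = sqrt (real (M - n\<^sup>2))"

lemma chord_nonneg: "0 \<le> chord M n" by (simp add: chord_def)

lemma chord_antimono: "m \<le> n \<Longrightarrow> chord M n \<le> chord M m"
  unfolding chord_def by (intro real_sqrt_le_mono) (simp add: diff_le_mono2 power_mono)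

text \<open>The chord length decreases in n, so the sum differs from the area of the quarter disc by
  at most the value sqrt M at 0. Any \<open>Q\<close> reaching sqrt M is allowed because later
  chords are 0; thus circles of different radii can share one range.\<close>

lemma quarter_circle_sum:
  assumes Q: "sqrt (real M) < real Q + 1"
  shows "\<bar>(\<Sum>n=1..Q. chord M n) - pi / 4 * real M\<bar> \<le> sqrt (real M)"
proof (cases "M = 0")
  case True
  then show ?thesis by (simp add: chord_def)
next
  case False
  define r where "r = sqrt (real M)"
  have r: "r > 0" "r\<^sup>2 = real M" using False by (auto simp: r_def)
  define h where "h = (\<lambda>x. sqrt (r\<^sup>2 - x\<^sup>2))"
  \<comment> \<open>The area under the circle up to x, with value pi r^2 / 4 at r. The mean value
    theorem on each cell replaces integration; it needs the derivative only in the interior, where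
    arcsin(x / r) is smooth.\<close>
  define F where "F = (\<lambda>x. (x * sqrt (r\<^sup>2 - x\<^sup>2) + r\<^sup>2 * arcsin (x / r)) / 2)"
  have deriv: "(F has_real_derivative h x) (at x)" if x: "0 \<le> x" "x < r" for x
  proof -
    have pos: "r\<^sup>2 - x\<^sup>2 > 0" using x by (simp add: power_strict_mono)
    have xr: "-1 < x / r" "x / r < 1" using x r by (auto simp: field_simps intro: less_le_trans[of _ 0])
    have s: "sqrt (1 - (x / r)\<^sup>2) = h x / r"
    proof -
      have "1 - (x / r)\<^sup>2 = (r\<^sup>2 - x\<^sup>2) / r\<^sup>2" using r(1) by (simp add: power_divide diff_divide_distrib)
      then show ?thesis using r(1) by (simp add: h_def real_sqrt_divide)
    qed
    have hx: "sqrt (r\<^sup>2 - x\<^sup>2) = h x" by (simp add: h_def)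
    have hp: "h x > 0" "h x * h x = r\<^sup>2 - x\<^sup>2" using pos by (auto simp: h_def)
    have "(F has_real_derivative (1 * sqrt (r\<^sup>2 - x\<^sup>2) + x * ((0 - 2 * x) * (inverse (sqrt (r\<^sup>2 - x\<^sup>2)) / 2))
        + r\<^sup>2 * ((1 / r) * inverse (sqrt (1 - (x / r)\<^sup>2)))) / 2) (at x)"
      unfolding F_def using pos xr r
      by (auto intro!: derivative_eq_intros)
    also have "(1 * sqrt (r\<^sup>2 - x\<^sup>2) + x * ((0 - 2 * x) * (inverse (sqrt (r\<^sup>2 - x\<^sup>2)) / 2))
        + r\<^sup>2 * ((1 / r) * inverse (sqrt (1 - (x / r)\<^sup>2)))) / 2 = (h x * h x - x\<^sup>2 + r\<^sup>2) / (2 * h x)"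
      unfolding s hx using hp(1) r(1) by (simp add: field_simps power2_eq_square)
    also have "\<dots> = h x" using hp by (simp add: field_simps power2_eq_square)
    finally show ?thesis .
  qed
  have cont: "continuous_on {0..r} F"
    unfolding F_def using r by (intro continuous_intros) (auto simp: field_simps intro: order_trans[of _ 0])
  have mvt: "(b - a) * h b \<le> F b - F a \<and> F b - F a \<le> (b - a) * h a" if "0 \<le> a" "a \<le> b" "b \<le> r" for a b
  proof (cases "a = b")
    case False
    then have "\<exists>l z. a < z \<and> z < b \<and> (F has_real_derivative l) (at z) \<and> F b - F a = (b - a) * l"
      using that
      by (intro MVT continuous_on_subset[OF cont])
         (auto simp: real_differentiable_def intro!: exI[of _ "h _"] deriv)
    then obtain l z where z: "a < z" "z < b" "(F has_real_derivative l) (at z)" "F b - F a = (b - a) * l"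
      by blast
    have "l = h z" using z that deriv[of z] DERIV_unique by auto
    moreover have "h b \<le> h z" "h z \<le> h a"
      unfolding h_def using z that by (auto intro!: real_sqrt_le_mono power_mono)
    ultimately show ?thesis using z that by (auto intro!: mult_left_mono)
  qed simp
  have hn: "h (real n) = chord M n" if "real n \<le> r" for n
  proof -
    have "(real n)\<^sup>2 \<le> real M" using that r by (metis of_nat_0_le_iff power_mono)
    then have "n\<^sup>2 \<le> M" by (simp flip: of_nat_power)
    then show ?thesis by (simp add: h_def chord_def r of_nat_diff)
  qed
  have zero: "chord M n = 0" if "real n > r" for n
  proof -
    have "(real n)\<^sup>2 > real M" using that r power_strict_mono[of r "real n" 2] by auto
    then have "n\<^sup>2 > M" by (simp flip: of_nat_power)
    then show ?thesis by (simp add: chord_def)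
  qed
  define q where "q = nat \<lfloor>r\<rfloor>"
  have q: "real q \<le> r" "r < real q + 1" using r by (auto simp: q_def)
  have "(\<Sum>n=1..m. chord M n) \<le> F (real m) - F 0 \<and> F (real m) - F 0 \<le> (\<Sum>n<m. chord M n)" if "m \<le> q" for m
    using that
  proof (induction m)
    case (Suc m)
    then show ?case
      using mvt[of "real m" "real (Suc m)"] q(1) hn[of m] hn[of "Suc m"] by simp
  qed simp
  note b = this[OF order_refl]
  have F0: "F 0 = 0" "F r = pi / 4 * real M"
    using r by (simp_all add: F_def)
  have "h (real q) \<ge> 0" "h r = 0" using hn[OF q(1)] by (simp_all add: chord_nonneg h_def)
  moreover have "(r - real q) * h (real q) \<le> 1 * h (real q)"
    using q \<open>h (real q) \<ge> 0\<close> by (intro mult_right_mono) auto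
  ultimately have c: "F (real q) \<le> F r" "F r \<le> F (real q) + chord M q"
    using mvt[of "real q" r] q hn[of q] by auto
  have "(\<Sum>n\<le>q. chord M n) = chord M 0 + (\<Sum>n=1..q. chord M n)"
    by (simp add: atMost_atLeast0 sum.atLeast_Suc_atMost)
  moreover have "(\<Sum>n\<le>q. chord M n) = (\<Sum>n<q. chord M n) + chord M q"
    by (simp add: lessThan_Suc_atMost[symmetric])
  moreover have "chord M 0 = r" by (simp add: chord_def r_def)
  moreover have "(\<Sum>n=1..Q. chord M n) = (\<Sum>n=1..q. chord M n)"
  proof (rule sum.mono_neutral_right)
    have "real q < real Q + 1" using Q q r_def by linarith
    then show "{1..q} \<subseteq> {1..Q}" by auto
    show "\<forall>n\<in>{1..Q} - {1..q}. chord M n = 0" using q by (auto intro!: zero)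
  qed simp
  ultimately show ?thesis using b c F0 by (auto simp: r_def)
qed

text \<open>Each pair (p, m) in the annulus is counted once: by its value n on one side, by its
  prime p on the other.\<close>

lemma sum_r22':
  assumes Q: "sqrt (real (N + H)) < real Q + 1"
  shows "(\<Sum>n=N+1..N+H. r22' n)
    = (\<Sum>p=1..Q. log_prime p * real (card {m. 1 \<le> m \<and> N < p\<^sup>2 + m\<^sup>2 \<and> p\<^sup>2 + m\<^sup>2 \<le> N + H}))"
proof -
  define T where "T = {(p,m). prime p \<and> 1 \<le> m \<and> N < p\<^sup>2 + m\<^sup>2 \<and> p\<^sup>2 + m\<^sup>2 \<le> N + H}"
  have sq: "x \<le> N + H" if "x\<^sup>2 \<le> N + H" for x :: nat
    using that by (metis le_trans power2_nat_le_imp_le order_refl)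
  have "T \<subseteq> {..N+H} \<times> {..N+H}"
  proof
    fix z assume "z \<in> T"
    then obtain p m where z: "z = (p, m)" "p\<^sup>2 \<le> N + H" "m\<^sup>2 \<le> N + H" by (auto simp: T_def)
    show "z \<in> {..N+H} \<times> {..N+H}" using sq[OF z(2)] sq[OF z(3)] z(1) by simp
  qed
  then have fin: "finite T" by (rule finite_subset) simp
  have finm: "finite {m. 1 \<le> m \<and> N < p\<^sup>2 + m\<^sup>2 \<and> p\<^sup>2 + m\<^sup>2 \<le> N + H}" for p
  proof (rule finite_subset)
    show "{m. 1 \<le> m \<and> N < p\<^sup>2 + m\<^sup>2 \<and> p\<^sup>2 + m\<^sup>2 \<le> N + H} \<subseteq> {..N+H}"
    proof
      fix m assume "m \<in> {m. 1 \<le> m \<and> N < p\<^sup>2 + m\<^sup>2 \<and> p\<^sup>2 + m\<^sup>2 \<le> N + H}"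
      then have "m\<^sup>2 \<le> N + H" by simp
      then show "m \<in> {..N+H}" using sq by simp
    qed
  qed simp
  have pQ: "p \<le> Q" if "p\<^sup>2 + m\<^sup>2 \<le> N + H" for p m
  proof -
    have "(real p)\<^sup>2 \<le> real (N + H)" using that by (simp flip: of_nat_power)
    then have "real p \<le> sqrt (real (N + H))" by (rule real_le_rsqrt)
    with Q show ?thesis by linarith
  qed
  have "(\<Sum>n=N+1..N+H. r22' n) = (\<Sum>n\<in>{N+1..N+H}. \<Sum>z\<in>{z\<in>T. (\<lambda>(p,m). p\<^sup>2 + m\<^sup>2) z = n}. (\<lambda>(p,m). ln (real p)) z)"
    unfolding r22'_def by (intro sum.cong refl) (auto simp: T_def)
  also have "\<dots> = (\<Sum>z\<in>T. (\<lambda>(p,m). ln (real p)) z)"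
    by (rule sum.group[OF fin]) (auto simp: T_def)
  also have "T = Sigma {p\<in>{1..Q}. prime p} (\<lambda>p. {m. 1 \<le> m \<and> N < p\<^sup>2 + m\<^sup>2 \<and> p\<^sup>2 + m\<^sup>2 \<le> N + H})"
    using pQ by (auto simp: T_def Suc_le_eq prime_gt_0_nat)
  also have "(\<Sum>z\<in>\<dots>. (\<lambda>(p,m). ln (real p)) z)
      = (\<Sum>p\<in>{p\<in>{1..Q}. prime p}. \<Sum>m\<in>{m. 1 \<le> m \<and> N < p\<^sup>2 + m\<^sup>2 \<and> p\<^sup>2 + m\<^sup>2 \<le> N + H}. ln (real p))"
    using finm by (subst sum.Sigma[symmetric]) auto
  also have "\<dots> = (\<Sum>p\<in>{p\<in>{1..Q}. prime p}. log_prime p * real (card {m. 1 \<le> m \<and> N < p\<^sup>2 + m\<^sup>2 \<and> p\<^sup>2 + m\<^sup>2 \<le> N + H}))"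
    by (intro sum.cong) (auto simp: log_prime_def)
  also have "\<dots> = (\<Sum>p=1..Q. log_prime p * real (card {m. 1 \<le> m \<and> N < p\<^sup>2 + m\<^sup>2 \<and> p\<^sup>2 + m\<^sup>2 \<le> N + H}))"
    by (rule sum.mono_neutral_left) (auto simp: log_prime_def)
  finally show ?thesis .
qed

text \<open>The admissible m fill a half-open interval between two square roots, so their number is
  a difference of two floors, off by less than 1 from the difference of the chords.\<close>

lemma card_annulus_column:
  assumes p: "p\<^sup>2 \<le> N + H"
  shows "\<bar>real (card {m. 1 \<le> m \<and> N < p\<^sup>2 + m\<^sup>2 \<and> p\<^sup>2 + m\<^sup>2 \<le> N + H})
    - (chord (N + H) p - chord N p)\<bar> \<le> 1"
proof -
  define a where "a = N + H - p\<^sup>2"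
  \<comment> \<open>Truncated subtraction: for p^2 > N this is 0, and the lower end of the interval
    then merely enforces m >= 1.\<close>
  define b where "b = N - p\<^sup>2"
  define s where "s = (\<lambda>x::nat. nat \<lfloor>sqrt (real x)\<rfloor>)"
  have s: "m \<le> s x \<longleftrightarrow> m\<^sup>2 \<le> x" for m x
  proof -
    have "m \<le> s x \<longleftrightarrow> real m \<le> sqrt (real x)"
      unfolding s_def by (simp add: le_nat_iff le_floor_iff)
    also have "\<dots> \<longleftrightarrow> (real m)\<^sup>2 \<le> real x"
      using real_le_lsqrt real_sqrt_le_iff[of "(real m)\<^sup>2" "real x"] by simp
    also have "\<dots> \<longleftrightarrow> m\<^sup>2 \<le> x" by (simp flip: of_nat_power)
    finally show ?thesis .
  qed
  have "{m. 1 \<le> m \<and> N < p\<^sup>2 + m\<^sup>2 \<and> p\<^sup>2 + m\<^sup>2 \<le> N + H} = {s b<..s a}"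
  proof (intro set_eqI)
    fix m
    have "m \<in> {s b<..s a} \<longleftrightarrow> \<not> m\<^sup>2 \<le> b \<and> m\<^sup>2 \<le> a"
      by (simp add: s not_le[symmetric])
    also have "\<dots> \<longleftrightarrow> 1 \<le> m \<and> N < p\<^sup>2 + m\<^sup>2 \<and> p\<^sup>2 + m\<^sup>2 \<le> N + H"
    proof (cases "m = 0")
      case False
      then have "0 < m\<^sup>2" by simp
      with False p show ?thesis unfolding a_def b_def by linarith
    qed simp
    finally show "m \<in> {m. 1 \<le> m \<and> N < p\<^sup>2 + m\<^sup>2 \<and> p\<^sup>2 + m\<^sup>2 \<le> N + H} \<longleftrightarrow> m \<in> {s b<..s a}"
      by simp
  qed
  then have card: "card {m. 1 \<le> m \<and> N < p\<^sup>2 + m\<^sup>2 \<and> p\<^sup>2 + m\<^sup>2 \<le> N + H} = s a - s b" by simp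
  have "b \<le> a" by (simp add: a_def b_def)
  then have "s b \<le> s a" unfolding s_def by (intro nat_mono floor_mono) simp
  moreover have "real (s x) \<le> sqrt (real x)" "sqrt (real x) < real (s x) + 1" for x
    by (auto simp: s_def)
  note this[of a] this[of b]
  ultimately show ?thesis
    unfolding card chord_def a_def[symmetric] b_def[symmetric] by (simp add: of_nat_diff)
qed

section \<open>Summation by parts\<close>

lemma abs_sum_by_parts_le:
  fixes w f :: "nat \<Rightarrow> real"
  assumes E: "\<And>n. n \<le> m \<Longrightarrow> \<bar>\<Sum>j=1..n. w j\<bar> \<le> E"
  shows "\<bar>\<Sum>n=1..m. w n * f n\<bar> \<le> E * (\<bar>f m\<bar> + (\<Sum>n=1..<m. \<bar>f n - f (Suc n)\<bar>))"
proof -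
  have eq: "(\<Sum>n=1..m. w n * f n) = (\<Sum>j=1..m. w j) * f m + (\<Sum>n=1..<m. (\<Sum>j=1..n. w j) * (f n - f (Suc n)))"
    by (induction m) (auto simp: algebra_simps sum.atLeastLessThan_Suc split: if_splits)
  have "\<bar>\<Sum>n=1..m. w n * f n\<bar> \<le> \<bar>(\<Sum>j=1..m. w j) * f m\<bar> + \<bar>\<Sum>n=1..<m. (\<Sum>j=1..n. w j) * (f n - f (Suc n))\<bar>"
    unfolding eq by (rule abs_triangle_ineq)
  also have "\<bar>(\<Sum>j=1..m. w j) * f m\<bar> \<le> E * \<bar>f m\<bar>"
    unfolding abs_mult by (intro mult_right_mono E) auto
  also have "\<bar>\<Sum>n=1..<m. (\<Sum>j=1..n. w j) * (f n - f (Suc n))\<bar> \<le> (\<Sum>n=1..<m. E * \<bar>f n - f (Suc n)\<bar>)"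
    by (rule order_trans[OF sum_abs], rule sum_mono, unfold abs_mult, rule mult_right_mono[OF E]) auto
  finally show ?thesis by (simp add: sum_distrib_left distrib_left)
qed

text \<open>The variation telescopes to f 1 - f m, which together with the boundary term f m leaves
  f 1.\<close>

lemma abs_sum_by_parts_decreasing:
  fixes w f :: "nat \<Rightarrow> real"
  assumes E: "\<And>n. n \<le> m \<Longrightarrow> \<bar>\<Sum>j=1..n. w j\<bar> \<le> E"
    and f: "\<And>n. 0 \<le> f n" "\<And>n. f (Suc n) \<le> f n"
  shows "\<bar>\<Sum>n=1..m. w n * f n\<bar> \<le> E * f 1"
proof (cases "m = 0")
  case False
  have "(\<Sum>n=1..<m. \<bar>f n - f (Suc n)\<bar>) = (\<Sum>n=1..<m. - f (Suc n) - (- f n))"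
    using f by (intro sum.cong) auto
  also have "\<dots> = - f m - (- f 1)"
    using False by (intro sum_Suc_diff') auto
  finally show ?thesis using abs_sum_by_parts_le[OF E, of m f] f(1)[of m] by simp
next
  case True
  then show ?thesis using E[of 0] f by simp
qed

text \<open>Boundary term and variation each cost at most f m. Monotonicity is asked only up to
  \<open>m\<close>, because the function to be inserted turns around after sqrt N.\<close>

lemma abs_sum_by_parts_increasing:
  fixes w f :: "nat \<Rightarrow> real"
  assumes E: "\<And>n. n \<le> m \<Longrightarrow> \<bar>\<Sum>j=1..n. w j\<bar> \<le> E"
    and f: "\<And>n. 0 \<le> f n" "\<And>n. n < m \<Longrightarrow> f n \<le> f (Suc n)"
  shows "\<bar>\<Sum>n=1..m. w n * f n\<bar> \<le> 2 * E * f m"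
proof (cases "m = 0")
  case False
  have E0: "0 \<le> E" using E[of 0] by simp
  have "(\<Sum>n=1..<m. \<bar>f n - f (Suc n)\<bar>) = (\<Sum>n=1..<m. f (Suc n) - f n)"
    using f by (intro sum.cong) auto
  also have "\<dots> = f m - f 1"
    using False by (intro sum_Suc_diff') auto
  finally have "\<bar>\<Sum>n=1..m. w n * f n\<bar> \<le> E * (f m + (f m - f 1))"
    using abs_sum_by_parts_le[OF E, of m f] f(1)[of m] by simp
  also have "\<dots> \<le> E * (f m + f m)" using f(1)[of 1] E0 by (intro mult_left_mono) auto
  finally show ?thesis by (simp add: algebra_simps)
next
  case True
  then show ?thesis using E[of 0] f by simp
qed

section \<open>The short interval estimate\<close>

text \<open>Concavity of the square root in terms of increments. With all terms moved to give
  positive sides, squaring reduces it to (b + h) c <= (c + h) b.\<close>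

lemma sqrt_diff_antimono:
  fixes b c h :: real
  assumes "0 \<le> c" "c \<le> b" "0 \<le> h"
  shows "sqrt (b + h) - sqrt b \<le> sqrt (c + h) - sqrt c"
proof -
  have "(b + h) * c \<le> (c + h) * b" using assms by (simp add: algebra_simps mult_right_mono)
  then have "sqrt (b + h) * sqrt c \<le> sqrt (c + h) * sqrt b"
    by (simp flip: real_sqrt_mult)
  then have "(sqrt (b + h) + sqrt c)\<^sup>2 \<le> (sqrt (c + h) + sqrt b)\<^sup>2"
    using assms by (simp add: power2_sum)
  then have "sqrt (b + h) + sqrt c \<le> sqrt (c + h) + sqrt b"
    by (rule power2_le_imp_le) (use assms in auto)
  then show ?thesis by simp
qed

text \<open>The height of the quarter annulus above the abscissa n, that is, f(n) of the
  overview.\<close>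

definition chord_diff :: "nat \<Rightarrow> nat \<Rightarrow> nat \<Rightarrow> real"
  where "chord_diff N H n = chord (N + H) n - chord N n"

lemma chord_diff_nonneg: "0 \<le> chord_diff N H n"
  by (simp add: chord_diff_def chord_def)

text \<open>Equality holds when n^2 = N, at the peak of f.\<close>

lemma chord_diff_le_sqrt: "chord_diff N H n \<le> sqrt (real H)"
proof -
  have "chord (N + H) n \<le> sqrt (real (N - n\<^sup>2) + real H)"
    unfolding chord_def by (intro real_sqrt_le_mono) linarith
  also have "\<dots> \<le> chord N n + sqrt (real H)"
    unfolding chord_def by (rule sqrt_add_le_add_sqrt) auto
  finally show ?thesis by (simp add: chord_diff_def)
qed

lemma chord_diff_eq:
  assumes "n\<^sup>2 \<le> N"
  shows "chord_diff N H n = sqrt (real (N - n\<^sup>2) + real H) - sqrt (real (N - n\<^sup>2))"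
proof -
  have "N + H - n\<^sup>2 = (N - n\<^sup>2) + H" using assms by simp
  then show ?thesis by (simp add: chord_diff_def chord_def)
qed

text \<open>As n grows towards sqrt N both radicands shrink by the same amount, and the increments
  of the square root grow. Beyond sqrt N the lower chord is 0 and the difference falls
  again.\<close>

lemma chord_diff_mono:
  assumes "m \<le> n" "n\<^sup>2 \<le> N"
  shows "chord_diff N H m \<le> chord_diff N H n"
proof -
  have "m\<^sup>2 \<le> n\<^sup>2" using assms by (simp add: power_mono)
  then have "N - n\<^sup>2 \<le> N - m\<^sup>2" and "m\<^sup>2 \<le> N"
    using assms(2) by (auto intro: diff_le_mono2 le_trans simp del: power_mono_iff)
  then show ?thesis
    unfolding chord_diff_eq[OF assms(2)] chord_diff_eq[OF \<open>m\<^sup>2 \<le> N\<close>]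
    by (intro sqrt_diff_antimono) (simp_all only: of_nat_le_iff of_nat_0_le_iff)
qed

lemma chord_diff_le_div:
  assumes D: "0 < D" "D \<le> real N - (real n)\<^sup>2"
  shows "chord_diff N H n \<le> real H / sqrt D"
proof -
  have "(real n)\<^sup>2 \<le> real N" using D by linarith
  then have n: "n\<^sup>2 \<le> N" by (simp flip: of_nat_power)
  define b where "b = real (N - n\<^sup>2)"
  have b: "D \<le> b" using D n by (simp add: b_def of_nat_diff)
  have f: "chord_diff N H n = sqrt (b + real H) - sqrt b" using chord_diff_eq[OF n] by (simp add: b_def)
  have "sqrt D \<le> sqrt (b + real H)" using b by simp
  moreover have "0 \<le> sqrt b" using b D by simp
  ultimately have "sqrt D \<le> sqrt (b + real H) + sqrt b" by linarith
  then have "chord_diff N H n * sqrt D \<le> (sqrt (b + real H) - sqrt b) * (sqrt (b + real H) + sqrt b)"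
    unfolding f using b D by (intro mult_left_mono) auto
  also have "\<dots> = real H" using b D by (simp add: algebra_simps)
  finally show ?thesis using D by (simp add: pos_le_divide_eq)
qed

text \<open>Each circle is treated alone, its chords being monotone over the whole range. The
  cancellation between the circles is lost: for H <= N the bound is of order E sqrt N whatever H
  is.\<close>

lemma weighted_chord_diff_large:
  fixes w :: "nat \<Rightarrow> real"
  assumes E: "\<And>n. n \<le> Q \<Longrightarrow> \<bar>\<Sum>j=1..n. w j\<bar> \<le> E"
  shows "\<bar>\<Sum>n=1..Q. w n * chord_diff N H n\<bar> \<le> E * (sqrt (real (N + H)) + sqrt (real N))"
proof -
  have E0: "0 \<le> E" using E[of 0] by simp
  have "\<bar>\<Sum>n=1..Q. w n * chord M n\<bar> \<le> E * sqrt (real M)" for M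
  proof -
    have "\<bar>\<Sum>n=1..Q. w n * chord M n\<bar> \<le> E * chord M 1"
      by (rule abs_sum_by_parts_decreasing[OF E]) (auto intro: chord_nonneg chord_antimono)
    also have "\<dots> \<le> E * sqrt (real M)"
      using E0 by (intro mult_left_mono) (auto simp: chord_def)
    finally show ?thesis .
  qed
  note this[of "N + H"] this[of N]
  moreover have "(\<Sum>n=1..Q. w n * chord_diff N H n) = (\<Sum>n=1..Q. w n * chord (N + H) n) - (\<Sum>n=1..Q. w n * chord N n)"
    by (simp add: chord_diff_def right_diff_distrib sum_subtractf)
  ultimately show ?thesis by (simp add: distrib_left)
qed

text \<open>The range is cut at m = q - J and at q, the integer part of sqrt N. Up to m, f increases
  and partial summation costs twice its value at m; on the J columns next to sqrt N and on the few
  between q and Q the weights are simply bounded by \<open>L\<close>. A larger \<open>J\<close>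
  helps the first part and harms the second.\<close>

lemma weighted_chord_diff_small:
  fixes w :: "nat \<Rightarrow> real"
  assumes N: "N \<ge> 1" and J: "1 \<le> J" "real J \<le> sqrt (real N)"
    and Q: "Q = nat \<lfloor>sqrt (real (N + H))\<rfloor>"
    and E: "\<And>n. n \<le> Q \<Longrightarrow> \<bar>\<Sum>j=1..n. w j\<bar> \<le> E"
    and L: "\<And>n. 1 \<le> n \<Longrightarrow> n \<le> Q \<Longrightarrow> \<bar>w n\<bar> \<le> L"
  shows "\<bar>\<Sum>n=1..Q. w n * chord_diff N H n\<bar> \<le> 2 * E * (real H / sqrt (sqrt (real N) * real J))
     + L * (2 * sqrt (real H) + 3 * (real H * sqrt (real J / sqrt (real N))) + real H / sqrt (real N) * sqrt (real H))"
proof -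
  define P where "P = sqrt (real N)"
  have P: "P \<ge> 1" "P\<^sup>2 = real N" using N by (auto simp: P_def)
  let ?f = "chord_diff N H"
  define q where "q = nat \<lfloor>P\<rfloor>"
  have q: "real q \<le> P" "P < real q + 1" "1 \<le> q" using P by (auto simp: q_def le_nat_iff)
  have Jq: "J \<le> q" using J unfolding q_def P_def by (simp add: le_nat_floor)
  define m where "m = q - J"
  have qN: "n\<^sup>2 \<le> N" if "n \<le> q" for n
  proof -
    have "(real n)\<^sup>2 \<le> P\<^sup>2" using that q by (intro power_mono) auto
    then show ?thesis unfolding P(2) by (simp flip: of_nat_power)
  qed
  have qQ: "q \<le> Q" unfolding q_def Q P_def by (intro nat_mono floor_mono) simp
  have Qle: "real Q \<le> sqrt (real (N + H))" unfolding Q by simp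
  have L0: "0 \<le> L" using L[of 1] q(3) qQ by fastforce
  \<comment> \<open>With P = sqrt N: P^2 - (P - j)^2 = P j + j (P - j) >= P j.\<close>
  have f_le: "?f (q - j) \<le> real H / sqrt (P * real j)" if j: "1 \<le> j" "j \<le> q" for j
  proof (rule chord_diff_le_div)
    have "real (q - j) \<le> P - real j" using j q by (simp add: of_nat_diff)
    then have "(real (q - j))\<^sup>2 \<le> (P - real j)\<^sup>2" by (intro power_mono) auto
    also have "\<dots> = P\<^sup>2 - P * real j - real j * (P - real j)" by (simp add: power2_eq_square algebra_simps)
    also have "\<dots> \<le> P\<^sup>2 - P * real j" using j q by simp
    finally show "P * real j \<le> real N - (real (q - j))\<^sup>2" unfolding P(2) by simp
  qed (use P j in auto)

  have A: "\<bar>\<Sum>n=1..m. w n * ?f n\<bar> \<le> 2 * E * (real H / sqrt (P * real J))"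
  proof -
    have "\<bar>\<Sum>n=1..m. w n * ?f n\<bar> \<le> 2 * E * ?f m"
      using qQ
      by (intro abs_sum_by_parts_increasing E chord_diff_nonneg chord_diff_mono qN) (auto simp: m_def)
    also have "\<dots> \<le> 2 * E * (real H / sqrt (P * real J))"
      using E[of 0] Jq J f_le[of J] by (intro mult_left_mono) (auto simp: m_def)
    finally show ?thesis .
  qed

  have B: "(\<Sum>n=Suc m..q. ?f n) \<le> sqrt (real H) + 3 * (real H * sqrt (real J / P))"
  proof -
    have "(\<Sum>n=Suc m..q. ?f n) = (\<Sum>j<J. ?f (q - j))"
      by (rule sum.reindex_bij_witness[of _ "\<lambda>j. q - j" "\<lambda>n. q - n"]) (use Jq in \<open>auto simp: m_def\<close>)
    also have "\<dots> = ?f q + (\<Sum>j=1..<J. ?f (q - j))"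
      using J by (simp add: lessThan_atLeast0 sum.atLeast_Suc_lessThan)
    also have "\<dots> \<le> sqrt (real H) + (\<Sum>j=1..<J. real H / sqrt P * real j powr (1/2 - 1))"
    proof (intro add_mono chord_diff_le_sqrt sum_mono)
      fix j assume j: "j \<in> {1..<J}"
      then have "real H / sqrt (P * real j) = real H / sqrt P * real j powr (1/2 - 1)"
        by (simp add: real_sqrt_mult powr_minus_divide powr_half_sqrt)
      then show "?f (q - j) \<le> real H / sqrt P * real j powr (1/2 - 1)"
        using f_le[of j] j Jq by simp
    qed
    also have "(\<Sum>j=1..<J. real H / sqrt P * real j powr (1/2 - 1)) \<le> real H / sqrt P * (\<Sum>j=1..J. real j powr (1/2 - 1))"
      unfolding sum_distrib_left[symmetric] using P by (intro mult_left_mono sum_mono2) auto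
    also have "\<dots> \<le> real H / sqrt P * (real J powr (1/2) / (1/2) + real J powr (1/2 - 1))"
      using P J by (intro mult_left_mono sum_powr_initial_le) auto
    also have "\<dots> \<le> real H / sqrt P * (real J powr (1/2) / (1/2) + real J powr (1/2))"
      using P J by (intro mult_left_mono add_left_mono powr_mono) auto
    also have "\<dots> = 3 * (real H * sqrt (real J / P))"
      by (simp add: powr_half_sqrt real_sqrt_divide)
    finally show ?thesis by simp
  qed

  have C: "(\<Sum>n=Suc q..Q. ?f n) \<le> real H / P * sqrt (real H) + sqrt (real H)"
  proof -
    \<comment> \<open>Since (P + H/P)^2 >= N + H, there are at most H/P + 1 integers beyond q up to
      Q.\<close>
    have "(P + real H / P)\<^sup>2 = P\<^sup>2 + 2 * real H + (real H / P)\<^sup>2" using P by (simp add: power2_sum)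
    then have "sqrt (real (N + H)) \<le> P + real H / P"
      using P by (intro real_le_lsqrt) auto
    then have "real Q - real q \<le> real H / P + 1" using Qle q by linarith
    moreover have "(\<Sum>n=Suc q..Q. ?f n) \<le> (\<Sum>n=Suc q..Q. sqrt (real H))"
      by (intro sum_mono chord_diff_le_sqrt)
    moreover have "(\<Sum>n=Suc q..Q. sqrt (real H)) = (real Q - real q) * sqrt (real H)"
      using qQ by (simp add: of_nat_diff)
    ultimately have "(\<Sum>n=Suc q..Q. ?f n) \<le> (real H / P + 1) * sqrt (real H)"
      by (smt (verit) mult_right_mono real_sqrt_ge_zero of_nat_0_le_iff)
    then show ?thesis by (simp add: distrib_right)
  qed

  have split: "sum g {a..c} = sum g {a..b} + sum g {Suc b..c}" if "a \<le> Suc b" "b \<le> c" for g :: "nat \<Rightarrow> real" and a b c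
    using that by (subst sum.union_disjoint[symmetric]) (auto intro!: sum.cong)
  have "(\<Sum>n=1..Q. w n * ?f n) = (\<Sum>n=1..m. w n * ?f n) + (\<Sum>n=Suc m..Q. w n * ?f n)"
    using qQ by (intro split) (auto simp: m_def)
  moreover have "\<bar>\<Sum>n=Suc m..Q. w n * ?f n\<bar> \<le> L * (\<Sum>n=Suc m..Q. ?f n)"
  proof -
    have "\<bar>\<Sum>n=Suc m..Q. w n * ?f n\<bar> \<le> (\<Sum>n=Suc m..Q. \<bar>w n * ?f n\<bar>)" by (rule sum_abs)
    also have "\<dots> \<le> (\<Sum>n=Suc m..Q. L * ?f n)"
    proof (rule sum_mono)
      fix n assume "n \<in> {Suc m..Q}"
      then have "\<bar>w n\<bar> \<le> L" by (intro L) auto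
      then show "\<bar>w n * ?f n\<bar> \<le> L * ?f n"
        using chord_diff_nonneg[of N H n] by (simp add: abs_mult mult_right_mono)
    qed
    finally show ?thesis by (simp add: sum_distrib_left)
  qed
  moreover have "(\<Sum>n=Suc m..Q. ?f n) = (\<Sum>n=Suc m..q. ?f n) + (\<Sum>n=Suc q..Q. ?f n)"
    using qQ by (intro split) (auto simp: m_def)
  with B C have "(\<Sum>n=Suc m..Q. ?f n) \<le> 2 * sqrt (real H) + 3 * (real H * sqrt (real J / P)) + real H / P * sqrt (real H)"
    by simp
  then have "L * (\<Sum>n=Suc m..Q. ?f n) \<le> L * (2 * sqrt (real H) + 3 * (real H * sqrt (real J / P)) + real H / P * sqrt (real H))"
    using L0 by (intro mult_left_mono)
  ultimately show ?thesis using A unfolding P_def by linarith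
qed

text \<open>In terms of P = sqrt N the weights have partial sums O(P^(31/32)), and every
  contribution is brought down to H P^(-1/128) = H N^(-1/256), up to one logarithm.\<close>

lemma weighted_chord_diff_sum_le:
  fixes K :: real
  assumes K: "K > 0" "\<And>n. \<bar>(\<Sum>j=1..n. log_prime j) - real n\<bar> \<le> K * real n powr (31/32)"
    and N: "N \<ge> 1" and H: "sqrt (real N) \<le> real H" "H \<le> N"
    and Q: "Q = nat \<lfloor>sqrt (real (N + H))\<rfloor>"
  shows "\<bar>\<Sum>n=1..Q. (log_prime n - 1) * chord_diff N H n\<bar>
    \<le> (8 * K + 12) * ((1 + ln (real N)) * (real H * real N powr (-1/256)))"
proof -
  define P where "P = sqrt (real N)"
  have P: "P \<ge> 1" "P\<^sup>2 = real N" using N by (auto simp: P_def)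
  have lnN: "ln (real N) \<ge> 0" using N by simp
  have Ppow: "P powr x = real N powr (x / 2)" for x
    using N by (simp add: P_def powr_half_sqrt[symmetric] powr_powr)
  have H0: "real H \<ge> 1" using H P P_def by linarith
  define X where "X = real H * P powr (-1/128)"
  have X: "X = real H * real N powr (-1/256)" by (simp add: X_def Ppow)
  have X0: "0 \<le> X" by (simp add: X_def)
  have MQ: "sqrt (real (N + H)) \<le> 2 * P"
    unfolding P_def using H by (intro real_le_lsqrt) (auto simp: power_mult_distrib)
  have Q2: "real Q \<le> 2 * P" using MQ unfolding Q by (smt (verit) of_int_floor_le of_nat_0_le_iff of_nat_nat real_sqrt_ge_zero zero_le_floor)
  define E where "E = 2 * K * P powr (31/32)"
  have sumw: "\<bar>\<Sum>j=1..n. log_prime j - 1\<bar> \<le> E" if "n \<le> Q" for n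
  proof -
    have "\<bar>\<Sum>j=1..n. log_prime j - 1\<bar> \<le> K * real n powr (31/32)"
      using K(2)[of n] by (simp add: sum_subtractf)
    also have "\<dots> \<le> K * (2 * P) powr (31/32)"
      using that Q2 K(1) by (intro mult_left_mono powr_mono2) auto
    also have "\<dots> = K * (2 powr (31/32) * P powr (31/32))" using P by (simp add: powr_mult)
    also have "\<dots> \<le> K * (2 powr 1 * P powr (31/32))"
      using K(1) by (intro mult_left_mono mult_right_mono powr_mono) auto
    finally show ?thesis by (simp add: E_def)
  qed
  show ?thesis
  proof (cases "real H \<ge> P powr (127/64)")
    \<comment> \<open>Treating the circles separately costs P^(31/32) * P = P^(127/64 - 1/64), so
      from this threshold on the error is O(H P^(-1/64)).\<close>
    case True
    have "\<bar>\<Sum>n=1..Q. (log_prime n - 1) * chord_diff N H n\<bar> \<le> E * (sqrt (real (N + H)) + sqrt (real N))"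
      by (rule weighted_chord_diff_large[OF sumw])
    also have "\<dots> \<le> E * (2 * P + P)"
      using MQ K(1) by (intro mult_left_mono add_mono) (auto simp: P_def E_def)
    also have "\<dots> = 6 * K * (P powr (31/32) * P powr 1)"
      using P by (simp add: E_def)
    also have "P powr (31/32) * P powr 1 = P powr (127/64) * P powr (-1/64)"
      unfolding powr_add[symmetric] by simp
    also have "6 * K * (P powr (127/64) * P powr (-1/64)) \<le> 6 * K * (real H * P powr (-1/128))"
      using True P K(1) by (intro mult_left_mono[OF mult_mono] powr_mono) auto
    also have "\<dots> = 6 * K * X" by (simp add: X_def)
    also have "\<dots> \<le> (8 * K + 12) * ((1 + ln (real N)) * X)"
      using K(1) X0 lnN mult_right_mono[of 1 "1 + ln (real N)" X] by (intro mult_mono) auto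
    finally show ?thesis by (simp add: X)
  next
    case False
    \<comment> \<open>With J about P^(63/64) the bulk costs P^(31/32) H / sqrt(P J), about H
      P^(-3/128), and the window next to sqrt N about H sqrt(J/P) = H P^(-1/128).\<close>
    define J where "J = nat \<lfloor>P powr (63/64)\<rfloor>"
    have J1: "P powr (63/64) \<ge> 1" using P by (intro ge_one_powr_ge_zero) auto
    have J: "1 \<le> J" "real J \<le> P powr (63/64)" "P powr (63/64) \<le> 2 * real J"
    proof -
      show "1 \<le> J" using J1 by (simp add: J_def le_nat_iff)
      show "real J \<le> P powr (63/64)" by (simp add: J_def)
      have "P powr (63/64) < real J + 1" by (simp add: J_def)
      with \<open>1 \<le> J\<close> show "P powr (63/64) \<le> 2 * real J" by linarith
    qed
    have JP: "real J \<le> P" using J(2) P powr_mono[of "63/64" 1 P] by simp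
    have w: "\<bar>log_prime n - 1\<bar> \<le> 2 * (1 + ln (real N))" if "1 \<le> n" "n \<le> Q" for n
    proof -
      have "real n \<le> 2 * P" using that Q2 by simp
      also have "P \<le> real N" unfolding P(2)[symmetric] by (rule self_le_power[OF P(1)]) simp
      finally have "ln (real n) \<le> ln (2 * real N)" using that N by simp
      also have "\<dots> = ln 2 + ln (real N)" using N by (simp add: ln_mult)
      also have "\<dots> \<le> 1 + ln (real N)" using ln_2_less_1 by simp
      finally show ?thesis using log_prime_nonneg[of n] log_prime_le_ln[of n] lnN by (intro abs_leI) (simp_all add: algebra_simps)
    qed
    have "\<bar>\<Sum>n=1..Q. (log_prime n - 1) * chord_diff N H n\<bar> \<le> 2 * E * (real H / sqrt (P * real J))
     + 2 * (1 + ln (real N)) * (2 * sqrt (real H) + 3 * (real H * sqrt (real J / P)) + real H / P * sqrt (real H))"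
      unfolding P_def using N J(1) JP Q sumw w
      by (intro weighted_chord_diff_small) (auto simp: P_def)
    also have "2 * E * (real H / sqrt (P * real J)) \<le> 8 * K * X"
    proof -
      have "(P powr (127/128) / 2)\<^sup>2 = P powr (127/64) / 4"
        by (simp add: power2_eq_square powr_add[symmetric])
      also have "\<dots> \<le> P * (P powr (63/64) / 2)"
        using P by (simp add: powr_mult_base)
      also have "\<dots> \<le> P * real J" using J P by (intro mult_left_mono) auto
      finally have "P powr (127/128) / 2 \<le> sqrt (P * real J)" by (rule real_le_rsqrt)
      then have "2 * E * (real H / sqrt (P * real J)) \<le> 2 * E * (real H / (P powr (127/128) / 2))"
        using P K(1) J by (intro mult_left_mono frac_le) (auto simp: E_def)
      also have "\<dots> = 8 * K * (real H * (P powr (31/32) * P powr (-127/128)))"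
        by (simp add: E_def powr_minus_divide)
      also have "P powr (31/32) * P powr (-127/128) = P powr (-3/128)" by (simp add: powr_add[symmetric])
      also have "8 * K * (real H * P powr (-3/128)) \<le> 8 * K * (real H * P powr (-1/128))"
        using P K(1) by (intro mult_left_mono powr_mono) auto
      finally show ?thesis by (simp add: X_def)
    qed
    also have "2 * sqrt (real H) + 3 * (real H * sqrt (real J / P)) + real H / P * sqrt (real H) \<le> 2 * X + 3 * X + X"
    proof (intro add_mono mult_left_mono)
      have "P powr (1/128) \<le> P powr (1/2)" using P by (intro powr_mono) auto
      also have "\<dots> = sqrt P" using P by (simp add: powr_half_sqrt)
      also have "\<dots> \<le> sqrt (real H)" using H by (simp add: P_def)
      finally have "sqrt (real H) * P powr (1/128) \<le> sqrt (real H) * sqrt (real H)" by (intro mult_left_mono) auto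
      then have "sqrt (real H) \<le> real H / P powr (1/128)" using P by (simp add: pos_le_divide_eq)
      then show "sqrt (real H) \<le> X" by (simp add: X_def powr_minus_divide)
      have "real J / P \<le> P powr (63/64) / P" using J P by (intro divide_right_mono) auto
      also have "\<dots> = P powr (63/64 - 1)" using P(1) by (simp only: powr_diff) simp
      also have "\<dots> = (P powr (-1/128))\<^sup>2" by (simp add: power2_eq_square powr_add[symmetric])
      finally have "sqrt (real J / P) \<le> P powr (-1/128)" by (intro real_le_lsqrt) auto
      then show "real H * sqrt (real J / P) \<le> X" unfolding X_def by (intro mult_left_mono) auto
      \<comment> \<open>The upper threshold for H enters here: beyond q there are about H/P columns
        of height up to sqrt H.\<close>
      have "sqrt (real H) \<le> P powr (127/128)"
        using False by (intro real_le_lsqrt) (auto simp: power2_eq_square powr_add[symmetric])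
      then have "real H / P * sqrt (real H) \<le> real H / P * P powr (127/128)"
        using P by (intro mult_left_mono) auto
      also have "\<dots> = real H * (P powr (-1) * P powr (127/128))" using P by (simp add: powr_minus_divide)
      also have "P powr (-1) * P powr (127/128) = P powr (-1/128)" unfolding powr_add[symmetric] by simp
      finally show "real H / P * sqrt (real H) \<le> X" by (simp add: X_def)
    qed auto
    also have "8 * K * X \<le> 8 * K * ((1 + ln (real N)) * X)"
      using K(1) X0 lnN mult_right_mono[of 1 "1 + ln (real N)" X] by (intro mult_left_mono) auto
    finally have "\<bar>\<Sum>n=1..Q. (log_prime n - 1) * chord_diff N H n\<bar>
        \<le> 8 * K * ((1 + ln (real N)) * X) + 2 * (1 + ln (real N)) * (2 * X + 3 * X + X)"
      using lnN by simp
    also have "\<dots> = (8 * K + 12) * ((1 + ln (real N)) * X)" by (simp add: algebra_simps)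
    finally show ?thesis by (simp add: X)
  qed
qed

text \<open>Three errors add up: rounding in the columns, at most the sum of log p and so (2K + 2)
  sqrt N; replacing log p by 1; and the two circle sums, sqrt(N + H) + sqrt N <= 3 sqrt N.\<close>

lemma short_interval_estimate:
  fixes K :: real
  assumes K: "K > 0" "\<And>n. \<bar>(\<Sum>j=1..n. log_prime j) - real n\<bar> \<le> K * real n powr (31/32)"
    and N: "N \<ge> 1" and H: "sqrt (real N) \<le> real H" "H \<le> N"
  shows "\<bar>(\<Sum>n=N+1..N+H. r22' n) - pi / 4 * real H\<bar>
    \<le> (2 * K + 5) * sqrt (real N) + (8 * K + 12) * ((1 + ln (real N)) * (real H * real N powr (-1/256)))"
proof -
  define Q where "Q = nat \<lfloor>sqrt (real (N + H))\<rfloor>"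
  have Q1: "sqrt (real (N + H)) < real Q + 1" "real Q \<le> sqrt (real (N + H))" by (simp_all add: Q_def)
  have Q1': "sqrt (real N) < real Q + 1"
    by (rule le_less_trans[OF _ Q1(1)]) simp
  have MQ: "sqrt (real (N + H)) \<le> 2 * sqrt (real N)"
    using H by (intro real_le_lsqrt) (auto simp: power_mult_distrib)
  let ?c = "\<lambda>p. real (card {m. 1 \<le> m \<and> N < p\<^sup>2 + m\<^sup>2 \<and> p\<^sup>2 + m\<^sup>2 \<le> N + H})"
  let ?f = "chord_diff N H"
  have "\<bar>(\<Sum>p=1..Q. log_prime p * ?c p) - (\<Sum>p=1..Q. log_prime p * ?f p)\<bar> \<le> (\<Sum>p=1..Q. log_prime p)"
  proof -
    have "\<bar>(\<Sum>p=1..Q. log_prime p * ?c p) - (\<Sum>p=1..Q. log_prime p * ?f p)\<bar> = \<bar>\<Sum>p=1..Q. log_prime p * (?c p - ?f p)\<bar>"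
      by (simp add: sum_subtractf right_diff_distrib)
    also have "\<dots> \<le> (\<Sum>p=1..Q. \<bar>log_prime p * (?c p - ?f p)\<bar>)" by (rule sum_abs)
    also have "\<dots> \<le> (\<Sum>p=1..Q. log_prime p * 1)"
    proof (rule sum_mono)
      fix p assume "p \<in> {1..Q}"
      then have "real p \<le> sqrt (real (N + H))" using Q1(2) by simp
      then have "(real p)\<^sup>2 \<le> (sqrt (real (N + H)))\<^sup>2" by (intro power_mono) auto
      then have "(real p)\<^sup>2 \<le> real (N + H)" by simp
      then have "p\<^sup>2 \<le> N + H" by (simp flip: of_nat_power)
      from card_annulus_column[OF this]
      show "\<bar>log_prime p * (?c p - ?f p)\<bar> \<le> log_prime p * 1"
        unfolding abs_mult chord_diff_def using log_prime_nonneg[of p] by (intro mult_mono) auto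
    qed
    finally show ?thesis by simp
  qed
  also have "(\<Sum>p=1..Q. log_prime p) \<le> (2 + 2 * K) * sqrt (real N)"
  proof -
    have "(\<Sum>p=1..Q. log_prime p) \<le> real Q + K * real Q powr (31/32)"
      using K(2)[of Q] by linarith
    also have "K * real Q powr (31/32) \<le> K * real Q"
      using K(1) powr_mono[of "31/32" 1 "real Q"] by (cases "Q = 0") (auto intro!: mult_left_mono)
    also have "real Q + K * real Q = (1 + K) * real Q" by (simp add: distrib_right)
    also have "\<dots> \<le> (1 + K) * (2 * sqrt (real N))"
      using K(1) Q1(2) MQ by (intro mult_left_mono) auto
    finally show ?thesis by (simp add: algebra_simps)
  qed
  finally have 1: "\<bar>(\<Sum>n=N+1..N+H. r22' n) - (\<Sum>p=1..Q. log_prime p * ?f p)\<bar> \<le> (2 + 2 * K) * sqrt (real N)"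
    using sum_r22'[OF Q1(1)] by simp
  have 2: "(\<Sum>p=1..Q. log_prime p * ?f p) = (\<Sum>p=1..Q. (log_prime p - 1) * ?f p) + (\<Sum>p=1..Q. ?f p)"
    by (simp add: left_diff_distrib sum_subtractf)
  have 3: "\<bar>(\<Sum>p=1..Q. ?f p) - pi / 4 * real H\<bar> \<le> 3 * sqrt (real N)"
    using quarter_circle_sum[OF Q1(1)] quarter_circle_sum[OF Q1'] MQ
    by (simp add: chord_diff_def sum_subtractf distrib_left)
  have 4: "\<bar>\<Sum>p=1..Q. (log_prime p - 1) * ?f p\<bar>
      \<le> (8 * K + 12) * ((1 + ln (real N)) * (real H * real N powr (-1/256)))"
    by (rule weighted_chord_diff_sum_le[OF K N H Q_def])
  have "(2 + 2 * K) * sqrt (real N) + 3 * sqrt (real N) = (2 * K + 5) * sqrt (real N)"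
    by (simp add: algebra_simps)
  with 1 2 3 4 show ?thesis by linarith
qed

theorem theorem3:
  assumes "Riemann_Hypothesis"
  shows "\<exists>K > (0 :: real). \<forall>H :: nat \<Rightarrow> nat.
    (\<forall>N. 0 < H N) \<longrightarrow>
    filterlim (\<lambda>N. real (H N) / (sqrt (real N) * (ln (real N))\<^sup>2)) at_top sequentially \<longrightarrow>
    (\<lambda>N. real (H N) / real N) \<longlonglongrightarrow> 0 \<longrightarrow>
    (\<forall>\<^sub>F N in sequentially.
      \<bar>(\<Sum>n = N + 1..N + H N. r22' n) - pi / 4 * real (H N)\<bar>
        \<le> K * ((real (H N))\<^sup>2 / real N
               + real (H N) * ln (ln (real N)) / sqrt (ln (real N))))"
proof -
  obtain K where K: "K > 0" "\<And>N. \<bar>(\<Sum>n=1..N. log_prime n) - real N\<bar> \<le> K * real N powr (31/32)"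
    by (rule sum_log_prime_asymp[OF assms]) (rule that)
  show ?thesis
  \<comment> \<open>The sum of the two coefficients 2 K + 5 and 8 K + 12 of
    \<open>short_interval_estimate\<close>.\<close>
  proof (rule exI[of _ "10 * K + 17"], intro conjI allI impI)
    fix H :: "nat \<Rightarrow> nat"
    assume big: "filterlim (\<lambda>N. real (H N) / (sqrt (real N) * (ln (real N))\<^sup>2)) at_top sequentially"
      and small: "(\<lambda>N. real (H N) / real N) \<longlonglongrightarrow> 0"
    have "\<forall>\<^sub>F N in sequentially. real (H N) / (sqrt (real N) * (ln (real N))\<^sup>2) \<ge> 1"
      using big by (simp add: filterlim_at_top)
    moreover have "\<forall>\<^sub>F N in sequentially. real (H N) / real N < 1"
      using small by (rule order_tendstoD) simp
    moreover have "\<forall>\<^sub>F N in sequentially. ln (real N) > 1" by real_asymp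
    \<comment> \<open>For the error O(sqrt N): the growth condition on H gives sqrt N <= H / log^2
      N.\<close>
    moreover have "\<forall>\<^sub>F N in sequentially. 1 / (ln (real N))\<^sup>2 \<le> ln (ln (real N)) / sqrt (ln (real N))" by real_asymp
    \<comment> \<open>For the error from the primes: the power of N outweighs all
      logarithms.\<close>
    moreover have "\<forall>\<^sub>F N in sequentially. (1 + ln (real N)) * real N powr (-1/256) \<le> ln (ln (real N)) / sqrt (ln (real N))" by real_asymp
    ultimately show "\<forall>\<^sub>F N in sequentially.
      \<bar>(\<Sum>n = N + 1..N + H N. r22' n) - pi / 4 * real (H N)\<bar>
        \<le> (10 * K + 17) * ((real (H N))\<^sup>2 / real N + real (H N) * ln (ln (real N)) / sqrt (ln (real N)))"
      using eventually_ge_at_top[of 1]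
    proof eventually_elim
      case (elim N)
      define Y where "Y = ln (ln (real N)) / sqrt (ln (real N))"
      have l2: "(ln (real N))\<^sup>2 > 0" using elim(3) by (intro zero_less_power) linarith
      have Np: "real N > 0" using elim by simp
      have le: "sqrt (real N) * (ln (real N))\<^sup>2 \<le> real (H N)"
        using elim(1) l2 Np by (simp add: pos_le_divide_eq)
      have "sqrt (real N) * 1 \<le> sqrt (real N) * (ln (real N))\<^sup>2"
        using elim(3) by (intro mult_left_mono) (auto intro: one_le_power)
      with le have H1: "sqrt (real N) \<le> real (H N)" by simp
      have H2: "H N \<le> N" using elim(2) Np by (simp add: pos_divide_less_eq)
      have "sqrt (real N) \<le> real (H N) * (1 / (ln (real N))\<^sup>2)"
        using le l2 by (simp add: pos_le_divide_eq)
      also have "\<dots> \<le> real (H N) * Y" using elim(4) by (intro mult_left_mono) (auto simp: Y_def)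
      finally have a: "sqrt (real N) \<le> real (H N) * Y" .
      have "(1 + ln (real N)) * (real (H N) * real N powr (-1/256)) = real (H N) * ((1 + ln (real N)) * real N powr (-1/256))"
        by simp
      also have "\<dots> \<le> real (H N) * Y" using elim(5) by (intro mult_left_mono) (auto simp: Y_def)
      finally have b: "(1 + ln (real N)) * (real (H N) * real N powr (-1/256)) \<le> real (H N) * Y" .
      have "\<bar>(\<Sum>n = N + 1..N + H N. r22' n) - pi / 4 * real (H N)\<bar>
          \<le> (2 * K + 5) * sqrt (real N) + (8 * K + 12) * ((1 + ln (real N)) * (real (H N) * real N powr (-1/256)))"
        using elim(6) by (intro short_interval_estimate[OF K] H1 H2)
      also have "\<dots> \<le> (2 * K + 5) * (real (H N) * Y) + (8 * K + 12) * (real (H N) * Y)"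
        using a b K(1) by (intro add_mono mult_left_mono) auto
      also have "\<dots> = (10 * K + 17) * (real (H N) * Y)" by (simp add: algebra_simps)
      also have "\<dots> \<le> (10 * K + 17) * ((real (H N))\<^sup>2 / real N + real (H N) * Y)"
        using K(1) by (intro mult_left_mono) auto
      finally show ?case by (simp add: Y_def)
    qed
  qed (use K in auto)
qed

end
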